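(* For any fixed framing $\mathcal F\in C_3$, the Lie-algebra-valued 1-form $$\xi_{\mathcal F}=\frac12\sum_{A\in\mathrm{PSL}_2(\mathbb Z)}\bar\vartheta_A\,d\log\lambda_{e_A}=\sum_{e\in\tau_*}\bar\vartheta_e\,d\log\lambda_e\ \in\ \Omega^1(\widetilde{\mathrm{Homeo}_+^n},ppsl_2)$$ is invariant under flips.
   Context: $sl_2=sl_2(\mathbb R)$ has basis $e=\begin{pmatrix}0&1\\0&0\end{pmatrix}$, $f=\begin{pmatrix}0&0\\1&0\end{pmatrix}$, $h=\begin{pmatrix}1&0\\0&-1\end{pmatrix}$; the matrix $\begin{pmatrix}\alpha&\beta\\ \gamma&-\alpha\end{pmatrix}$ is identified with the vector field $\{(\gamma+\beta)\cos\theta+2\alpha\sin\theta+(\gamma-\beta)\}\frac{\partial}{\partial\theta}$ on $\mathbb S^1$ (a global $sl_2$ vector field; it is determined by its values at any three distinct points). The circle $\mathbb S^1=\partial\mathbb D$ is identified with $\hat{\mathbb R}=\mathbb R\cup\{\infty\}$ via $s\mapsto\frac{s-i}{s+i}$. $ppsl_2$ is the Lie algebra of piecewise $sl_2$ vector fields on $\mathbb S^1$ with finitely many pieces and breakpoints in $\hat{\mathbb Q}$. $C_3$ is the set of ordered triples of pairwise distinct points of $\mathbb S^1$; a framing is an element of $C_3$. Farey tesselation: $\mathrm{PSL}_2(\mathbb Z)$ acts on the right on $\hat{\mathbb R}$ by $x.A=\frac{dx-b}{-cx+a}$, $A=\begin{pmatrix}a&b\\c&d\end{pmatrix}$; $e_A$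 is the oriented geodesic in the disk $\mathbb D$ from $0.A$ to $\infty.A$, and $\tau_*$ is the set of underlying unoriented geodesics, a tesselation of $\mathbb D$ by ideal triangles. Wavelets: the mother wavelet $\vartheta\in ppsl_2$ takes values $h+2e$, $-h+2f$, $-h-2f$, $h-2e$ on quadrants I–IV respectively, and $\vartheta_A(\theta.A)=A^{-1}\vartheta(\theta)A$; it depends only on the unoriented edge $x$ underlying $e_A$ and is also written $\vartheta_x$. More generally, for an edge $x$ of any tesselation, which is a diagonal of the ideal quadrilateral formed by its two adjacent triangles, $\vartheta_x$ denotes the vector field which on the arc cut off by each side of this quadrilateral is the $sl_2$ vector field of determinant $-1$ vanishing at the endpoints of that side (the generator of hyperbolic translations along that side), with signs chosen so that $\vartheta_x$ is once continuously differentiable on $\mathbb S^1$, with the overall sign agreeing with that of the mother wavelet (positive $\theta$-derivative at the endpoints of $x$, negative at the other two vertices). The normalization with respect to $\mathcal F=(u,v,w)$ is $\bar\vartheta_x=\vartheta_x-X_x$, where $X_x\in sl_2$ is the global $sl_2$ vector field agreeing with $\vartheta_x$ at $u,v,w$. $\widetilde{\mathrm{Homeo}_+^n}$ is identified with the space $\widetilde{\mathcal{T}ess^n}$ of decorated tesselations of $\mathbb D$ (tesselations with a horocycle at each ideal vertex) having $0,1,\infty$ among their ideal vertices, with coordinates given by the lambda lengths $\lambda_e>0$, $e\in\tau_*$, where $\lambda=\sqrt{\exp \ell}$ with $\ell$ the signed hyperbolic distance between the two horocycles along the corresponding edge. The identity element is the Farey tesselation with its canonical decoration, for which all lambda lengths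 equal $1$. As a Lie-algebra-valued 1-form on the group, $\xi_{\mathcal F}$ is described by right translation from the cotangent space at the identity element, where it is given by the displayed (formal) sum. Flip invariance: the flip along an edge $e\in\tau_*$ replaces $e$ by the other diagonal $f$ of its quadrilateral, giving a tesselation $\tau'=(\tau_*\setminus\{e\})\cup\{f\}$; lambda lengths are related by the Ptolemy equation $ef=ac+bd$, where $a,b,c,d$ are the consecutive sides of the quadrilateral (edges identified with lambda lengths). Letting $\bar\vartheta'_x$ be the wavelets of the edges $x\in\tau'$ computed in $\tau'$ and normalized by the same $\mathcal F$, invariance under the flip means $$\sum_{x\in\tau_*}\bar\vartheta_x\,d\log\lambda_x=\sum_{x\in\tau'}\bar\vartheta'_x\,d\log\lambda_x$$ at the identity element. Here $\bar\vartheta'_x=\bar\vartheta_x$ for every edge $x$ other than $a,b,c,d$ and $e$ or $f$, so this is an equality of finite sums over $\{a,b,c,d,e\}$ and $\{a,b,c,d,f\}$. *)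

theory Defs
  imports "HOL-Analysis.Analysis"
begin

section \<open>Global and piecewise sl2 vector fields on the circle\<close>

abbreviation S1 :: "complex set" where
  "S1 \<equiv> sphere 0 1"

text \<open>
  A vector field on the circle is represented by its coefficient with respect to
  d/d theta, as a function of the point z = cis theta.  By convention this function is 0 off
  the unit circle, so that equality of vector fields is equality of functions.
\<close>

type_synonym vfield = "complex \<Rightarrow> real"

definition mat2 :: "real \<Rightarrow> real \<Rightarrow> real \<Rightarrow> real \<Rightarrow> real^2^2" where
  "mat2 a b c d = vector [vector [a, b], vector [c, d]]"

definition sl2 :: "(real^2^2) set" where
  "sl2 = {X. trace X = 0}"

definition sl_e :: "real^2^2" where "sl_e = mat2 0 1 0 0"
definition sl_f :: "real^2^2" where "sl_f = mat2 0 0 1 0"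
definition sl_h :: "real^2^2" where "sl_h = mat2 1 0 0 (-1)"

definition field_of :: "real^2^2 \<Rightarrow> vfield" where
  "field_of X z =
     (if z \<in> S1
      then (X$2$1 + X$1$2) * Re z + 2 * X$1$1 * Im z + (X$2$1 - X$1$2)
      else 0)"

text \<open>The point \<^term>\<open>None\<close> of \<^typ>\<open>real option\<close> is the point at infinity.\<close>

fun bdry :: "real option \<Rightarrow> complex" where
  "bdry None = 1"
| "bdry (Some s) = (complex_of_real s - \<i>) / (complex_of_real s + \<i>)"

definition Qhat :: "complex set" where
  "Qhat = bdry ` insert None (Some ` \<rat>)"

text \<open>
  No continuity is required, and the values at the finitely many breakpoints are
  unconstrained.
\<close>

definition ppsl2 :: "vfield set" where
  "ppsl2 = {f. (\<forall>z. z \<notin> S1 \<longrightarrow> f z = 0) \<and>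
     (\<exists>B. finite B \<and> B \<subseteq> Qhat \<and>
        (\<forall>C\<in>components (S1 - B). \<exists>X\<in>sl2. \<forall>z\<in>C. f z = field_of X z))}"

definition framings :: "(complex \<times> complex \<times> complex) set" where
  "framings = {(u, v, w). u \<in> S1 \<and> v \<in> S1 \<and> w \<in> S1 \<and> u \<noteq> v \<and> u \<noteq> w \<and> v \<noteq> w}"

definition normalize_at :: "complex \<times> complex \<times> complex \<Rightarrow> vfield \<Rightarrow> vfield" where
  "normalize_at F f = (case F of (u, v, w) \<Rightarrow>
     (\<lambda>z. f z - field_of (THE X. X \<in> sl2 \<and> (\<forall>p\<in>{u, v, w}. field_of X p = f p)) z))"


section \<open>The Farey tesselation\<close>

definition SL2R :: "(real^2^2) set" where
  "SL2R = {A. det A = 1}"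

definition SL2Z :: "(real^2^2) set" where
  "SL2Z = {A \<in> SL2R. \<forall>i j. A$i$j \<in> \<int>}"

definition PSL2Z :: "(real^2^2) set set" where
  "PSL2Z = (\<lambda>A. {A, - A}) ` SL2Z"

fun act :: "real option \<Rightarrow> real^2^2 \<Rightarrow> real option" where
  "act (Some x) A =
     (if - A$2$1 * x + A$1$1 = 0 then None
      else Some ((A$2$2 * x - A$1$2) / (- A$2$1 * x + A$1$1)))"
| "act None A = (if A$2$1 = 0 then None else Some (A$2$2 / (- A$2$1)))"

definition circ_act :: "complex \<Rightarrow> real^2^2 \<Rightarrow> complex" where
  "circ_act z A = bdry (act (inv bdry z) A)"

text \<open>
  A geodesic of the disk is represented by its ideal endpoints: an oriented one by the ordered
  pair, an unoriented one by the two-element set.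
\<close>

type_synonym geodesic = "complex set"

definition oriented_edge :: "real^2^2 \<Rightarrow> complex \<times> complex" where
  "oriented_edge A = (bdry (act (Some 0) A), bdry (act None A))"

definition underlying_edge :: "real^2^2 \<Rightarrow> geodesic" where
  "underlying_edge A = {fst (oriented_edge A), snd (oriented_edge A)}"

text \<open>Functions on SL2(Z) that agree on A and -A descend to PSL2(Z).\<close>

definition descend :: "(real^2^2 \<Rightarrow> 'a) \<Rightarrow> (real^2^2) set \<Rightarrow> 'a" where
  "descend k g = the_elem (k ` g)"

definition farey :: "geodesic set" where
  "farey = descend underlying_edge ` PSL2Z"


section \<open>Wavelets\<close>

text \<open>
  At the four points 1, i, -1, -i where two quadrants meet, the two candidate matrices give
  vector fields vanishing there, so the choice made below is immaterial.
\<close>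

definition mother :: "complex \<Rightarrow> real^2^2" where
  "mother z =
     (if Re z \<ge> 0 \<and> Im z \<ge> 0 then sl_h + 2 *\<^sub>R sl_e
      else if Re z \<le> 0 \<and> Im z \<ge> 0 then - sl_h + 2 *\<^sub>R sl_f
      else if Re z \<le> 0 \<and> Im z \<le> 0 then - sl_h - 2 *\<^sub>R sl_f
      else sl_h - 2 *\<^sub>R sl_e)"

definition wavelet_mat :: "real^2^2 \<Rightarrow> vfield" where
  "wavelet_mat A z =
     field_of (matrix_inv A ** mother (circ_act z (matrix_inv A)) ** A) z"

text \<open>
  Two ideal points joined to each other and to a third one by edges of a tesselation span,
  together with it, a complementary triangle.  So for an edge x of a tesselation the next set
  consists of the third vertices of the two triangles adjacent to x; it is the other diagonal
  of the quadrilateral around x.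
\<close>

definition opposite :: "geodesic set \<Rightarrow> geodesic \<Rightarrow> geodesic" where
  "opposite \<tau> x = {r. r \<notin> x \<and> (\<forall>p\<in>x. {p, r} \<in> \<tau>)}"

definition sides :: "geodesic set \<Rightarrow> geodesic \<Rightarrow> geodesic set" where
  "sides \<tau> x = {{p, r} | p r. p \<in> x \<and> r \<in> opposite \<tau> x}"

definition flip :: "geodesic set \<Rightarrow> geodesic \<Rightarrow> geodesic set" where
  "flip \<tau> x = insert (opposite \<tau> x) (\<tau> - {x})"

text \<open>The sign tells on which side of the oriented chord (or geodesic) from p to q the point z lies.\<close>

definition chord_side :: "complex \<Rightarrow> complex \<Rightarrow> complex \<Rightarrow> real" where
  "chord_side p q z = Im (cnj (q - p) * (z - p))"

text \<open>
  The closed arc cut off by the side s of an ideal polygon with vertex set V: the endpoints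
  of s together with the points that s separates from the remaining vertices.
\<close>

definition cut_off_arc :: "geodesic \<Rightarrow> complex set \<Rightarrow> complex set" where
  "cut_off_arc s V =
     {z \<in> S1. \<forall>p\<in>s. \<forall>q\<in>s. \<forall>v\<in>V. chord_side p q z * chord_side p q v \<le> 0}"

definition is_wavelet :: "geodesic set \<Rightarrow> geodesic \<Rightarrow> vfield \<Rightarrow> bool" where
  "is_wavelet \<tau> x f \<longleftrightarrow>
     (\<forall>z. z \<notin> S1 \<longrightarrow> f z = 0) \<and>
     (\<forall>s\<in>sides \<tau> x. \<exists>X\<in>sl2. det X = -1 \<and> (\<forall>p\<in>s. field_of X p = 0) \<and>
        (\<forall>z\<in>cut_off_arc s (x \<union> opposite \<tau> x). f z = field_of X z)) \<and>
     (\<lambda>t. f (cis t)) C1_differentiable_on UNIV \<and>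
     (\<forall>t. cis t \<in> x \<longrightarrow> deriv (\<lambda>t. f (cis t)) t > 0) \<and>
     (\<forall>t. cis t \<in> opposite \<tau> x \<longrightarrow> deriv (\<lambda>t. f (cis t)) t < 0)"

definition wavelet :: "geodesic set \<Rightarrow> geodesic \<Rightarrow> vfield" where
  "wavelet \<tau> x = (THE f. is_wavelet \<tau> x f)"


section \<open>Decorated tesselations and lambda lengths\<close>

text \<open>
  A point of the space is a pair (phi, rho).  The normalized homeomorphism phi carries the
  Farey tesselation to a tesselation with ideal vertices phi q, q in \<^const>\<open>Qhat\<close>; the
  horocycle at phi q is the Euclidean circle of radius rho q internally tangent to the unit
  circle at phi q.
\<close>

type_synonym dec_tess = "(complex \<Rightarrow> complex) \<times> (complex \<Rightarrow> real)"

definition orientation_preserving_homeo :: "(complex \<Rightarrow> complex) \<Rightarrow> bool" where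
  "orientation_preserving_homeo \<phi> \<longleftrightarrow>
     (\<exists>g :: real \<Rightarrow> real. continuous_on UNIV g \<and> strict_mono g \<and>
        (\<forall>t. g (t + 2 * pi) = g t + 2 * pi) \<and> (\<forall>t. \<phi> (cis t) = cis (g t)))"

definition decorated_tess :: "dec_tess set" where
  "decorated_tess = {(\<phi>, \<rho>).
     orientation_preserving_homeo \<phi> \<and>
     (\<forall>s\<in>{Some 0, Some 1, None}. \<phi> (bdry s) = bdry s) \<and>
     (\<forall>q\<in>Qhat. 0 < \<rho> q \<and> \<rho> q < 1)}"

definition horocycle :: "complex \<Rightarrow> real \<Rightarrow> complex set" where
  "horocycle p r = {z \<in> ball 0 1. dist z (of_real (1 - r) * p) = r}"

text \<open>
  The unit speed geodesic (curvature -1) of the disk from 0.A to infinity.A: the image of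
  the geodesic t \<mapsto> exp(t) i of the upper half plane under A, followed by the Cayley map.
\<close>

definition geodesic_path :: "real^2^2 \<Rightarrow> real \<Rightarrow> complex" where
  "geodesic_path A t =
     (let y = \<i> * of_real (exp t);
          w = (of_real (A$2$2) * y - of_real (A$1$2)) / (- of_real (A$2$1) * y + of_real (A$1$1))
      in (w - \<i>) / (w + \<i>))"

text \<open>
  The difference l of the times at which the geodesic leaves the horoball at its initial point
  and enters the one at its terminal point is the signed distance of the horocycles:
  positive exactly if the horoballs are disjoint.
\<close>

definition signed_horo_dist :: "dec_tess \<Rightarrow> geodesic \<Rightarrow> real" where
  "signed_horo_dist D x = (case D of (\<phi>, \<rho>) \<Rightarrow>
     (THE l. \<exists>u v A t\<^sub>1 t\<^sub>2. x = {u, v} \<and> A \<in> SL2R \<and>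
        oriented_edge A = (\<phi> u, \<phi> v) \<and>
        geodesic_path A t\<^sub>1 \<in> horocycle (\<phi> u) (\<rho> u) \<and>
        geodesic_path A t\<^sub>2 \<in> horocycle (\<phi> v) (\<rho> v) \<and>
        l = t\<^sub>2 - t\<^sub>1))"

text \<open>
  Here x is a pair of points of \<^const>\<open>Qhat\<close>; the edge measured is its image under the
  homeomorphism.
\<close>

definition lambda_length :: "dec_tess \<Rightarrow> geodesic \<Rightarrow> real" where
  "lambda_length D x = sqrt (exp (signed_horo_dist D x))"

text \<open>
  The canonical decoration of the Farey tesselation is the one all of whose lambda lengths are 1.
\<close>

definition is_identity :: "dec_tess \<Rightarrow> bool" where
  "is_identity D \<longleftrightarrow> D \<in> decorated_tess \<and> (\<forall>z\<in>S1. fst D z = z) \<and>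
     (\<forall>e\<in>farey. lambda_length D e = 1)"

text \<open>
  The lambda lengths of the Farey edges are the coordinates on the space, so tangent vectors at
  the identity are represented by curves along which these are differentiable, and the 1-form
  d log lambda is evaluated by differentiating along such a curve.
\<close>

definition curves_at_identity :: "(real \<Rightarrow> dec_tess) set" where
  "curves_at_identity = {c. (\<forall>t. c t \<in> decorated_tess) \<and> is_identity (c 0) \<and>
     (\<forall>e\<in>farey. (\<lambda>t. lambda_length (c t) e) differentiable (at 0))}"

definition dlog_lambda :: "geodesic \<Rightarrow> (real \<Rightarrow> dec_tess) \<Rightarrow> real" where
  "dlog_lambda x c = deriv (\<lambda>t. ln (lambda_length (c t) x)) 0"


section \<open>The 1-form and its invariance under flips\<close>

text \<open>
  A formal sum of the terms k x * dlog_lambda x over the edges x of a tesselation is represented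
  by its family k of coefficients.
\<close>

definition xi :: "complex \<times> complex \<times> complex \<Rightarrow> geodesic set \<Rightarrow> geodesic \<Rightarrow> vfield" where
  "xi F \<tau> x = normalize_at F (wavelet \<tau> x)"

text \<open>
  The coefficients of one half of the formal sum over PSL2(Z), after collecting the terms with
  the same underlying unoriented edge x.
\<close>

definition xi_PSL2Z :: "complex \<times> complex \<times> complex \<Rightarrow> geodesic \<Rightarrow> vfield" where
  "xi_PSL2Z F x =
     (\<lambda>z. 1/2 * (\<Sum>g\<in>{g \<in> PSL2Z. descend underlying_edge g = x}.
                    normalize_at F (descend wavelet_mat g) z))"

text \<open>
  The formal sums for a tesselation and its flip along e agree: the coefficients agree
  at all edges other than the sides of the quadrilateral around e and its two diagonals, and
  what remains is an equality of finite sums of 1-forms.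
\<close>

definition flip_invariant ::
  "(geodesic set \<Rightarrow> geodesic \<Rightarrow> vfield) \<Rightarrow> geodesic set \<Rightarrow> geodesic \<Rightarrow> bool" where
  "flip_invariant k \<tau> e \<longleftrightarrow>
     (let \<tau>' = flip \<tau> e; f = opposite \<tau> e; Q = sides \<tau> e in
       (\<forall>x \<in> \<tau> - insert e Q. k \<tau>' x = k \<tau> x) \<and>
       (\<forall>c \<in> curves_at_identity.
          (\<lambda>z. \<Sum>x\<in>insert e Q. k \<tau> x z * dlog_lambda x c) =
          (\<lambda>z. \<Sum>x\<in>insert f Q. k \<tau>' x z * dlog_lambda x c)))"

end

theory Submission
  imports Defs
begin

text \<open>
  The form is invariant because the change of the wavelets under a flip is dual to the change of
  the lambda lengths given by the Ptolemy equation.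

  Let e = {p, q} be the flipped edge and f = {r, s} the other diagonal of its quadrilateral.  A
  wavelet consists of hyperbolic translations along the sides of a quadrilateral, normalized to
  have derivative 2 at the endpoints of the edge and -2 at the other two vertices.  Therefore the
  wavelet of f is minus the wavelet of e.  For a side of the quadrilateral, the flip moves one of
  the four vertices that define its wavelet.  Since Farey quadrilaterals are harmonic, a
  translation along a diagonal is the mean of the translations along two adjacent sides, and it
  follows that the wavelet of each side changes by half the wavelet of e plus a global sl2 field
  (\<open>quad_field_flip_side\<close>).  Normalization at a framing is linear and annihilates global
  fields (\<open>normalize_at_linear\<close>), so with k the coefficient at e the coefficients become
  -k at f and are increased by k/2 at each of the four sides.

  On the other hand the lambda length of an edge is a chord length times a factor for each of its
  endpoints, so the Ptolemy equation of Euclidean geometry holds for lambda lengths.  At the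
  identity, where all Farey edges have lambda length 1, its logarithmic derivative says that
  dlog f is half the sum of the dlog of the sides, minus dlog e (\<open>dlog_lambda_diagonal\<close>).
  Inserting this into the sum over the sides and f gives back the sum over the sides and e.

  To make this rigorous, the wavelet of an edge is identified with an explicit piecewise field
  (\<open>wavelet_eq_quad_field\<close>), which also serves to compare it with the transport of the
  mother wavelet (\<open>wavelet_mat_eq_wavelet\<close>) and to see that its normalization lies in
  ppsl2.  The combinatorics of the Farey tesselation before and after the flip is read off in
  lattice coordinates adapted to the edge (\<open>farey_quad\<close>).
\<close>

section \<open>Homogeneous coordinates on the circle\<close>

text \<open>
  The boundary point of slope x/y, so that infinity is the direction (1, 0) and needs no separate
  treatment.  Moebius maps become linear maps, orientation and incidence become 2 x 2 determinants,
  and on unit vectors the angle of the point is minus twice the angle of the vector.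
\<close>

definition ideal_pt :: "real \<Rightarrow> real \<Rightarrow> complex" where
  "ideal_pt x y = Complex x (- y) / Complex x y"

lemma Complex_nonzero: "(x, y) \<noteq> (0, 0) \<Longrightarrow> Complex x y \<noteq> 0"
  by (simp add: complex_eq_iff)

lemma sum_squares_nonzero: "(x, y) \<noteq> (0, 0) \<Longrightarrow> (x::real)\<^sup>2 + y\<^sup>2 \<noteq> 0"
  by (simp add: sum_power2_eq_zero_iff)

lemma sum_squares_pos: "(x, y) \<noteq> (0, 0) \<Longrightarrow> (x::real)\<^sup>2 + y\<^sup>2 > 0"
  by (simp add: sum_power2_gt_zero_iff)

lemma ideal_pt_in_S1 [simp]: "(x, y) \<noteq> (0, 0) \<Longrightarrow> ideal_pt x y \<in> S1"
proof -
  assume "(x, y) \<noteq> (0, 0)"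
  then have "sqrt (x\<^sup>2 + y\<^sup>2) \<noteq> 0" by (simp add: sum_power2_eq_zero_iff)
  then show ?thesis by (simp add: ideal_pt_def norm_divide complex_norm)
qed

lemma Re_ideal_pt: "Re (ideal_pt x y) = (x\<^sup>2 - y\<^sup>2) / (x\<^sup>2 + y\<^sup>2)"
  and Im_ideal_pt: "Im (ideal_pt x y) = - (2 * x * y) / (x\<^sup>2 + y\<^sup>2)"
  by (simp_all add: ideal_pt_def Re_divide Im_divide power2_eq_square)

lemma cis_eq_ideal_pt: "cis t = ideal_pt (cos (t/2)) (- sin (t/2))"
proof -
  have "(cos (t/2))\<^sup>2 + (sin (t/2))\<^sup>2 = 1" by simp
  moreover have "cos t = (cos (t/2))\<^sup>2 - (sin (t/2))\<^sup>2"
    using cos_double[of "t/2"] by simp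
  moreover have "sin t = 2 * sin (t/2) * cos (t/2)"
    using sin_double[of "t/2"] by simp
  ultimately show ?thesis
    by (simp add: complex_eq_iff Re_ideal_pt Im_ideal_pt)
qed

lemma half_vec_nonzero: "(cos (t/2), - sin (t/2)) \<noteq> (0::real, 0::real)"
  using sin_zero_norm_cos_one[of "t/2"] by auto

lemma S1_ideal_ptE:
  assumes "z \<in> S1"
  obtains x y where "z = ideal_pt x y" "x\<^sup>2 + y\<^sup>2 = 1"
proof -
  obtain t where "z = cis t"
    using assms rcis_cmod_Arg[of z] by (metis mem_sphere_0 rcis_def mult_1 of_real_1)
  then show ?thesis
    using that[of "cos (t/2)" "- sin (t/2)"] cis_eq_ideal_pt by simp
qed

lemma ideal_pt_diff:
  assumes "(a, b) \<noteq> (0, 0)" "(x, y) \<noteq> (0, 0)"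
  shows "ideal_pt x y - ideal_pt a b
           = - 2 * \<i> * of_real (a * y - b * x) / (Complex x y * Complex a b)"
proof -
  have nz: "Complex a b \<noteq> 0" "Complex x y \<noteq> 0" using assms by (auto simp: Complex_nonzero)
  have "ideal_pt x y - ideal_pt a b =
          (Complex x (-y) * Complex a b - Complex a (-b) * Complex x y) / (Complex x y * Complex a b)"
    using nz by (simp add: ideal_pt_def field_simps)
  also have "Complex x (-y) * Complex a b - Complex a (-b) * Complex x y
               = - 2 * \<i> * of_real (a * y - b * x)"
    by (simp add: complex_eq_iff)
  finally show ?thesis .
qed

lemma ideal_pt_eq_iff:
  assumes "(a, b) \<noteq> (0, 0)" "(x, y) \<noteq> (0, 0)"
  shows "ideal_pt x y = ideal_pt a b \<longleftrightarrow> a * y = b * x"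
proof -
  have nz: "Complex a b \<noteq> 0" "Complex x y \<noteq> 0" using assms by (auto simp: Complex_nonzero)
  have "ideal_pt x y = ideal_pt a b \<longleftrightarrow> ideal_pt x y - ideal_pt a b = 0" by simp
  also have "\<dots> \<longleftrightarrow> (of_real (a * y - b * x) :: complex) = 0"
    unfolding ideal_pt_diff[OF assms] using nz by simp
  also have "\<dots> \<longleftrightarrow> a * y = b * x" unfolding of_real_eq_0_iff by simp
  finally show ?thesis .
qed

lemma ideal_pt_minus [simp]: "ideal_pt (- x) (- y) = ideal_pt x y"
proof -
  have "Complex (-x) (- (-y)) = - Complex x (-y)" "Complex (-x) (-y) = - Complex x y"
    by (simp_all add: complex_eq_iff)
  then show ?thesis unfolding ideal_pt_def by simp
qed

text \<open>
  Each difference of two ideal points is a determinant divided by the two complex vectors, and the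
  imaginary part contributes the third determinant.  Hence the orientation of three points of the
  circle is the sign of the product of the determinants of their direction vectors.
\<close>

lemma chord_side_ideal_pt:
  assumes "(a, b) \<noteq> (0, 0)" "(c, d) \<noteq> (0, 0)" "(x, y) \<noteq> (0, 0)"
  shows "chord_side (ideal_pt a b) (ideal_pt c d) (ideal_pt x y) =
    4 * (a * d - b * c) * (c * y - d * x) * (x * b - y * a)
      / ((a\<^sup>2 + b\<^sup>2) * (c\<^sup>2 + d\<^sup>2) * (x\<^sup>2 + y\<^sup>2))"
proof -
  have nz: "a\<^sup>2 + b\<^sup>2 \<noteq> 0" "c\<^sup>2 + d\<^sup>2 \<noteq> 0" "x\<^sup>2 + y\<^sup>2 \<noteq> 0"
    using assms sum_squares_nonzero by blast+
  \<comment> \<open>Clearing denominators with the three norms kept atomic leaves a polynomial identity.\<close>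
  have common_denominator:
    "(A2/N2 - A1/N1) * (B3/N3 - B1/N1) - (B2/N2 - B1/N1) * (A3/N3 - A1/N1) =
      (A1 * (B2 * N3 - B3 * N2) - B1 * (A2 * N3 - A3 * N2) + N1 * (A2 * B3 - A3 * B2)) / (N1 * N2 * N3)"
    if "N1 \<noteq> 0" "N2 \<noteq> 0" "N3 \<noteq> 0" for A1 A2 A3 B1 B2 B3 N1 N2 N3 :: real
    using that by (simp add: field_simps)
  have "chord_side (ideal_pt a b) (ideal_pt c d) (ideal_pt x y) =
     (Re (ideal_pt c d) - Re (ideal_pt a b)) * (Im (ideal_pt x y) - Im (ideal_pt a b))
      - (Im (ideal_pt c d) - Im (ideal_pt a b)) * (Re (ideal_pt x y) - Re (ideal_pt a b))"
    by (simp add: chord_side_def algebra_simps)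
  also have "\<dots> = ((a\<^sup>2 - b\<^sup>2) * (- (2*c*d) * (x\<^sup>2 + y\<^sup>2) - (- (2*x*y)) * (c\<^sup>2 + d\<^sup>2))
     - (- (2*a*b)) * ((c\<^sup>2 - d\<^sup>2) * (x\<^sup>2 + y\<^sup>2) - (x\<^sup>2 - y\<^sup>2) * (c\<^sup>2 + d\<^sup>2))
     + (a\<^sup>2 + b\<^sup>2) * ((c\<^sup>2 - d\<^sup>2) * (- (2*x*y)) - (x\<^sup>2 - y\<^sup>2) * (- (2*c*d))))
     / ((a\<^sup>2 + b\<^sup>2) * (c\<^sup>2 + d\<^sup>2) * (x\<^sup>2 + y\<^sup>2))"
    unfolding Re_ideal_pt Im_ideal_pt by (rule common_denominator[OF nz])
  also have "(a\<^sup>2 - b\<^sup>2) * (- (2*c*d) * (x\<^sup>2 + y\<^sup>2) - (- (2*x*y)) * (c\<^sup>2 + d\<^sup>2))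
     - (- (2*a*b)) * ((c\<^sup>2 - d\<^sup>2) * (x\<^sup>2 + y\<^sup>2) - (x\<^sup>2 - y\<^sup>2) * (c\<^sup>2 + d\<^sup>2))
     + (a\<^sup>2 + b\<^sup>2) * ((c\<^sup>2 - d\<^sup>2) * (- (2*x*y)) - (x\<^sup>2 - y\<^sup>2) * (- (2*c*d)))
     = 4 * (a * d - b * c) * (c * y - d * x) * (x * b - y * a)"
    by algebra
  finally show ?thesis .
qed

lemma chord_side_swap: "chord_side q p z = - chord_side p q z"
  by (simp add: chord_side_def algebra_simps)

lemma chord_side_self [simp]: "chord_side p q p = 0" "chord_side p q q = 0" "chord_side p p q = 0"
  by (simp_all add: chord_side_def algebra_simps)

lemma chord_side_cis:
  "chord_side (cis a) (cis b) (cis t) = 4 * sin ((b - a)/2) * sin ((t - a)/2) * sin ((t - b)/2)"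
proof -
  have *: "sin ((v - u)/2) = sin (v/2) * cos (u/2) - cos (v/2) * sin (u/2)" for u v :: real
    by (simp add: diff_divide_distrib sin_diff)
  show ?thesis
    unfolding cis_eq_ideal_pt chord_side_ideal_pt[OF half_vec_nonzero half_vec_nonzero half_vec_nonzero]
    unfolding * by (simp add: algebra_simps)
qed

section \<open>Hyperbolic translations as vector fields\<close>

text \<open>
  For points of the circle the quotient is purely imaginary, and twice its imaginary part has
  derivative 2 at p and -2 at q along the circle.  This is the infinitesimal hyperbolic translation
  from p to q.  That the derivative at an endpoint does not depend on the other endpoint is the
  reason why translations along adjacent sides of a polygon fit together differentiably.
\<close>

definition transl :: "complex \<Rightarrow> complex \<Rightarrow> vfield" where
  "transl p q z = (if z \<in> S1 then 2 * Im ((z - p) * (z - q) / (z * (p - q))) else 0)"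

lemma transl_ideal_pt:
  assumes "(a, b) \<noteq> (0, 0)" "(c, d) \<noteq> (0, 0)" "(x, y) \<noteq> (0, 0)"
  shows "transl (ideal_pt a b) (ideal_pt c d) (ideal_pt x y) =
     4 * (a * y - b * x) * (c * y - d * x) / ((a * d - b * c) * (x\<^sup>2 + y\<^sup>2))"
proof (cases "a * d - b * c = 0")
  case True
  then have "ideal_pt a b = ideal_pt c d" using ideal_pt_eq_iff[OF assms(2,1)] by (simp add: algebra_simps)
  then show ?thesis using True by (simp add: transl_def)
next
  case False
  have nz: "Complex a b \<noteq> 0" "Complex c d \<noteq> 0" "Complex x y \<noteq> 0" "Complex x (-y) \<noteq> 0"
    using assms by (auto simp: complex_eq_iff)
  have False': "(of_real (a * d - b * c) :: complex) \<noteq> 0" using False unfolding of_real_eq_0_iff .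
  have norm: "Complex x y * Complex x (-y) = of_real (x\<^sup>2 + y\<^sup>2)"
    by (simp add: complex_eq_iff power2_eq_square)
  have D: "ideal_pt a b - ideal_pt c d = 2 * \<i> * of_real (a * d - b * c) / (Complex a b * Complex c d)"
    unfolding ideal_pt_diff[OF assms(2,1)] by (simp add: algebra_simps)
  have "(ideal_pt x y - ideal_pt a b) * (ideal_pt x y - ideal_pt c d)
           / (ideal_pt x y * (ideal_pt a b - ideal_pt c d))
        = 2 * \<i> * (of_real (a * y - b * x) * of_real (c * y - d * x))
           / (of_real (a * d - b * c) * (Complex x y * Complex x (-y)))"
    unfolding ideal_pt_diff[OF assms(1,3)] ideal_pt_diff[OF assms(2,3)] D
    using nz False' by (simp add: ideal_pt_def[of x y] divide_simps del: of_real_diff of_real_mult)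
  also have "\<dots> = \<i> * of_real (2 * (a * y - b * x) * (c * y - d * x) / ((a * d - b * c) * (x\<^sup>2 + y\<^sup>2)))"
    unfolding norm by simp
  finally show ?thesis
    using ideal_pt_in_S1[OF assms(3)] by (simp only: transl_def if_True) (simp add: mult.assoc)
qed

lemma transl_cis:
  "transl (cis a) (cis b) (cis t) = 4 * sin ((t - a)/2) * sin ((t - b)/2) / sin ((a - b)/2)"
proof -
  have *: "sin ((v - u)/2) = sin (v/2) * cos (u/2) - cos (v/2) * sin (u/2)" for u v :: real
    by (simp add: diff_divide_distrib sin_diff)
  have "(cos (t/2))\<^sup>2 + (- sin (t/2))\<^sup>2 = 1" by simp
  then show ?thesis
    unfolding cis_eq_ideal_pt transl_ideal_pt[OF half_vec_nonzero half_vec_nonzero half_vec_nonzero]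
    unfolding * by (simp add: algebra_simps)
qed

lemma transl_off: "z \<notin> S1 \<Longrightarrow> transl p q z = 0"
  by (simp add: transl_def)

lemma transl_endpoint [simp]: "transl p q p = 0" "transl p q q = 0"
  by (simp_all add: transl_def)

lemma transl_swap: "transl q p z = - transl p q z"
proof -
  have "(z - q) * (z - p) / (z * (q - p)) = - ((z - p) * (z - q) / (z * (p - q)))"
    by (metis minus_diff_eq mult.commute mult_minus_right minus_divide_right)
  then show ?thesis by (simp only: transl_def) simp
qed

section \<open>Cyclic order on the circle\<close>

lemma sin_half_pos_iff: "\<bar>t\<bar> < 2 * pi \<Longrightarrow> 0 < sin (t/2) \<longleftrightarrow> 0 < t"
  and sin_half_neg_iff: "\<bar>t\<bar> < 2 * pi \<Longrightarrow> sin (t/2) < 0 \<longleftrightarrow> t < 0"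
proof -
  have pos: "0 < sin (u/2)" if "0 < u" "u < 2 * pi" for u :: real
    using that by (intro sin_gt_zero) auto
  assume t: "\<bar>t\<bar> < 2 * pi"
  consider "t < 0" | "t = 0" | "0 < t" by linarith
  then have "(0 < sin (t/2) \<longleftrightarrow> 0 < t) \<and> (sin (t/2) < 0 \<longleftrightarrow> t < 0)"
  proof cases
    case 1 then show ?thesis using pos[of "-t"] t by auto
  next
    case 2 then show ?thesis by simp
  next
    case 3 then show ?thesis using pos[of t] t by auto
  qed
  then show "0 < sin (t/2) \<longleftrightarrow> 0 < t" "sin (t/2) < 0 \<longleftrightarrow> t < 0" by auto
qed

text \<open>
  The chord function is a product of three half-angle sines, and a half-angle sine has the sign of
  its argument as long as the angle stays below a full turn.
\<close>

lemma chord_side_cis_neg_iff: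
  assumes "u < v" "v < u + 2 * pi" "\<bar>t - u\<bar> < 2 * pi" "\<bar>t - v\<bar> < 2 * pi"
  shows "chord_side (cis u) (cis v) (cis t) < 0 \<longleftrightarrow> u < t \<and> t < v"
    and "chord_side (cis u) (cis v) (cis t) > 0 \<longleftrightarrow> t < u \<or> v < t"
    and "chord_side (cis u) (cis v) (cis t) \<le> 0 \<longleftrightarrow> u \<le> t \<and> t \<le> v"
proof -
  have "0 < sin ((v - u)/2)" using sin_half_pos_iff[of "v - u"] assms by simp
  moreover note sin_half_pos_iff[OF assms(3)] sin_half_neg_iff[OF assms(3)]
    sin_half_pos_iff[OF assms(4)] sin_half_neg_iff[OF assms(4)]
  ultimately show *: "chord_side (cis u) (cis v) (cis t) < 0 \<longleftrightarrow> u < t \<and> t < v"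
    "chord_side (cis u) (cis v) (cis t) > 0 \<longleftrightarrow> t < u \<or> v < t"
    using assms(1) unfolding chord_side_cis
    by (auto simp: mult_less_0_iff zero_less_mult_iff)
  show "chord_side (cis u) (cis v) (cis t) \<le> 0 \<longleftrightarrow> u \<le> t \<and> t \<le> v"
    using *(2) by linarith
qed

lemma S1_angleE:
  assumes "z \<in> S1"
  obtains t where "a \<le> t" "t < a + 2 * pi" "z = cis t"
proof -
  obtain t0 where t0: "z = cis t0"
    using assms rcis_cmod_Arg[of z] by (metis mem_sphere_0 rcis_def mult_1 of_real_1)
  \<comment> \<open>The number of full turns by which the angle has to be shifted into the window starting at a.\<close>
  define n where "n = \<lfloor>(t0 - a) / (2 * pi)\<rfloor>"
  have "of_int n \<le> (t0 - a) / (2 * pi)" "(t0 - a) / (2 * pi) < of_int n + 1"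
    unfolding n_def by linarith+
  then have "a \<le> t0 - 2 * pi * of_int n" "t0 - 2 * pi * of_int n < a + 2 * pi"
    by (simp_all add: field_simps)
  moreover have "cis (t0 - 2 * pi * of_int n) = cis t0"
    by (simp flip: cis_divide add: cis_multiple_2pi)
  ultimately show ?thesis using that t0 by metis
qed

lemma cis_plus_2pi: "cis (t + 2 * pi) = cis t"
  by (simp flip: cis_mult)

text \<open>
  The arguments are in counterclockwise order; the pairs (p, q) and (r, s) are the diagonals.
  The angles in the definition turn order arguments on the circle into linear inequalities.
\<close>

definition ccw_quad :: "complex \<Rightarrow> complex \<Rightarrow> complex \<Rightarrow> complex \<Rightarrow> bool" where
  "ccw_quad p r q s \<longleftrightarrow> (\<exists>a b c d. a < b \<and> b < c \<and> c < d \<and> d < a + 2 * pi \<and>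
     p = cis a \<and> r = cis b \<and> q = cis c \<and> s = cis d)"

lemma ccw_quad_rotate: "ccw_quad p r q s \<Longrightarrow> ccw_quad r q s p"
  unfolding ccw_quad_def
  apply clarify
  subgoal for a b c d
    apply (rule exI[of _ b], rule exI[of _ c], rule exI[of _ d], rule exI[of _ "a + 2 * pi"])
    apply (simp add: cis_plus_2pi)
    done
  done

lemma ccw_quad_S1: "ccw_quad p r q s \<Longrightarrow> p \<in> S1 \<and> r \<in> S1 \<and> q \<in> S1 \<and> s \<in> S1"
  unfolding ccw_quad_def by auto

lemma ccw_quad_chord_side:
  assumes "ccw_quad p r q s"
  shows "chord_side p r q > 0" "chord_side p r s > 0"
  using assms unfolding ccw_quad_def by (auto simp: chord_side_cis_neg_iff)

lemma ccw_quad_distinct: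
  assumes "ccw_quad p r q s"
  shows "distinct [p, r, q, s]"
proof -
  have "x \<noteq> y \<and> x \<noteq> z" if "ccw_quad x y z w" for x y z w
    using ccw_quad_chord_side(1)[OF that] by auto
  from this[OF assms] this[OF ccw_quad_rotate[OF assms]]
    this[OF ccw_quad_rotate[OF ccw_quad_rotate[OF assms]]]
    this[OF ccw_quad_rotate[OF ccw_quad_rotate[OF ccw_quad_rotate[OF assms]]]]
  show ?thesis by auto
qed

lemma ccw_quad_arcs_cover:
  assumes "ccw_quad p r q s" "z \<in> S1"
  shows "chord_side p r z \<le> 0 \<or> chord_side r q z \<le> 0 \<or> chord_side q s z \<le> 0 \<or> chord_side s p z \<le> 0"
proof -
  obtain a b c d where *: "a < b" "b < c" "c < d" "d < a + 2 * pi"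
    "p = cis a" "r = cis b" "q = cis c" "s = cis d"
    using assms(1) unfolding ccw_quad_def by blast
  obtain t where t: "a \<le> t" "t < a + 2 * pi" "z = cis t" using S1_angleE[OF assms(2)] .
  show ?thesis
    using * t chord_side_cis_neg_iff(3)[of a b t] chord_side_cis_neg_iff(3)[of b c t]
      chord_side_cis_neg_iff(3)[of c d t] chord_side_cis_neg_iff(1)[of a d t] chord_side_swap[of s p z]
    by (cases "t \<le> b"; cases "t \<le> c"; cases "t \<le> d") simp_all
qed

lemma ccw_quad_adjacent_arcs:
  assumes "ccw_quad p r q s" "z \<in> S1" "chord_side p r z \<le> 0" "chord_side r q z \<le> 0"
  shows "z = r"
proof -
  obtain a b c d where *: "a < b" "b < c" "c < d" "d < a + 2 * pi"
    "p = cis a" "r = cis b" "q = cis c" "s = cis d"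
    using assms(1) unfolding ccw_quad_def by blast
  obtain t where t: "a \<le> t" "t < a + 2 * pi" "z = cis t" using S1_angleE[OF assms(2)] .
  have "t = b" using * t assms(3,4) chord_side_cis_neg_iff(3)[of a b t] chord_side_cis_neg_iff(3)[of b c t]
    by simp
  then show ?thesis using * t by simp
qed

lemma ccw_quad_opposite_arcs:
  assumes "ccw_quad p r q s" "z \<in> S1" "chord_side p r z \<le> 0"
  shows "chord_side q s z > 0"
proof -
  obtain a b c d where *: "a < b" "b < c" "c < d" "d < a + 2 * pi"
    "p = cis a" "r = cis b" "q = cis c" "s = cis d"
    using assms(1) unfolding ccw_quad_def by blast
  obtain t where t: "a \<le> t" "t < a + 2 * pi" "z = cis t" using S1_angleE[OF assms(2)] .
  show ?thesis using * t assms(3) chord_side_cis_neg_iff(3)[of a b t] chord_side_cis_neg_iff(2)[of c d t]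
    by simp
qed

text \<open>
  A side of a polygon has all other vertices on one side, so the arc that it cuts off is the closed
  arc on its other side; testing both orientations of the side gives the same condition twice.
\<close>

lemma cut_off_arc_eq:
  assumes "\<forall>v\<in>V. 0 \<le> chord_side p q v" "\<exists>v\<in>V. 0 < chord_side p q v"
  shows "cut_off_arc {p, q} V = {z \<in> S1. chord_side p q z \<le> 0}"
  using assms unfolding cut_off_arc_def
  using chord_side_swap[of q p] by (auto simp: mult_le_0_iff)

section \<open>The vector field of an ideal quadrilateral\<close>

text \<open>
  The nested conditional prefers one of the two functions at a common endpoint of two arcs.  The
  choice is immaterial when the functions agree at the vertices.
  The same gluing serves for the vector field and for its derivative.
\<close>

definition on_arcs ::
  "complex \<Rightarrow> complex \<Rightarrow> complex \<Rightarrow> complex \<Rightarrow> (complex \<Rightarrow> real) \<Rightarrow> (complex \<Rightarrow> real) \<Rightarrow>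
    (complex \<Rightarrow> real) \<Rightarrow> (complex \<Rightarrow> real) \<Rightarrow> complex \<Rightarrow> real" where
  "on_arcs p r q s g\<^sub>1 g\<^sub>2 g\<^sub>3 g\<^sub>4 z =
     (if chord_side p r z \<le> 0 then g\<^sub>1 z
      else if chord_side r q z \<le> 0 then g\<^sub>2 z
      else if chord_side q s z \<le> 0 then g\<^sub>3 z
      else g\<^sub>4 z)"

lemma on_arcs_eq:
  assumes "ccw_quad p r q s" "z \<in> S1"
    and "g\<^sub>1 r = g\<^sub>2 r" "g\<^sub>2 q = g\<^sub>3 q" "g\<^sub>3 s = g\<^sub>4 s" "g\<^sub>4 p = g\<^sub>1 p"
  shows "chord_side p r z \<le> 0 \<Longrightarrow> on_arcs p r q s g\<^sub>1 g\<^sub>2 g\<^sub>3 g\<^sub>4 z = g\<^sub>1 z"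
    and "chord_side r q z \<le> 0 \<Longrightarrow> on_arcs p r q s g\<^sub>1 g\<^sub>2 g\<^sub>3 g\<^sub>4 z = g\<^sub>2 z"
    and "chord_side q s z \<le> 0 \<Longrightarrow> on_arcs p r q s g\<^sub>1 g\<^sub>2 g\<^sub>3 g\<^sub>4 z = g\<^sub>3 z"
    and "chord_side s p z \<le> 0 \<Longrightarrow> on_arcs p r q s g\<^sub>1 g\<^sub>2 g\<^sub>3 g\<^sub>4 z = g\<^sub>4 z"
proof -
  note quads = assms(1) ccw_quad_rotate[OF assms(1)] ccw_quad_rotate[OF ccw_quad_rotate[OF assms(1)]]
    ccw_quad_rotate[OF ccw_quad_rotate[OF ccw_quad_rotate[OF assms(1)]]]
  note adj = quads[THEN ccw_quad_adjacent_arcs, OF assms(2)]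
  note opp = quads[THEN ccw_quad_opposite_arcs, OF assms(2)]
  note e = assms(3-6)
  show "chord_side p r z \<le> 0 \<Longrightarrow> on_arcs p r q s g\<^sub>1 g\<^sub>2 g\<^sub>3 g\<^sub>4 z = g\<^sub>1 z"
    by (simp add: on_arcs_def)
  show "on_arcs p r q s g\<^sub>1 g\<^sub>2 g\<^sub>3 g\<^sub>4 z = g\<^sub>2 z" if "chord_side r q z \<le> 0"
    using adj(1)[OF _ that] that e by (cases "chord_side p r z \<le> 0") (simp_all add: on_arcs_def)
  show "on_arcs p r q s g\<^sub>1 g\<^sub>2 g\<^sub>3 g\<^sub>4 z = g\<^sub>3 z" if "chord_side q s z \<le> 0"
    using opp(3)[OF that] adj(2)[OF _ that] that e
    by (cases "chord_side r q z \<le> 0") (simp_all add: on_arcs_def)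
  show "on_arcs p r q s g\<^sub>1 g\<^sub>2 g\<^sub>3 g\<^sub>4 z = g\<^sub>4 z" if "chord_side s p z \<le> 0"
  proof -
    consider "chord_side p r z \<le> 0" | "chord_side q s z \<le> 0"
      | "chord_side p r z > 0" "chord_side q s z > 0" by linarith
    then show ?thesis
    proof cases
      case 1 then show ?thesis using adj(4)[OF that 1] e by (simp add: on_arcs_def)
    next
      case 2 then show ?thesis
        using adj(3)[OF 2 that] opp(4)[OF that] opp(3)[OF 2] e by (simp add: on_arcs_def)
    next
      case 3 then show ?thesis using opp(4)[OF that] by (simp add: on_arcs_def)
    qed
  qed
qed

text \<open>
  On the arc cut off by each side, the translation along that side, directed away from its endpoint
  on the diagonal p q.  Thus the derivative is 2 at p and q and -2 at r and s.
\<close>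

definition quad_field :: "complex \<Rightarrow> complex \<Rightarrow> complex \<Rightarrow> complex \<Rightarrow> vfield" where
  "quad_field p r q s = on_arcs p r q s (transl p r) (transl q r) (transl q s) (transl p s)"

lemma quad_field_arcs:
  assumes "ccw_quad p r q s" "z \<in> S1"
  shows "chord_side p r z \<le> 0 \<Longrightarrow> quad_field p r q s z = transl p r z"
    and "chord_side r q z \<le> 0 \<Longrightarrow> quad_field p r q s z = transl q r z"
    and "chord_side q s z \<le> 0 \<Longrightarrow> quad_field p r q s z = transl q s z"
    and "chord_side s p z \<le> 0 \<Longrightarrow> quad_field p r q s z = transl p s z"
  unfolding quad_field_def by (simp_all add: on_arcs_eq[OF assms])

lemma quad_field_off: "z \<notin> S1 \<Longrightarrow> quad_field p r q s z = 0"
  by (simp add: quad_field_def on_arcs_def transl_off)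

text \<open>
  Exchanging the roles of the diagonals reverses the direction of the translation on each arc.
  For this reason the wavelet of the new diagonal is minus the wavelet of the old one.
\<close>

lemma quad_field_rotate:
  assumes "ccw_quad p r q s"
  shows "quad_field r q s p z = - quad_field p r q s z"
proof (cases "z \<in> S1")
  case True
  note A = quad_field_arcs[OF assms True] and B = quad_field_arcs[OF ccw_quad_rotate[OF assms] True]
  show ?thesis
    using ccw_quad_arcs_cover[OF assms True]
    by (elim disjE) (simp_all only: A B transl_swap[of r p z] transl_swap[of r q z]
      transl_swap[of s q z] transl_swap[of s p z])
qed (simp add: quad_field_off)

section \<open>Differentiability of the quadrilateral field\<close>

text \<open>
  The derivative of the translation field with respect to the angle, as a function on the circle.
\<close>

definition transl' :: "complex \<Rightarrow> complex \<Rightarrow> complex \<Rightarrow> real" where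
  "transl' p q z = 2 * Re ((z - p * q / z) / (p - q))"

text \<open>
  Both values are independent of the other endpoint, which is what makes the pieces fit at vertices.
\<close>

lemma transl'_endpoint:
  assumes "p \<in> S1" "q \<in> S1" "p \<noteq> q"
  shows "transl' p q p = 2" "transl' p q q = - 2"
proof -
  have "p \<noteq> 0" "q \<noteq> 0" using assms by auto
  then show "transl' p q p = 2" using assms(3) by (simp add: transl'_def)
  have "(q - p) / (p - q) = - 1" using assms(3) by (simp add: divide_simps)
  then show "transl' p q q = - 2" using \<open>q \<noteq> 0\<close> by (simp add: transl'_def)
qed

lemma has_real_derivative_transl:
  "((\<lambda>t. transl p q (cis t)) has_real_derivative transl' p q (cis t)) (at t)"
proof -
  define \<kappa> where "\<kappa> = 1 / (p - q)"
  define \<mu> where "\<mu> = \<kappa> * p * q"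
  have inv: "1 / cis s = cis (- s)" for s by (simp add: inverse_eq_divide flip: cis_inverse)
  have "(cis s - p) * (cis s - q) / (cis s * (p - q)) = \<kappa> * cis s + \<mu> * cis (- s) - \<kappa> * (p + q)" for s
    unfolding inv[symmetric] \<mu>_def \<kappa>_def
    by (cases "p = q") (simp_all add: divide_simps, simp add: algebra_simps)
  then have f: "transl p q (cis s) = 2 * (Re \<kappa> * sin s + Im \<kappa> * cos s - Re \<mu> * sin s + Im \<mu> * cos s - Im (\<kappa> * (p + q)))" for s
    by (simp add: transl_def)
  have "(cis t - p * q / cis t) / (p - q) = \<kappa> * cis t - \<mu> * cis (- t)"
    unfolding inv[symmetric] \<mu>_def \<kappa>_def
    by (simp add: diff_divide_distrib algebra_simps)
  then have f': "transl' p q (cis t) = 2 * (Re \<kappa> * cos t - Im \<kappa> * sin t - Re \<mu> * cos t - Im \<mu> * sin t)"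
    by (simp add: transl'_def)
  show ?thesis
    unfolding f f' by (auto intro!: derivative_eq_intros simp: algebra_simps)
qed

lemma continuous_transl': "continuous_on UNIV (\<lambda>t. transl' p q (cis t))"
  unfolding transl'_def by (cases "p = q") (auto intro!: continuous_intros)

lemma continuous_chord_side: "continuous_on A (\<lambda>t. chord_side p q (cis t))"
  unfolding chord_side_def by (intro continuous_intros)

lemma has_real_derivative_closed_piece:
  fixes f g :: "real \<Rightarrow> real"
  assumes "closed F" "\<And>s. s \<in> F \<Longrightarrow> f s = g s" "t \<in> F \<Longrightarrow> (g has_real_derivative D) (at t)"
  shows "(f has_real_derivative D) (at t within F)"
proof (cases "t \<in> F")
  case True
  have "(g has_real_derivative D) (at t within F)"
    using assms(3)[OF True] by (rule has_field_derivative_at_within)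
  then show ?thesis
    by (rule has_field_derivative_transform_within[OF _ zero_less_one True]) (simp add: assms(2))
next
  case False
  \<comment> \<open>A point off the closed piece is not a limit point of it, so nothing is demanded there.\<close>
  then have "at t within F = bot"
    using assms(1) by (auto simp: trivial_limit_within closed_limpt)
  then show ?thesis by (simp add: has_field_derivative_iff)
qed

lemma has_real_derivative_within_Un:
  fixes f :: "real \<Rightarrow> real"
  assumes "(f has_real_derivative D) (at t within A)" "(f has_real_derivative D) (at t within B)"
  shows "(f has_real_derivative D) (at t within A \<union> B)"
  using assms unfolding has_field_derivative_iff by (simp add: Lim_within_Un)

definition quad_field' :: "complex \<Rightarrow> complex \<Rightarrow> complex \<Rightarrow> complex \<Rightarrow> complex \<Rightarrow> real" where
  "quad_field' p r q s = on_arcs p r q s (transl' p r) (transl' q r) (transl' q s) (transl' p s)"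

lemma quad_field'_arcs:
  assumes "ccw_quad p r q s" "z \<in> S1"
  shows "chord_side p r z \<le> 0 \<Longrightarrow> quad_field' p r q s z = transl' p r z"
    and "chord_side r q z \<le> 0 \<Longrightarrow> quad_field' p r q s z = transl' q r z"
    and "chord_side q s z \<le> 0 \<Longrightarrow> quad_field' p r q s z = transl' q s z"
    and "chord_side s p z \<le> 0 \<Longrightarrow> quad_field' p r q s z = transl' p s z"
proof -
  have S: "p \<in> S1" "r \<in> S1" "q \<in> S1" "s \<in> S1" using ccw_quad_S1[OF assms(1)] by auto
  have ne: "p \<noteq> r" "q \<noteq> r" "q \<noteq> s" "p \<noteq> s" using ccw_quad_distinct[OF assms(1)] by auto
  note e = transl'_endpoint[OF S(1,2) ne(1)] transl'_endpoint[OF S(3,2) ne(2)]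
    transl'_endpoint[OF S(3,4) ne(3)] transl'_endpoint[OF S(1,4) ne(4)]
  show "chord_side p r z \<le> 0 \<Longrightarrow> quad_field' p r q s z = transl' p r z"
    and "chord_side r q z \<le> 0 \<Longrightarrow> quad_field' p r q s z = transl' q r z"
    and "chord_side q s z \<le> 0 \<Longrightarrow> quad_field' p r q s z = transl' q s z"
    and "chord_side s p z \<le> 0 \<Longrightarrow> quad_field' p r q s z = transl' p s z"
    unfolding quad_field'_def by (simp_all add: on_arcs_eq[OF assms] e)
qed

text \<open>
  The four arcs pull back to closed sets covering the line, on each of which the function is smooth.
  At a common endpoint the values and the derivatives agree, so both pasting arguments apply: the
  derivative exists within each closed piece, hence within their union, and it is continuous.
\<close>

lemma quad_field_C1:
  assumes "ccw_quad p r q s"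
  shows has_real_derivative_quad_field:
      "((\<lambda>t. quad_field p r q s (cis t)) has_real_derivative quad_field' p r q s (cis t)) (at t)"
    and continuous_quad_field': "continuous_on UNIV (\<lambda>t. quad_field' p r q s (cis t))"
proof -
  define F where "F u v = {t. chord_side u v (cis t) \<le> 0}" for u v
  have closed: "closed (F u v)" for u v
    unfolding F_def using continuous_chord_side[of UNIV u v]
    by (simp add: closed_Collect_le)
  have S1: "cis t \<in> S1" for t by simp
  have cover: "F p r \<union> F r q \<union> (F q s \<union> F s p) = UNIV"
    using ccw_quad_arcs_cover[OF assms S1] unfolding F_def by auto
  note A = quad_field_arcs[OF assms S1] and A' = quad_field'_arcs[OF assms S1]
  have D: "((\<lambda>t. quad_field p r q s (cis t)) has_real_derivative quad_field' p r q s (cis t)) (at t within F p r)"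
    "((\<lambda>t. quad_field p r q s (cis t)) has_real_derivative quad_field' p r q s (cis t)) (at t within F r q)"
    "((\<lambda>t. quad_field p r q s (cis t)) has_real_derivative quad_field' p r q s (cis t)) (at t within F q s)"
    "((\<lambda>t. quad_field p r q s (cis t)) has_real_derivative quad_field' p r q s (cis t)) (at t within F s p)"
    by (rule has_real_derivative_closed_piece[OF closed, where g = "\<lambda>t. transl _ _ (cis t)"],
        force simp: F_def A, force simp: F_def A' has_real_derivative_transl)+
  show "((\<lambda>t. quad_field p r q s (cis t)) has_real_derivative quad_field' p r q s (cis t)) (at t)"
    using has_real_derivative_within_Un[OF has_real_derivative_within_Un[OF D(1,2)]
        has_real_derivative_within_Un[OF D(3,4)]] unfolding cover .
  have C: "continuous_on (F u v) (\<lambda>t. quad_field' p r q s (cis t))"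
    if "\<And>t. t \<in> F u v \<Longrightarrow> quad_field' p r q s (cis t) = transl' y y' (cis t)" for u v y y'
    using continuous_on_subset[OF continuous_transl'[of y y'] subset_UNIV] that
    by (simp cong: continuous_on_cong)
  have "continuous_on (F p r \<union> F r q \<union> (F q s \<union> F s p)) (\<lambda>t. quad_field' p r q s (cis t))"
    by (intro continuous_on_closed_Un closed_Un closed
        C[where y = p and y' = r] C[where y = q and y' = r]
        C[where y = q and y' = s] C[where y = p and y' = s])
      (simp_all add: F_def A')
  then show "continuous_on UNIV (\<lambda>t. quad_field' p r q s (cis t))" unfolding cover .
qed

section \<open>Wavelets are quadrilateral fields\<close>

lemma mat2_nth [simp]:
  "mat2 a b c d $ 1 $ 1 = a" "mat2 a b c d $ 1 $ 2 = b"
  "mat2 a b c d $ 2 $ 1 = c" "mat2 a b c d $ 2 $ 2 = d"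
  by (simp_all add: mat2_def)

lemma mat2_eta: "mat2 (A$1$1) (A$1$2) (A$2$1) (A$2$2) = A"
  by (simp add: vec_eq_iff forall_2)

lemma sl2_iff: "X \<in> sl2 \<longleftrightarrow> X$2$2 = - X$1$1"
  by (auto simp: sl2_def trace_def sum_2)

lemma field_of_off: "z \<notin> S1 \<Longrightarrow> field_of X z = 0"
  by (simp add: field_of_def)

lemma S1_cisE:
  assumes "z \<in> S1" obtains t where "z = cis t"
  using S1_angleE[OF assms] by metis

lemma sin_half_diff_nonzero:
  assumes "cis a \<noteq> cis b" shows "sin ((b - a)/2) \<noteq> 0"
proof
  assume "sin ((b - a)/2) = 0"
  then have "cos (a/2) * (- sin (b/2)) = (- sin (a/2)) * cos (b/2)"
    by (simp add: diff_divide_distrib sin_diff mult.commute)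
  with assms show False
    unfolding cis_eq_ideal_pt using ideal_pt_eq_iff[OF half_vec_nonzero half_vec_nonzero, of a b]
    by (simp add: algebra_simps)
qed

text \<open>
  Measured from the midpoint of p and q the field is a cosine minus a constant.  This form exhibits
  it as a global sl2 field and makes its determinant visible.
\<close>

lemma transl_cis_centered:
  assumes "cis a \<noteq> cis b"
  shows "transl (cis a) (cis b) (cis t)
           = 2 * (cos (t - (a + b)/2) - cos ((b - a)/2)) / sin ((b - a)/2)"
proof -
  have "2 * (sin ((t - a)/2) * sin ((t - b)/2)) = cos ((b - a)/2) - cos (t - (a + b)/2)"
  proof -
    have "(t - a)/2 - (t - b)/2 = (b - a)/2" "(t - a)/2 + (t - b)/2 = t - (a + b)/2"
      by (simp_all add: field_simps)
    then show ?thesis unfolding sin_times_sin by (simp only:) simp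
  qed
  moreover have "sin ((a - b)/2) = - sin ((b - a)/2)"
    by (metis minus_diff_eq minus_divide_left sin_minus)
  moreover have "4 * u / (- v) = 2 * (w - x) / v" if "2 * u = x - w" for u v w x :: real
  proof -
    have "4 * u = - (2 * (w - x))" using that by simp
    then show ?thesis by (metis minus_divide_divide)
  qed
  ultimately show ?thesis unfolding transl_cis mult.assoc by metis
qed

lemma transl_in_sl2:
  assumes "p \<in> S1" "q \<in> S1" "p \<noteq> q"
  obtains X where "X \<in> sl2" "det X = - 1" "transl p q = field_of X"
proof -
  obtain a b where ab: "p = cis a" "q = cis b" using assms by (metis S1_cisE)
  define m \<delta> where "m = (a + b)/2" and "\<delta> = (b - a)/2"
  have sin: "sin \<delta> \<noteq> 0" using sin_half_diff_nonzero assms(3) ab unfolding \<delta>_def by blast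
  define X where "X = mat2 (sin m / sin \<delta>) ((cos m + cos \<delta>) / sin \<delta>) ((cos m - cos \<delta>) / sin \<delta>) (- sin m / sin \<delta>)"
  \<comment> \<open>Midpoint m and half-width d: the field is 2 (cos (t - m) - cos d) / sin d, whose coefficients are read off.\<close>
  have "(sin m)\<^sup>2 + (cos m)\<^sup>2 = 1" "(sin \<delta>)\<^sup>2 + (cos \<delta>)\<^sup>2 = 1" by simp_all
  then have "sin m * sin m + (cos m + cos \<delta>) * (cos m - cos \<delta>) = sin \<delta> * sin \<delta>" by algebra
  moreover have "det X = - ((sin m * sin m + (cos m + cos \<delta>) * (cos m - cos \<delta>)) / (sin \<delta> * sin \<delta>))"
  proof -
    have "(u / k) * (- u / k) - (v / k) * (w / k) = - ((u * u + v * w) / (k * k))" for u v w k :: real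
      by (simp add: add_divide_distrib)
    then show ?thesis unfolding X_def det_2 mat2_nth .
  qed
  ultimately have "det X = - (sin \<delta> * sin \<delta> / (sin \<delta> * sin \<delta>))" by simp
  also have "\<dots> = - 1" using sin by simp
  finally have "det X = - 1" .
  moreover have "transl p q z = field_of X z" for z
  proof (cases "z \<in> S1")
    case True
    then obtain t where t: "z = cis t" by (metis S1_cisE)
    have "cos (t - m) = cos t * cos m + sin t * sin m" by (simp add: cos_diff)
    then show ?thesis
      using assms(3) unfolding t ab
      by (simp add: transl_cis_centered field_of_def X_def field_simps add_divide_distrib[symmetric] flip: m_def \<delta>_def)
  qed (simp add: transl_off field_of_off)
  moreover have "X \<in> sl2" by (simp add: sl2_iff X_def)
  ultimately show ?thesis using that by blast
qed

text \<open>
  A global field is a trigonometric polynomial of degree one.  Two zeros determine it up to a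
  factor, and the determinant fixes the factor up to sign.
\<close>

lemma field_of_eq_transl:
  assumes "X \<in> sl2" "det X = - 1" "p \<in> S1" "q \<in> S1" "p \<noteq> q" "field_of X p = 0" "field_of X q = 0"
  shows "\<exists>\<sigma>::real. \<forall>z. field_of X z = \<sigma> * transl p q z \<and> \<bar>\<sigma>\<bar> = 1"
proof -
  obtain a b where ab: "p = cis a" "q = cis b" using assms by (metis S1_cisE)
  define m \<delta> where "m = (a + b)/2" and "\<delta> = (b - a)/2"
  have sin: "sin \<delta> \<noteq> 0" using sin_half_diff_nonzero assms ab unfolding \<delta>_def by blast
  define A B C where "A = X$2$1 + X$1$2" and "B = 2 * X$1$1" and "C = X$2$1 - X$1$2"
  have field: "field_of X (cis t) = A * cos t + B * sin t + C" for t
    by (simp add: field_of_def A_def B_def C_def)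
  \<comment> \<open>Rotating the coordinates so that the two zeros lie symmetrically about angle 0.\<close>
  define A' B' where "A' = A * cos m + B * sin m" and "B' = B * cos m - A * sin m"
  have cm: "(cos m)\<^sup>2 + (sin m)\<^sup>2 = 1" by simp
  have field': "field_of X (cis t) = A' * cos (t - m) + B' * sin (t - m) + C" for t
    unfolding field A'_def B'_def cos_diff sin_diff using cm by algebra
  have "A' * cos \<delta> - B' * sin \<delta> + C = 0" "A' * cos \<delta> + B' * sin \<delta> + C = 0"
  proof -
    have "a - m = - \<delta>" "b - m = \<delta>" by (simp_all add: m_def \<delta>_def field_simps)
    then show "A' * cos \<delta> - B' * sin \<delta> + C = 0" "A' * cos \<delta> + B' * sin \<delta> + C = 0"
      using assms(6,7) unfolding ab field' by simp_all
  qed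
  then have C: "C = - A' * cos \<delta>" and "B' * sin \<delta> = 0" by linarith+
  with sin have B': "B' = 0" by simp
  \<comment> \<open>This quadratic form is minus four times the determinant and is invariant under the rotation.\<close>
  have "A'\<^sup>2 + B'\<^sup>2 - C\<^sup>2 = 4"
  proof -
    have "A'\<^sup>2 + B'\<^sup>2 = A\<^sup>2 + B\<^sup>2" unfolding A'_def B'_def using cm by algebra
    moreover have "A\<^sup>2 + B\<^sup>2 - C\<^sup>2 = - 4 * det X"
      using assms(1) by (simp add: A_def B_def C_def det_2 sl2_iff power2_eq_square algebra_simps)
    ultimately show ?thesis using assms(2) by simp
  qed
  moreover have "A'\<^sup>2 * ((sin \<delta>)\<^sup>2 + (cos \<delta>)\<^sup>2) = A'\<^sup>2" by simp
  then have "A'\<^sup>2 * (sin \<delta>)\<^sup>2 + A'\<^sup>2 * (cos \<delta>)\<^sup>2 = A'\<^sup>2" by (simp only: distrib_left)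
  ultimately have "A'\<^sup>2 * (sin \<delta>)\<^sup>2 = 4" unfolding C B' by (simp add: power_mult_distrib)
  then have "(A' * sin \<delta> / 2)\<^sup>2 = 1" by (simp add: power_mult_distrib power_divide)
  then have "\<bar>A' * sin \<delta> / 2\<bar> = 1" by (metis abs_1 power2_eq_iff abs_minus_cancel one_power2)
  moreover have "field_of X z = (A' * sin \<delta> / 2) * transl p q z" for z
  proof (cases "z \<in> S1")
    case True
    then obtain t where t: "z = cis t" by (metis S1_cisE)
    show ?thesis
      using assms(5) sin unfolding t ab field' C B'
      by (simp add: transl_cis_centered field_simps flip: m_def \<delta>_def)
  qed (simp add: transl_off field_of_off)
  ultimately show ?thesis by blast
qed

text \<open>
  The conditions on a wavelet leave only a sign on each arc.  Every side has an endpoint y on the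
  edge x itself, where the derivative is required to be positive, and this decides the sign.
\<close>

lemma wavelet_on_side:
  assumes wav: "is_wavelet \<tau> x f"
    and side: "{p, r} \<in> sides \<tau> x" and S1: "p \<in> S1" "r \<in> S1"
    and left: "\<forall>v\<in>x \<union> opposite \<tau> x. 0 \<le> chord_side p r v" "\<exists>v\<in>x \<union> opposite \<tau> x. 0 < chord_side p r v"
    and y: "{y, y'} = {p, r}" "y \<in> x"
    and z: "z \<in> S1" "chord_side p r z \<le> 0"
  shows "f z = transl y y' z"
proof -
  have "p \<noteq> r" using left(2) by auto
  then have "y \<noteq> y'" "y \<in> S1" "y' \<in> S1" using y S1 by (auto simp: doubleton_eq_iff)
  obtain a where a: "p = cis a" using S1 S1_cisE by metis
  obtain b where b: "a \<le> b" "b < a + 2 * pi" "r = cis b" using S1_angleE[OF S1(2)] .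
  then have "a < b" using \<open>p \<noteq> r\<close> a by (cases "a = b") auto
  obtain X where X: "X \<in> sl2" "det X = - 1" "\<forall>p\<in>{p, r}. field_of X p = 0"
    "\<forall>z\<in>cut_off_arc {p, r} (x \<union> opposite \<tau> x). f z = field_of X z"
    using wav side unfolding is_wavelet_def by blast
  have zero: "field_of X y = 0" "field_of X y' = 0" using X(3) y(1) by auto
  obtain \<sigma> where \<sigma>: "\<And>z. field_of X z = \<sigma> * transl y y' z" "\<bar>\<sigma>\<bar> = 1"
    using field_of_eq_transl[OF X(1,2) \<open>y \<in> S1\<close> \<open>y' \<in> S1\<close> \<open>y \<noteq> y'\<close> zero] by auto
  have f: "f z = \<sigma> * transl y y' z" if "z \<in> S1" "chord_side p r z \<le> 0" for z
    using X(4) that \<sigma>(1) unfolding cut_off_arc_eq[OF left] by auto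
  obtain t0 where t0: "t0 \<in> {a..b}" "y = cis t0" proof -
    have "y = p \<or> y = r" using y(1) by auto
    then show ?thesis using that[of a] that[of b] a b(3) \<open>a < b\<close> by auto
  qed
  obtain D where D: "((\<lambda>t. f (cis t)) has_real_derivative D) (at t0)"
    using wav unfolding is_wavelet_def C1_differentiable_on_def
    unfolding has_real_derivative_iff_has_vector_derivative by blast
  then have "D > 0" using wav y(2) t0(2) unfolding is_wavelet_def by (metis DERIV_imp_deriv)
  have "((\<lambda>t. \<sigma> * transl y y' (cis t)) has_real_derivative \<sigma> * transl' y y' (cis t0)) (at t0)"
    by (intro DERIV_cmult has_real_derivative_transl)
  then have "((\<lambda>t. \<sigma> * transl y y' (cis t)) has_real_derivative \<sigma> * 2) (at t0 within {a..b})"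
    using transl'_endpoint(1)[OF \<open>y \<in> S1\<close> \<open>y' \<in> S1\<close> \<open>y \<noteq> y'\<close>] t0(2) has_field_derivative_at_within by metis
  then have "((\<lambda>t. f (cis t)) has_real_derivative \<sigma> * 2) (at t0 within {a..b})"
  proof (rule has_field_derivative_transform_within[OF _ zero_less_one t0(1)])
    fix t assume "t \<in> {a..b}"
    then have "chord_side p r (cis t) \<le> 0"
      unfolding a b(3) using chord_side_cis_neg_iff(3)[of a b t] \<open>a < b\<close> b(2) by auto
    then show "\<sigma> * transl y y' (cis t) = f (cis t)" using f by simp
  qed
  moreover have "((\<lambda>t. f (cis t)) has_real_derivative D) (at t0 within {a..b})"
    using D by (rule has_field_derivative_at_within)
  \<comment> \<open>The one-sided derivative along the arc at y, where the translation has derivative 2, must be the two-sided one.\<close>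
  ultimately have "D = \<sigma> * 2"
    using vector_derivative_unique_within_closed_interval[of a b t0] \<open>a < b\<close> t0(1)
    unfolding has_real_derivative_iff_has_vector_derivative by (metis cbox_interval)
  with \<open>D > 0\<close> \<sigma>(2) have "\<sigma> = 1" by auto
  with f[OF z] show ?thesis by simp
qed

text \<open>
  Existence is the differentiability of the quadrilateral field; uniqueness holds arc by arc.
\<close>

lemma wavelet_eq_quad_field:
  assumes ccw: "ccw_quad p r q s" and x: "x = {p, q}" and opp: "opposite \<tau> x = {r, s}"
  shows "wavelet \<tau> x = quad_field p r q s"
proof -
  note quads = ccw ccw_quad_rotate[OF ccw] ccw_quad_rotate[OF ccw_quad_rotate[OF ccw]]
    ccw_quad_rotate[OF ccw_quad_rotate[OF ccw_quad_rotate[OF ccw]]]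
  note pos = quads[THEN ccw_quad_chord_side(1)] quads[THEN ccw_quad_chord_side(2)]
  have S: "p \<in> S1" "r \<in> S1" "q \<in> S1" "s \<in> S1" using ccw_quad_S1[OF ccw] by auto
  have ne: "p \<noteq> r" "q \<noteq> r" "q \<noteq> s" "p \<noteq> s" using ccw_quad_distinct[OF ccw] by auto
  have sides: "sides \<tau> x = {{p, r}, {r, q}, {q, s}, {s, p}}"
    unfolding sides_def opp unfolding x by auto
  have vertices: "x \<union> opposite \<tau> x = {p, q, r, s}" unfolding opp unfolding x by auto
  have left: "\<forall>v\<in>x \<union> opposite \<tau> x. 0 \<le> chord_side u w v" "\<exists>v\<in>x \<union> opposite \<tau> x. 0 < chord_side u w v"
    if uw: "(u, w) \<in> {(p, r), (r, q), (q, s), (s, p)}" for u w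
  proof -
    consider "u = p" "w = r" | "u = r" "w = q" | "u = q" "w = s" | "u = s" "w = p" using uw by auto
    then show "\<forall>v\<in>x \<union> opposite \<tau> x. 0 \<le> chord_side u w v" "\<exists>v\<in>x \<union> opposite \<tau> x. 0 < chord_side u w v"
      using pos unfolding vertices by (cases; simp add: less_imp_le)+
  qed

  have arc: "cut_off_arc {u, w} (x \<union> opposite \<tau> x) = {z \<in> S1. chord_side u w z \<le> 0}"
    if "(u, w) \<in> {(p, r), (r, q), (q, s), (s, p)}" for u w
    using cut_off_arc_eq[OF left[OF that]] .
  have "is_wavelet \<tau> x (quad_field p r q s)"
  proof -
    have side: "\<exists>X\<in>sl2. det X = -1 \<and> (\<forall>p\<in>{u, w}. field_of X p = 0) \<and>
        (\<forall>z\<in>cut_off_arc {u, w} (x \<union> opposite \<tau> x). quad_field p r q s z = field_of X z)"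
      if uw: "(u, w) \<in> {(p, r), (r, q), (q, s), (s, p)}" and y: "y \<in> S1" "y' \<in> S1" "y \<noteq> y'" and eq: "{u, w} = {y, y'}"
        and on_arc: "\<And>z. z \<in> S1 \<Longrightarrow> chord_side u w z \<le> 0 \<Longrightarrow> quad_field p r q s z = transl y y' z"
      for u w y y'
    proof -
      obtain X where "X \<in> sl2" "det X = - 1" "transl y y' = field_of X" using transl_in_sl2[OF y] .
      then show ?thesis using on_arc unfolding arc[OF uw] unfolding eq
        by (intro bexI[of _ X]) (auto simp flip: \<open>transl y y' = field_of X\<close>)
    qed
    note arcs = quad_field_arcs[OF ccw]
    have "\<forall>u\<in>sides \<tau> x. \<exists>X\<in>sl2. det X = -1 \<and> (\<forall>p\<in>u. field_of X p = 0) \<and>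
        (\<forall>z\<in>cut_off_arc u (x \<union> opposite \<tau> x). quad_field p r q s z = field_of X z)"
      unfolding sides
      using side[of p r p r, OF _ S(1,2) ne(1)] side[of r q q r, OF _ S(3,2) ne(2)]
        side[of q s q s, OF _ S(3,4) ne(3)] side[of s p p s, OF _ S(1,4) ne(4)]
      by (simp add: arcs insert_commute)
    moreover have "(\<lambda>t. quad_field p r q s (cis t)) C1_differentiable_on UNIV"
      unfolding C1_differentiable_on_def
      using quad_field_C1[OF ccw] unfolding has_real_derivative_iff_has_vector_derivative
      by (intro exI[of _ "\<lambda>t. quad_field' p r q s (cis t)"]) simp
    moreover have "deriv (\<lambda>t. quad_field p r q s (cis t)) t = quad_field' p r q s (cis t)" for t
      using has_real_derivative_quad_field[OF ccw] by (rule DERIV_imp_deriv)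
    moreover have "quad_field' p r q s p = 2" "quad_field' p r q s q = 2"
      "quad_field' p r q s r = - 2" "quad_field' p r q s s = - 2"
      using quad_field'_arcs[OF ccw S(1)] quad_field'_arcs[OF ccw S(2)] quad_field'_arcs[OF ccw S(3)]
        quad_field'_arcs[OF ccw S(4)] S ne by (simp_all add: transl'_endpoint)
    ultimately show ?thesis
      unfolding is_wavelet_def opp by (auto simp: quad_field_off x)
  qed
  moreover have "f = quad_field p r q s" if f: "is_wavelet \<tau> x f" for f
  proof
    fix z show "f z = quad_field p r q s z"
    proof (cases "z \<in> S1")
      case True
      note arcs = quad_field_arcs[OF ccw True]
      have "f z = transl y y' z"
        if "(u, w) \<in> {(p, r), (r, q), (q, s), (s, p)}" "{y, y'} = {u, w}" "y \<in> x" "chord_side u w z \<le> 0"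
        for u w y y'
      proof -
        have "{u, w} \<in> sides \<tau> x" "u \<in> S1" "w \<in> S1" using that(1) S unfolding sides by auto
        then show ?thesis using wavelet_on_side[OF f _ _ _ left[OF that(1)] that(2,3) True that(4)] by blast
      qed
      from this[of p r p r] this[of r q q r] this[of q s q s] this[of s p p s]
      show ?thesis
        using ccw_quad_arcs_cover[OF ccw True] arcs x by (auto simp: insert_commute)
    next
      case False
      then show ?thesis using f quad_field_off unfolding is_wavelet_def by simp
    qed
  qed
  ultimately show ?thesis unfolding wavelet_def by (intro the_equality)
qed

section \<open>Normalization\<close>

lemma field_of_linear: "field_of (\<alpha> *\<^sub>R X + \<beta> *\<^sub>R Y) z = \<alpha> * field_of X z + \<beta> * field_of Y z"
  by (simp add: field_of_def algebra_simps)

lemma sl2_linear: "X \<in> sl2 \<Longrightarrow> Y \<in> sl2 \<Longrightarrow> \<alpha> *\<^sub>R X + \<beta> *\<^sub>R Y \<in> sl2"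
  by (simp add: sl2_iff)

lemma transl_eq_0_iff:
  assumes "p \<in> S1" "q \<in> S1" "p \<noteq> q" "z \<in> S1"
  shows "transl p q z = 0 \<longleftrightarrow> z = p \<or> z = q"
proof -
  obtain a b t where ab: "p = cis a" "q = cis b" "z = cis t" using assms by (metis S1_cisE)
  have "transl p q z = 0 \<Longrightarrow> z = p \<or> z = q"
    using assms sin_half_diff_nonzero[of a t] sin_half_diff_nonzero[of b t] sin_half_diff_nonzero[of b a]
    unfolding ab transl_cis by fastforce
  then show ?thesis by auto
qed

lemma chord_side_eq_0_iff:
  assumes "p \<in> S1" "q \<in> S1" "p \<noteq> q" "z \<in> S1"
  shows "chord_side p q z = 0 \<longleftrightarrow> z = p \<or> z = q"
proof -
  obtain a b t where ab: "p = cis a" "q = cis b" "z = cis t" using assms by (metis S1_cisE)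
  have "chord_side p q z = 0 \<Longrightarrow> z = p \<or> z = q"
    using assms sin_half_diff_nonzero[of a t] sin_half_diff_nonzero[of b t] sin_half_diff_nonzero[of a b]
    unfolding ab chord_side_cis by fastforce
  then show ?thesis by auto
qed

text \<open>
  Existence by interpolation with translations; uniqueness because the coefficients of a field
  vanishing at three points solve a linear system whose determinant is the chord function.
\<close>

lemma framing_interpolation:
  assumes "(u, v, w) \<in> framings"
  shows "\<exists>!X. X \<in> sl2 \<and> (\<forall>p\<in>{u, v, w}. field_of X p = f p)"
proof (rule ex_ex1I)
  have S: "u \<in> S1" "v \<in> S1" "w \<in> S1" and ne: "u \<noteq> v" "u \<noteq> w" "v \<noteq> w"
    using assms unfolding framings_def by auto
  obtain X Y Z where X: "X \<in> sl2" "transl v w = field_of X" and Y: "Y \<in> sl2" "transl u w = field_of Y"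
    and Z: "Z \<in> sl2" "transl u v = field_of Z"
    using transl_in_sl2[OF S(2,3) ne(3)] transl_in_sl2[OF S(1,3) ne(2)] transl_in_sl2[OF S(1,2) ne(1)]
    by metis
  have nz: "field_of X u \<noteq> 0" "field_of Y v \<noteq> 0" "field_of Z w \<noteq> 0"
    using S ne by (auto simp: transl_eq_0_iff simp flip: X(2) Y(2) Z(2))
  have zero: "field_of X v = 0" "field_of X w = 0" "field_of Y u = 0" "field_of Y w = 0"
    "field_of Z u = 0" "field_of Z v = 0" by (simp_all flip: X(2) Y(2) Z(2))
  \<comment> \<open>Lagrange interpolation: each translation vanishes at two of the three points.\<close>
  define W where "W = 1 *\<^sub>R ((f u / field_of X u) *\<^sub>R X + (f v / field_of Y v) *\<^sub>R Y) + (f w / field_of Z w) *\<^sub>R Z"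
  have "W \<in> sl2" unfolding W_def by (intro sl2_linear X Y Z)
  moreover have "\<forall>p\<in>{u, v, w}. field_of W p = f p"
    unfolding W_def field_of_linear using nz zero by simp
  ultimately show "\<exists>X. X \<in> sl2 \<and> (\<forall>p\<in>{u, v, w}. field_of X p = f p)" by blast
next
  have S: "u \<in> S1" "v \<in> S1" "w \<in> S1" and ne: "u \<noteq> v" "u \<noteq> w" "v \<noteq> w"
    using assms unfolding framings_def by auto
  fix X Y assume X: "X \<in> sl2 \<and> (\<forall>p\<in>{u, v, w}. field_of X p = f p)"
    and Y: "Y \<in> sl2 \<and> (\<forall>p\<in>{u, v, w}. field_of Y p = f p)"
  define A where "A = (X$2$1 + X$1$2) - (Y$2$1 + Y$1$2)"
  define B where "B = 2 * X$1$1 - 2 * Y$1$1"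
  define C where "C = (X$2$1 - X$1$2) - (Y$2$1 - Y$1$2)"
  have "A * Re p + B * Im p + C = 0" if "p \<in> {u, v, w}" for p
  proof -
    have "p \<in> S1" using that S by auto
    moreover have "field_of X p = field_of Y p" using X Y that by auto
    ultimately show ?thesis by (simp add: field_of_def A_def B_def C_def algebra_simps)
  qed
  then have e: "A * Re u + B * Im u + C = 0" "A * Re v + B * Im v + C = 0" "A * Re w + B * Im w + C = 0"
    by auto
  have "chord_side u v w \<noteq> 0" using chord_side_eq_0_iff S ne by metis
  moreover have "A * chord_side u v w = 0" "B * chord_side u v w = 0"
    using e unfolding chord_side_def by (simp_all, algebra+)
  ultimately have "A = 0" "B = 0" by auto
  with e have "C = 0" by simp
  have "X$1$1 = Y$1$1" "X$1$2 = Y$1$2" "X$2$1 = Y$2$1"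
    using \<open>A = 0\<close> \<open>B = 0\<close> \<open>C = 0\<close> unfolding A_def B_def C_def by linarith+
  with X Y show "X = Y" by (simp add: vec_eq_iff forall_2 sl2_iff)
qed

lemma normalize_at_eq:
  assumes "(u, v, w) \<in> framings" "X \<in> sl2" "\<forall>p\<in>{u, v, w}. field_of X p = f p"
  shows "normalize_at (u, v, w) f = (\<lambda>z. f z - field_of X z)"
proof -
  have "(THE X. X \<in> sl2 \<and> (\<forall>p\<in>{u, v, w}. field_of X p = f p)) = X"
    using framing_interpolation[OF assms(1), of f] assms(2,3) by (intro the1_equality) auto
  then show ?thesis by (simp add: normalize_at_def)
qed

lemma normalize_at_subtracts:
  assumes "F \<in> framings"
  obtains X where "X \<in> sl2" "normalize_at F f = (\<lambda>z. f z - field_of X z)"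
proof -
  obtain u v w where F: "F = (u, v, w)" by (cases F)
  obtain X where "X \<in> sl2" "\<forall>p\<in>{u, v, w}. field_of X p = f p"
    using framing_interpolation[of u v w f] assms F by blast
  then show ?thesis using that normalize_at_eq assms F by blast
qed

text \<open>
  Normalization is the projection along the global fields, so it is linear and a global summand
  disappears.  This is how an identity of wavelets up to sl2 becomes an identity of coefficients.
\<close>

lemma normalize_at_linear:
  assumes F: "F \<in> framings" and Y: "Y \<in> sl2"
    and f: "\<And>z. f z = \<alpha> * g z + \<beta> * h z + field_of Y z"
  shows "normalize_at F f z = \<alpha> * normalize_at F g z + \<beta> * normalize_at F h z"
proof -
  obtain u v w where uvw: "F = (u, v, w)" by (cases F)
  obtain G where G: "G \<in> sl2" "\<forall>p\<in>{u, v, w}. field_of G p = g p"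
    using framing_interpolation[of u v w g] F uvw by blast
  obtain H where H: "H \<in> sl2" "\<forall>p\<in>{u, v, w}. field_of H p = h p"
    using framing_interpolation[of u v w h] F uvw by blast
  have "1 *\<^sub>R (\<alpha> *\<^sub>R G + \<beta> *\<^sub>R H) + 1 *\<^sub>R Y \<in> sl2" by (intro sl2_linear G H Y)
  moreover have "\<forall>p\<in>{u, v, w}. field_of (1 *\<^sub>R (\<alpha> *\<^sub>R G + \<beta> *\<^sub>R H) + 1 *\<^sub>R Y) p = f p"
    unfolding field_of_linear f using G H by auto
  ultimately have "normalize_at F f = (\<lambda>z. f z - field_of (1 *\<^sub>R (\<alpha> *\<^sub>R G + \<beta> *\<^sub>R H) + 1 *\<^sub>R Y) z)"
    using normalize_at_eq F uvw by blast
  moreover have "normalize_at F g = (\<lambda>z. g z - field_of G z)" "normalize_at F h = (\<lambda>z. h z - field_of H z)"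
    using normalize_at_eq F uvw G H by blast+
  ultimately show ?thesis by (simp only: field_of_linear f) (simp add: algebra_simps)
qed

section \<open>Normalized quadrilateral fields are piecewise sl2\<close>

lemma connected_nonzero_sign:
  fixes g :: "'a::topological_space \<Rightarrow> real"
  assumes "connected C" "continuous_on C g" "\<forall>z\<in>C. g z \<noteq> 0" "z0 \<in> C" "g z0 \<le> 0" "z \<in> C"
  shows "g z \<le> 0"
proof (rule ccontr)
  assume "\<not> g z \<le> 0"
  moreover have "connected (g ` C)" using assms(1,2) by (rule connected_continuous_image[rotated])
  ultimately have "0 \<in> g ` C" using connectedD_interval[of "g ` C" "g z0" "g z" 0] assms(4-6) by auto
  with assms(3) show False by auto
qed

text \<open>
  A connected set avoiding the four vertices lies strictly on one side of each of the four sides,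
  because a chord function vanishes on the circle only at the endpoints of its chord.  So it lies in
  a single arc.
\<close>

lemma normalized_quad_field_in_ppsl2:
  assumes ccw: "ccw_quad p r q s" and Q: "{p, r, q, s} \<subseteq> Qhat" and F: "F \<in> framings"
  shows "normalize_at F (quad_field p r q s) \<in> ppsl2"
proof -
  obtain N where N: "N \<in> sl2" "normalize_at F (quad_field p r q s) = (\<lambda>z. quad_field p r q s z - field_of N z)"
    using normalize_at_subtracts[OF F] .
  have S: "p \<in> S1" "r \<in> S1" "q \<in> S1" "s \<in> S1" using ccw_quad_S1[OF ccw] by auto
  have ne: "p \<noteq> r" "r \<noteq> q" "q \<noteq> s" "s \<noteq> p" using ccw_quad_distinct[OF ccw] by auto
  have "\<exists>X\<in>sl2. \<forall>z\<in>C. quad_field p r q s z - field_of N z = field_of X z"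
    if C: "C \<in> components (S1 - {p, r, q, s})" for C
  proof -
    have conn: "connected C" and sub: "C \<subseteq> S1 - {p, r, q, s}" and "C \<noteq> {}"
      using in_components_connected[OF C] in_components_subset[OF C] in_components_nonempty[OF C] by auto
    then obtain z0 where z0: "z0 \<in> C" by auto
    have piece: "\<exists>X\<in>sl2. \<forall>z\<in>C. quad_field p r q s z - field_of N z = field_of X z"
      if uv: "u \<in> {p, r, q, s}" "v \<in> {p, r, q, s}" "u \<noteq> v" "chord_side u v z0 \<le> 0"
        and y: "y \<in> S1" "y' \<in> S1" "y \<noteq> y'"
        and on_arc: "\<And>z. z \<in> S1 \<Longrightarrow> chord_side u v z \<le> 0 \<Longrightarrow> quad_field p r q s z = transl y y' z"
      for u v y y'
    proof -
      have cont: "continuous_on C (chord_side u v)" unfolding chord_side_def by (intro continuous_intros)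
      have "u \<in> S1" "v \<in> S1" using uv(1,2) S by auto
      then have "\<forall>z\<in>C. chord_side u v z \<noteq> 0"
        using chord_side_eq_0_iff[of u v] sub uv by blast
      then have le: "\<forall>z\<in>C. chord_side u v z \<le> 0"
        using connected_nonzero_sign[OF conn cont _ z0] uv(4) by blast
      obtain X where X: "X \<in> sl2" "transl y y' = field_of X" using transl_in_sl2[OF y] by metis
      have "quad_field p r q s z - field_of N z = field_of (1 *\<^sub>R X + (-1) *\<^sub>R N) z" if "z \<in> C" for z
        unfolding field_of_linear using le sub on_arc that X(2) by auto
      moreover have "1 *\<^sub>R X + (-1) *\<^sub>R N \<in> sl2" by (intro sl2_linear X N)
      ultimately show ?thesis by blast
    qed
    have "z0 \<in> S1" using z0 sub by auto
    from ccw_quad_arcs_cover[OF ccw this] show ?thesis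
      using piece[of p r p r] piece[of r q q r] piece[of q s q s] piece[of s p p s]
        quad_field_arcs[OF ccw] S ne by blast
  qed
  then show ?thesis
    unfolding ppsl2_def N(2) using Q
    by (auto simp: quad_field_off field_of_off intro!: exI[of _ "{p, r, q, s}"])
qed

section \<open>The change of a side wavelet under a flip\<close>

lemma quad_field_cis:
  assumes "a < b" "b < c" "c < d" "d < a + 2 * pi" "a \<le> t" "t < a + 2 * pi"
  shows "t \<le> b \<Longrightarrow> quad_field (cis a) (cis b) (cis c) (cis d) (cis t) = transl (cis a) (cis b) (cis t)"
    and "b \<le> t \<Longrightarrow> t \<le> c \<Longrightarrow> quad_field (cis a) (cis b) (cis c) (cis d) (cis t) = transl (cis c) (cis b) (cis t)"
    and "c \<le> t \<Longrightarrow> t \<le> d \<Longrightarrow> quad_field (cis a) (cis b) (cis c) (cis d) (cis t) = transl (cis c) (cis d) (cis t)"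
    and "d \<le> t \<Longrightarrow> quad_field (cis a) (cis b) (cis c) (cis d) (cis t) = transl (cis a) (cis d) (cis t)"
proof -
  have ccw: "ccw_quad (cis a) (cis b) (cis c) (cis d)" using assms unfolding ccw_quad_def by blast
  have S1: "cis t \<in> S1" by simp
  note arcs = quad_field_arcs[OF ccw S1]
  have "chord_side (cis d) (cis a) (cis t) \<le> 0" if "d \<le> t"
    using chord_side_cis_neg_iff(1)[of a d t] chord_side_swap[of "cis d" "cis a" "cis t"] assms that by simp
  then show "d \<le> t \<Longrightarrow> quad_field (cis a) (cis b) (cis c) (cis d) (cis t) = transl (cis a) (cis d) (cis t)"
    by (rule arcs(4))
  show "t \<le> b \<Longrightarrow> quad_field (cis a) (cis b) (cis c) (cis d) (cis t) = transl (cis a) (cis b) (cis t)"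
    and "b \<le> t \<Longrightarrow> t \<le> c \<Longrightarrow> quad_field (cis a) (cis b) (cis c) (cis d) (cis t) = transl (cis c) (cis b) (cis t)"
    and "c \<le> t \<Longrightarrow> t \<le> d \<Longrightarrow> quad_field (cis a) (cis b) (cis c) (cis d) (cis t) = transl (cis c) (cis d) (cis t)"
    using arcs(1-3) assms chord_side_cis_neg_iff(3)[of a b t] chord_side_cis_neg_iff(3)[of b c t]
      chord_side_cis_neg_iff(3)[of c d t] by auto
qed

text \<open>
  The cross ratio of the four points is -1.  In terms of translations, with one endpoint and the
  derivative there fixed, the translations form an affine line, and the translation from a vertex
  along its diagonal is the midpoint of the translations from that vertex along its two sides.
\<close>

definition harmonic :: "complex \<Rightarrow> complex \<Rightarrow> complex \<Rightarrow> complex \<Rightarrow> bool" where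
  "harmonic p r q s \<longleftrightarrow> (\<forall>z.
     2 * transl p q z = transl p r z + transl p s z \<and> 2 * transl q p z = transl q r z + transl q s z \<and>
     2 * transl r s z = transl r p z + transl r q z \<and> 2 * transl s r z = transl s p z + transl s q z)"

definition ccw_pentagon :: "complex \<Rightarrow> complex \<Rightarrow> complex \<Rightarrow> complex \<Rightarrow> complex \<Rightarrow> bool" where
  "ccw_pentagon p m r q s \<longleftrightarrow> (\<exists>a x b c d. a < x \<and> x < b \<and> b < c \<and> c < d \<and> d < a + 2 * pi \<and>
     p = cis a \<and> m = cis x \<and> r = cis b \<and> q = cis c \<and> s = cis d)"

text \<open>
  Placing all points in one window of angles starting at p, each chord condition with first
  endpoint p compares two angles.
\<close>

lemma ccw_pentagonI:
  assumes "p \<in> S1" "m \<in> S1" "r \<in> S1" "q \<in> S1" "s \<in> S1"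
    and pos: "chord_side p m r > 0" "chord_side p r q > 0" "chord_side p q s > 0"
  shows "ccw_pentagon p m r q s"
proof -
  obtain a where a: "p = cis a" using S1_cisE[OF assms(1)] .
  have angle: "\<exists>t. a < t \<and> t < a + 2 * pi \<and> z = cis t" if z: "z \<in> S1" "z \<noteq> p" for z
  proof -
    obtain t where "a \<le> t" "t < a + 2 * pi" "z = cis t" using S1_angleE[OF z(1)] .
    then show ?thesis using z(2) a by (cases "a = t") (auto intro!: exI[of _ t])
  qed
  have "m \<noteq> p" "r \<noteq> p" "q \<noteq> p" "s \<noteq> p" using pos by auto
  then obtain x b c d where xbcd: "a < x" "x < a + 2 * pi" "m = cis x" "a < b" "b < a + 2 * pi" "r = cis b"
    "a < c" "c < a + 2 * pi" "q = cis c" "a < d" "d < a + 2 * pi" "s = cis d"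
    using angle assms(2-5) by metis
  have "x < b" using pos(1) chord_side_cis_neg_iff(2)[of a x b] xbcd a by auto
  moreover have "b < c" using pos(2) chord_side_cis_neg_iff(2)[of a b c] xbcd a by auto
  moreover have "c < d" using pos(3) chord_side_cis_neg_iff(2)[of a c d] xbcd a by auto
  ultimately show ?thesis unfolding ccw_pentagon_def using xbcd a by blast
qed

lemma ccw_pentagon_quads:
  assumes "ccw_pentagon p m r q s"
  shows "ccw_quad p m r q" "ccw_quad p m r s" "ccw_quad p r q s"
proof -
  obtain a x b c d where *: "a < x" "x < b" "b < c" "c < d" "d < a + 2 * pi"
     "p = cis a" "m = cis x" "r = cis b" "q = cis c" "s = cis d"
    using assms unfolding ccw_pentagon_def by blast
  then have "x < c" "a < b" "c < a + 2 * pi" "b < d" by linarith+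
  with * show "ccw_quad p m r q" "ccw_quad p m r s" "ccw_quad p r q s"
    unfolding ccw_quad_def by blast+
qed

text \<open>
  Here m is the third vertex of the triangle outside the side p r; flipping p q replaces q by s in
  the quadrilateral around p r.  The arcs between p, m and r do not notice the replacement.  On the
  remaining three arcs all fields involved are translations, and the harmonic relations express the
  difference as half the wavelet of p q minus half the translation from p to r.
\<close>

lemma quad_field_flip_side:
  assumes ccw: "ccw_pentagon p m r q s" and H: "harmonic p r q s"
  shows "quad_field p m r s z - quad_field p m r q z = 1/2 * quad_field p r q s z - 1/2 * transl p r z"
proof (cases "z \<in> S1")
  case True
  obtain a x b c d where *: "a < x" "x < b" "b < c" "c < d" "d < a + 2 * pi"
     and eqs: "p = cis a" "m = cis x" "r = cis b" "q = cis c" "s = cis d"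
    using ccw unfolding ccw_pentagon_def by blast
  obtain t where t: "a \<le> t" "t < a + 2 * pi" "z = cis t" using S1_angleE[OF True] .
  have **: "a < b" "c < a + 2 * pi" "b < d" using * by linarith+
  note A = quad_field_cis[OF *(1,2) **(3) *(5) t(1,2), folded eqs t(3)]
  note B = quad_field_cis[OF *(1,2,3) **(2) t(1,2), folded eqs t(3)]
  note C = quad_field_cis[OF **(1) *(3,4,5) t(1,2), folded eqs t(3)]
  have h: "2 * transl p q z = transl p r z + transl p s z" "2 * transl q p z = transl q r z + transl q s z"
     "2 * transl r s z = transl r p z + transl r q z" "2 * transl s r z = transl s p z + transl s q z"
    using H unfolding harmonic_def by auto
  note swap = transl_swap[of r p z] transl_swap[of r q z] transl_swap[of q p z] transl_swap[of s p z]
    transl_swap[of s q z] transl_swap[of s r z]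
  consider "t \<le> x" | "x \<le> t" "t \<le> b" | "b \<le> t" "t \<le> c" | "c \<le> t" "t \<le> d" | "d \<le> t" by linarith
  then show ?thesis
  proof cases
    case 1 then show ?thesis using A(1) B(1) C(1) * by simp
  next
    case 2 then show ?thesis using A(2) B(2) C(1) * by simp
  next
    case 3 then show ?thesis using A(3) B(3) C(2) * h swap by simp
  next
    case 4 then show ?thesis using A(3) B(4) C(3) * h swap by simp
  next
    case 5 then show ?thesis using A(4) B(4) C(4) * h swap by simp
  qed
qed (simp add: quad_field_off transl_off)

section \<open>Rational ideal points\<close>

definition rational_pt :: "int \<Rightarrow> int \<Rightarrow> complex" where
  "rational_pt a b = ideal_pt (of_int a) (of_int b)"

text \<open>
  Coprimality, stated by the completion to a unimodular matrix, which is the form in which the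
  arguments below use it.
\<close>

definition primitive :: "int \<Rightarrow> int \<Rightarrow> bool" where
  "primitive a b \<longleftrightarrow> (\<exists>c d. a * d - b * c = 1)"

lemma primitive_nonzero: "primitive a b \<Longrightarrow> (real_of_int a, real_of_int b) \<noteq> (0, 0)"
  unfolding primitive_def by auto

lemma rational_pt_in_S1: "primitive a b \<Longrightarrow> rational_pt a b \<in> S1"
  unfolding rational_pt_def by (intro ideal_pt_in_S1 primitive_nonzero)

lemma rational_pt_minus: "rational_pt (- a) (- b) = rational_pt a b"
  unfolding rational_pt_def by simp

lemma rational_pt_eq_iff:
  assumes "primitive a b" "primitive c d"
  shows "rational_pt a b = rational_pt c d \<longleftrightarrow> a * d = b * c"
proof -
  have "rational_pt a b = rational_pt c d \<longleftrightarrow> real_of_int c * real_of_int b = real_of_int d * real_of_int a"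
    unfolding rational_pt_def by (rule ideal_pt_eq_iff[OF primitive_nonzero[OF assms(2)] primitive_nonzero[OF assms(1)]])
  also have "\<dots> \<longleftrightarrow> a * d = b * c"
    by (metis mult.commute of_int_eq_iff of_int_mult)
  finally show ?thesis .
qed

lemma rational_pt_eqD:
  assumes "primitive a b" "primitive c d" "rational_pt a b = rational_pt c d"
  shows "c = a \<and> d = b \<or> c = - a \<and> d = - b"
proof -
  obtain x y where xy: "a * y - b * x = 1" using assms(1) unfolding primitive_def by blast
  obtain x' y' where xy': "c * y' - d * x' = 1" using assms(2) unfolding primitive_def by blast
  have ad: "a * d = b * c" using assms rational_pt_eq_iff by blast
  \<comment> \<open>Proportional primitive vectors differ by an integer factor whose inverse is also an integer.\<close>
  define k where "k = c * y - d * x"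
  have k: "c = k * a" "d = k * b" unfolding k_def using xy ad by algebra+
  have "k * (a * y' - b * x') = 1" using xy' unfolding k by (simp add: algebra_simps)
  then have "k = 1 \<or> k = - 1" using zmult_eq_1_iff by blast
  then show ?thesis using k by auto
qed

lemma rational_pt_in_Qhat:
  assumes "primitive a b" shows "rational_pt a b \<in> Qhat"
proof (cases "b = 0")
  case True
  then have "rational_pt a b = 1" using primitive_nonzero[OF assms]
    by (simp add: rational_pt_def ideal_pt_def complex_eq_iff Complex_eq)
  then show ?thesis unfolding Qhat_def by (auto intro!: image_eqI[of _ _ None])
next
  case False
  have "rational_pt a b = ideal_pt (of_int a / of_int b) 1"
    unfolding rational_pt_def using ideal_pt_eq_iff False primitive_nonzero[OF assms] by simp
  also have "\<dots> = bdry (Some (of_int a / of_int b))" by (simp add: ideal_pt_def Complex_eq)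
  finally show ?thesis unfolding Qhat_def by (metis Rats_divide Rats_of_int image_eqI insertI2)
qed

section \<open>The Moebius action in homogeneous coordinates\<close>

definition slope :: "real \<Rightarrow> real \<Rightarrow> real option" where
  "slope x y = (if y = 0 then None else Some (x / y))"

lemma bdry_Some: "bdry (Some t) = ideal_pt t 1"
  by (simp add: ideal_pt_def Complex_eq)

lemma bdry_None: "bdry None = ideal_pt 1 0"
  by (simp add: ideal_pt_def Complex_eq)

lemma bdry_slope:
  assumes "(x, y) \<noteq> (0, 0)" shows "bdry (slope x y) = ideal_pt x y"
proof (cases "y = 0")
  case True
  then show ?thesis using assms ideal_pt_eq_iff[of x y 1 0]
    by (simp add: slope_def bdry_None del: bdry.simps)
next
  case False
  then show ?thesis using ideal_pt_eq_iff[of x y "x / y" 1]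
    by (simp add: slope_def bdry_Some del: bdry.simps)
qed

lemma inj_bdry: "inj bdry"
proof (rule injI)
  fix s t assume "bdry s = bdry t"
  then show "s = t"
    by (cases s; cases t) (simp_all add: bdry_Some bdry_None ideal_pt_eq_iff del: bdry.simps)
qed

lemma act_nonzero:
  fixes A :: "real^2^2"
  assumes "det A = 1" "(x, y) \<noteq> (0, 0)"
  shows "(A$2$2 * x - A$1$2 * y, - A$2$1 * x + A$1$1 * y) \<noteq> (0, 0)"
proof
  assume "(A$2$2 * x - A$1$2 * y, - A$2$1 * x + A$1$1 * y) = (0, 0)"
  then have zero: "A$2$2 * x - A$1$2 * y = 0" "- A$2$1 * x + A$1$1 * y = 0" by auto
  have det: "A$1$1 * A$2$2 - A$1$2 * A$2$1 = 1" using assms(1) by (simp add: det_2)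
  have "A$1$1 * (A$2$2 * x - A$1$2 * y) + A$1$2 * (- A$2$1 * x + A$1$1 * y)
      = (A$1$1 * A$2$2 - A$1$2 * A$2$1) * x"
    "A$2$1 * (A$2$2 * x - A$1$2 * y) + A$2$2 * (- A$2$1 * x + A$1$1 * y)
      = (A$1$1 * A$2$2 - A$1$2 * A$2$1) * y"
    by (simp_all add: algebra_simps)
  from this[unfolded zero det] have "x = 0" "y = 0" by simp_all
  with assms(2) show False by simp
qed

lemma act_slope:
  assumes "det A = 1" "(x, y) \<noteq> (0, 0)"
  shows "act (slope x y) A = slope (A$2$2 * x - A$1$2 * y) (- A$2$1 * x + A$1$1 * y)"
proof (cases "y = 0")
  case True
  then have "x \<noteq> 0" using assms(2) by simp
  then show ?thesis using True by (simp add: slope_def)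
next
  case False
  then have "- A$2$1 * (x / y) + A$1$1 = (- A$2$1 * x + A$1$1 * y) / y"
    "A$2$2 * (x / y) - A$1$2 = (A$2$2 * x - A$1$2 * y) / y" by (simp_all add: field_simps)
  then show ?thesis using False unfolding slope_def act.simps by auto
qed

lemma circ_act_ideal_pt:
  assumes "det A = 1" "(x, y) \<noteq> (0, 0)"
  shows "circ_act (ideal_pt x y) A = ideal_pt (A$2$2 * x - A$1$2 * y) (- A$2$1 * x + A$1$1 * y)"
proof -
  have "inv bdry (ideal_pt x y) = slope x y"
    using inj_bdry bdry_slope[OF assms(2)] by (metis inv_f_f)
  then show ?thesis
    unfolding circ_act_def using act_slope[OF assms] bdry_slope[OF act_nonzero[OF assms]] by simp
qed

lemma oriented_edge_eq:
  assumes "det A = 1"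
  shows "oriented_edge A = (ideal_pt (- A$1$2) (A$1$1), ideal_pt (A$2$2) (- A$2$1))"
proof -
  have "slope 0 1 = Some 0" "slope 1 0 = None" by (simp_all add: slope_def)
  then show ?thesis
    using act_slope[OF assms, of 0 1] act_slope[OF assms, of 1 0]
      bdry_slope[OF act_nonzero[OF assms, of 0 1]] bdry_slope[OF act_nonzero[OF assms, of 1 0]]
    by (simp add: oriented_edge_def)
qed

lemma underlying_edge_eq:
  assumes "det A = 1"
  shows "underlying_edge A = {ideal_pt (A$2$2) (- A$2$1), ideal_pt (- A$1$2) (A$1$1)}"
  unfolding underlying_edge_def oriented_edge_eq[OF assms] by auto

lemma det_minus_mat2: "det (- A) = det (A :: real^2^2)"
  by (simp add: det_2)

lemma underlying_edge_minus: "det A = 1 \<Longrightarrow> underlying_edge (- A) = underlying_edge A"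
  using ideal_pt_minus[of "A$2$2" "- A$2$1"] ideal_pt_minus[of "- A$1$2" "A$1$1"]
  by (simp add: underlying_edge_eq det_minus_mat2)

lemma descend_eq: "k (- A) = k A \<Longrightarrow> descend k {A, - A} = k A"
  by (simp add: descend_def)

section \<open>Adjacency in the Farey tesselation\<close>

text \<open>
  The endpoints of the edge of A are the directions of the two columns of the inverse of A.
\<close>

lemma farey_iff:
  "x \<in> farey \<longleftrightarrow> (\<exists>v1 v2 w1 w2. v1 * w2 - v2 * w1 = 1 \<and> x = {rational_pt v1 v2, rational_pt w1 w2})"
proof
  assume "x \<in> farey"
  then obtain A where A: "A \<in> SL2Z" "x = descend underlying_edge {A, - A}"
    unfolding farey_def PSL2Z_def by auto
  have det: "det A = 1" and int: "A$i$j \<in> \<int>" for i j using A(1) unfolding SL2Z_def SL2R_def by auto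
  obtain a b c d where abcd: "A$1$1 = of_int a" "A$1$2 = of_int b" "A$2$1 = of_int c" "A$2$2 = of_int d"
    using int unfolding Ints_def by (metis imageE)
  have "real_of_int (a * d - b * c) = 1" using det by (simp add: det_2 abcd)
  then have "d * a - (- c) * (- b) = 1" by (simp only: of_int_eq_1_iff) (simp add: algebra_simps)
  moreover have "x = {rational_pt d (- c), rational_pt (- b) a}"
    unfolding A(2) descend_eq[OF underlying_edge_minus[OF det]] underlying_edge_eq[OF det] abcd rational_pt_def
    by simp
  ultimately show "\<exists>v1 v2 w1 w2. v1 * w2 - v2 * w1 = 1 \<and> x = {rational_pt v1 v2, rational_pt w1 w2}" by blast
next
  assume "\<exists>v1 v2 w1 w2. v1 * w2 - v2 * w1 = 1 \<and> x = {rational_pt v1 v2, rational_pt w1 w2}"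
  then obtain v1 v2 w1 w2 where v: "v1 * w2 - v2 * w1 = 1" "x = {rational_pt v1 v2, rational_pt w1 w2}" by blast
  define A where "A = mat2 (of_int w2) (of_int (- w1)) (of_int (- v2)) (of_int v1)"
  have "det A = of_int (v1 * w2 - v2 * w1)" by (simp add: A_def det_2)
  then have det: "det A = 1" using v(1) by simp
  have "\<forall>i j. A$i$j \<in> \<int>" unfolding forall_2 by (simp add: A_def)
  then have "A \<in> SL2Z" using det unfolding SL2Z_def SL2R_def by simp
  moreover have "descend underlying_edge {A, - A} = x"
    unfolding descend_eq[OF underlying_edge_minus[OF det]] underlying_edge_eq[OF det] v(2) rational_pt_def
    by (simp add: A_def)
  ultimately show "x \<in> farey" unfolding farey_def PSL2Z_def by blast
qed

lemma farey_edge_primitive: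
  assumes "v1 * w2 - v2 * w1 = 1"
  shows "primitive v1 v2" "primitive w1 w2"
proof -
  show "primitive v1 v2" using assms unfolding primitive_def by blast
  have "w1 * (- v2) - w2 * (- v1) = 1" using assms by (simp add: algebra_simps)
  then show "primitive w1 w2" unfolding primitive_def by blast
qed

text \<open>
  A primitive direction vector of a rational point is unique up to sign, so the absolute value of
  the determinant does not depend on how the edge is presented.
\<close>

lemma farey_doubleton_iff:
  assumes "primitive a b" "primitive c d"
  shows "{rational_pt a b, rational_pt c d} \<in> farey \<longleftrightarrow> \<bar>a * d - b * c\<bar> = 1"
proof
  assume "{rational_pt a b, rational_pt c d} \<in> farey"
  then obtain v1 v2 w1 w2 where v: "v1 * w2 - v2 * w1 = 1"
    "{rational_pt a b, rational_pt c d} = {rational_pt v1 v2, rational_pt w1 w2}"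
    unfolding farey_iff by blast
  note prim = farey_edge_primitive[OF v(1)]
  have "rational_pt a b = rational_pt v1 v2 \<and> rational_pt c d = rational_pt w1 w2 \<or>
        rational_pt a b = rational_pt w1 w2 \<and> rational_pt c d = rational_pt v1 v2"
    using v(2) by (auto simp: doubleton_eq_iff)
  then have "(v1 = a \<and> v2 = b \<or> v1 = - a \<and> v2 = - b) \<and> (w1 = c \<and> w2 = d \<or> w1 = - c \<and> w2 = - d) \<or>
     (w1 = a \<and> w2 = b \<or> w1 = - a \<and> w2 = - b) \<and> (v1 = c \<and> v2 = d \<or> v1 = - c \<and> v2 = - d)"
    using rational_pt_eqD[OF assms(1) prim(1)] rational_pt_eqD[OF assms(2) prim(2)]
      rational_pt_eqD[OF assms(1) prim(2)] rational_pt_eqD[OF assms(2) prim(1)] by blast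
  then have "a * d - b * c = 1 \<or> a * d - b * c = - 1"
    using v(1) by (elim disjE conjE) (simp_all add: algebra_simps)
  then show "\<bar>a * d - b * c\<bar> = 1" by auto
next
  assume "\<bar>a * d - b * c\<bar> = 1"
  then consider "a * d - b * c = 1" | "a * (- d) - b * (- c) = 1" by linarith
  then show "{rational_pt a b, rational_pt c d} \<in> farey"
  proof cases
    case 1 then show ?thesis unfolding farey_iff by blast
  next
    case 2
    then have "{rational_pt a b, rational_pt (- c) (- d)} \<in> farey" unfolding farey_iff by blast
    then show ?thesis unfolding rational_pt_minus .
  qed
qed

lemma farey_neighbourE:
  assumes "{rational_pt a b, z} \<in> farey" "primitive a b"
  obtains c d where "primitive c d" "z = rational_pt c d" "\<bar>a * d - b * c\<bar> = 1"
proof -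
  obtain v1 v2 w1 w2 where v: "v1 * w2 - v2 * w1 = 1"
    "{rational_pt a b, z} = {rational_pt v1 v2, rational_pt w1 w2}"
    using assms(1) unfolding farey_iff by blast
  then have "z = rational_pt v1 v2 \<or> z = rational_pt w1 w2" by auto
  then obtain c d where "primitive c d" "z = rational_pt c d" using farey_edge_primitive[OF v(1)] by blast
  then show ?thesis using that farey_doubleton_iff[OF assms(2)] assms(1) by metis
qed

lemma lattice_coordinates:
  fixes u1 u2 v1 v2 w1 w2 x y :: int
  assumes "v1 * w2 - v2 * w1 = 1" and x: "x = u1 * w2 - u2 * w1" and y: "y = v1 * u2 - v2 * u1"
  shows "u1 = x * v1 + y * w1" "u2 = x * v2 + y * w2"
proof -
  have "x * v1 + y * w1 = u1 * (v1 * w2 - v2 * w1)" "x * v2 + y * w2 = u2 * (v1 * w2 - v2 * w1)"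
    unfolding x y by (simp_all add: algebra_simps)
  then show "u1 = x * v1 + y * w1" "u2 = x * v2 + y * w2" unfolding assms(1) by linarith+
qed

text \<open>
  In the basis v, w a common neighbour of both endpoints has both coordinates equal to 1 or -1.
\<close>

lemma opposite_farey:
  assumes "v1 * w2 - v2 * w1 = 1"
  shows "opposite farey {rational_pt v1 v2, rational_pt w1 w2}
           = {rational_pt (w1 - v1) (w2 - v2), rational_pt (w1 + v1) (w2 + v2)}"
    (is "opposite farey {?p, ?q} = {?r, ?s}")
proof -
  note prim = farey_edge_primitive[OF assms]
  have d: "(w1 - v1) * (- w2) - (w2 - v2) * (- w1) = 1" "(w1 + v1) * w2 - (w2 + v2) * w1 = 1"
    "v1 * (w2 - v2) - v2 * (w1 - v1) = 1" "v1 * (w2 + v2) - v2 * (w1 + v1) = 1"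
    using assms by (simp_all add: algebra_simps)
  note prim' = farey_edge_primitive(1)[OF d(1)] farey_edge_primitive(1)[OF d(2)]
  have d': "\<bar>w1 * (w2 - v2) - w2 * (w1 - v1)\<bar> = 1" "\<bar>w1 * (w2 + v2) - w2 * (w1 + v1)\<bar> = 1"
    using assms by (simp_all add: algebra_simps)
  have edges: "{?p, ?r} \<in> farey" "{?p, ?s} \<in> farey" "{?q, ?r} \<in> farey" "{?q, ?s} \<in> farey"
    using d d' prim prim' by (simp_all add: farey_doubleton_iff)
  have "?r \<noteq> ?p" "?r \<noteq> ?q" "?s \<noteq> ?p" "?s \<noteq> ?q"
    using d d' prim prim' by (auto simp: rational_pt_eq_iff algebra_simps)
  with edges have "{?r, ?s} \<subseteq> opposite farey {?p, ?q}" unfolding opposite_def by auto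
  moreover have "z \<in> {?r, ?s}" if "z \<in> opposite farey {?p, ?q}" for z
  proof -
    have "{?p, z} \<in> farey" "{?q, z} \<in> farey" using \<open>z \<in> _\<close> unfolding opposite_def by auto
    then obtain u1 u2 where u: "primitive u1 u2" "z = rational_pt u1 u2" "\<bar>v1 * u2 - v2 * u1\<bar> = 1"
      using farey_neighbourE[OF _ prim(1)] by metis
    have "\<bar>w1 * u2 - w2 * u1\<bar> = 1" using \<open>{?q, z} \<in> farey\<close> farey_doubleton_iff[OF prim(2) u(1)] u(2) by simp
    define x y where xy: "x = u1 * w2 - u2 * w1" "y = v1 * u2 - v2 * u1"
    have "x = 1 \<or> x = - 1" using \<open>\<bar>w1 * u2 - w2 * u1\<bar> = 1\<close> unfolding xy
      by (auto simp: abs_if algebra_simps split: if_splits)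
    moreover have "y = 1 \<or> y = - 1" using u(3) unfolding xy by (auto simp: abs_if split: if_splits)
    moreover note lattice_coordinates[OF assms xy]
    ultimately
    have "(u1 = w1 - v1 \<and> u2 = w2 - v2) \<or> (u1 = - (w1 - v1) \<and> u2 = - (w2 - v2)) \<or>
          (u1 = w1 + v1 \<and> u2 = w2 + v2) \<or> (u1 = - (w1 + v1) \<and> u2 = - (w2 + v2))"
      by (elim disjE) simp_all
    then show ?thesis unfolding u(2)
      using rational_pt_minus[of "w1 - v1" "w2 - v2"] rational_pt_minus[of "w1 + v1" "w2 + v2"] by auto
  qed
  ultimately show ?thesis by blast
qed

text \<open>
  This guarantees that the flip creates no triangles, and hence changes no third vertices, away from
  the quadrilateral around the edge.
\<close>

lemma farey_common_neighbours:
  assumes "v1 * w2 - v2 * w1 = 1"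
    and "{rational_pt (w1 - v1) (w2 - v2), z} \<in> farey" "{rational_pt (w1 + v1) (w2 + v2), z} \<in> farey"
  shows "z \<in> {rational_pt v1 v2, rational_pt w1 w2}"
proof -
  have d: "(w1 - v1) * (- w2) - (w2 - v2) * (- w1) = 1" "(w1 + v1) * w2 - (w2 + v2) * w1 = 1"
    using assms by (simp_all add: algebra_simps)
  note prim = farey_edge_primitive(1)[OF d(1)] farey_edge_primitive(1)[OF d(2)]
  obtain u1 u2 where u: "primitive u1 u2" "z = rational_pt u1 u2" "\<bar>(w1 - v1) * u2 - (w2 - v2) * u1\<bar> = 1"
    using farey_neighbourE[OF assms(2) prim(1)] .
  have "\<bar>(w1 + v1) * u2 - (w2 + v2) * u1\<bar> = 1" using assms(3) farey_doubleton_iff[OF prim(2) u(1)] u(2) by simp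
  \<comment> \<open>In the basis v, w the two adjacency conditions become |x + y| = 1 and |x - y| = 1.\<close>
  define x y where xy: "x = u1 * w2 - u2 * w1" "y = v1 * u2 - v2 * u1"
  have "x + y = 1 \<or> x + y = - 1" "y - x = 1 \<or> y - x = - 1"
    using u(3) \<open>\<bar>(w1 + v1) * u2 - (w2 + v2) * u1\<bar> = 1\<close> unfolding xy
    by (auto simp: abs_if algebra_simps split: if_splits)
  then have "x = 0 \<and> (y = 1 \<or> y = -1) \<or> y = 0 \<and> (x = 1 \<or> x = -1)"
    by presburger
  moreover note lattice_coordinates[OF assms(1) xy]
  ultimately have "(u1 = w1 \<and> u2 = w2) \<or> (u1 = - w1 \<and> u2 = - w2) \<or> (u1 = v1 \<and> u2 = v2) \<or> (u1 = - v1 \<and> u2 = - v2)"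
    by (elim disjE conjE) simp_all
  then show ?thesis unfolding u(2) using rational_pt_minus by auto
qed

section \<open>Third vertices after a flip\<close>

lemma oppositeD:
  assumes "r \<in> opposite \<tau> {p, q}"
  shows "r \<noteq> p" "r \<noteq> q" "{p, r} \<in> \<tau>" "{q, r} \<in> \<tau>"
  using assms unfolding opposite_def by auto

lemma opposite_doubleton: "opposite \<tau> {p, q} = {r. r \<noteq> p \<and> r \<noteq> q \<and> {p, r} \<in> \<tau> \<and> {q, r} \<in> \<tau>}"
  unfolding opposite_def by auto

text \<open>
  The hypothesis on common neighbours excludes further triangles on the new diagonal.
\<close>

lemma opposite_flip_diagonal:
  assumes "opposite \<tau> {p, q} = {r, s}" "r \<noteq> s"
    and "\<And>z. {r, z} \<in> \<tau> \<Longrightarrow> {s, z} \<in> \<tau> \<Longrightarrow> z \<in> {p, q}"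
  shows "opposite (flip \<tau> {p, q}) {r, s} = {p, q}"
proof -
  have rs: "r \<noteq> p" "r \<noteq> q" "{p, r} \<in> \<tau>" "{q, r} \<in> \<tau>" "s \<noteq> p" "s \<noteq> q" "{p, s} \<in> \<tau>" "{q, s} \<in> \<tau>"
    using oppositeD[of r \<tau> p q] oppositeD[of s \<tau> p q] assms(1) by auto
  have "z \<in> {p, q}" if "z \<noteq> r" "z \<noteq> s" "{r, z} \<in> flip \<tau> {p, q}" "{s, z} \<in> flip \<tau> {p, q}" for z
    using that assms unfolding flip_def by (auto simp: doubleton_eq_iff)
  moreover have "{r, p} \<in> flip \<tau> {p, q}" "{s, p} \<in> flip \<tau> {p, q}" "{r, q} \<in> flip \<tau> {p, q}" "{s, q} \<in> flip \<tau> {p, q}"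
    using rs unfolding flip_def by (auto simp: doubleton_eq_iff insert_commute)
  ultimately show ?thesis unfolding opposite_doubleton using rs by blast
qed

text \<open>
  The triangle p q r is destroyed and the triangle p r s is created.
\<close>

lemma opposite_flip_side:
  assumes "opposite \<tau> {p, q} = {r, s}" "r \<noteq> s"
  shows "opposite (flip \<tau> {p, q}) {p, r} = insert s (opposite \<tau> {p, r} - {q})"
proof -
  have rs: "r \<noteq> p" "r \<noteq> q" "{p, r} \<in> \<tau>" "{q, r} \<in> \<tau>" "s \<noteq> p" "s \<noteq> q" "{p, s} \<in> \<tau>" "{q, s} \<in> \<tau>"
    using oppositeD[of r \<tau> p q] oppositeD[of s \<tau> p q] assms(1) by auto
  have "{p, z} \<in> flip \<tau> {p, q} \<longleftrightarrow> {p, z} \<in> \<tau> \<and> z \<noteq> q" for z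
    unfolding flip_def assms(1) using rs by (auto simp: doubleton_eq_iff)
  moreover have "{r, z} \<in> flip \<tau> {p, q} \<longleftrightarrow> {r, z} \<in> \<tau> \<or> z = s" for z
    unfolding flip_def assms(1) using rs assms(2) by (auto simp: doubleton_eq_iff)
  ultimately show ?thesis unfolding opposite_doubleton using rs assms(2) by auto
qed

text \<open>
  A triangle on {y, y'} that is lost by the flip has the old diagonal as a side, and one that is
  gained has the new diagonal as a side.  In both cases {y, y'} is a side of the quadrilateral.
\<close>

lemma opposite_flip_other:
  assumes "opposite \<tau> {p, q} = {r, s}" "r \<noteq> s"
    and common: "\<And>z. {r, z} \<in> \<tau> \<Longrightarrow> {s, z} \<in> \<tau> \<Longrightarrow> z \<in> {p, q}"
    and x: "{y, y'} \<in> \<tau>" "y \<noteq> y'" "{y, y'} \<notin> sides \<tau> {p, q}"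
  shows "opposite (flip \<tau> {p, q}) {y, y'} = opposite \<tau> {y, y'}"
proof -
  have rs: "r \<noteq> p" "r \<noteq> q" "{p, r} \<in> \<tau>" "{q, r} \<in> \<tau>" "s \<noteq> p" "s \<noteq> q" "{p, s} \<in> \<tau>" "{q, s} \<in> \<tau>"
    using oppositeD[of r \<tau> p q] oppositeD[of s \<tau> p q] assms(1) by auto
  have side: "{a, b} \<in> sides \<tau> {p, q}" if "a \<in> {p, q}" "b \<in> {r, s}" for a b
    using that assms(1) unfolding sides_def by blast
  have flip: "u \<in> flip \<tau> {p, q} \<longleftrightarrow> u = {r, s} \<or> u \<in> \<tau> \<and> u \<noteq> {p, q}" for u
    unfolding flip_def assms(1) by auto
  have old: "{a, z} \<noteq> {p, q}" if z: "{a, z} \<in> \<tau>" "{b, z} \<in> \<tau>" "z \<noteq> a" "z \<noteq> b" and ab: "{a, b} = {y, y'}" for a b z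
  proof
    assume e: "{a, z} = {p, q}"
    have "{a, b} \<in> \<tau>" unfolding ab by (rule x(1))
    moreover have "a \<noteq> b" using ab x(2) by (metis doubleton_eq_iff)
    ultimately have "a \<noteq> b" "{a, b} \<in> \<tau>" by simp_all
    then have "b \<in> opposite \<tau> {p, q}"
      using z unfolding e[symmetric] opposite_doubleton by (auto simp: insert_commute)
    then have "{a, b} \<in> sides \<tau> {p, q}" using side[of a b] e assms(1) by auto
    with x(3) ab show False by simp
  qed
  have new: "{a, z} \<noteq> {r, s}" if z: "{b, z} \<in> flip \<tau> {p, q}" "z \<noteq> a" "z \<noteq> b" and ab: "{a, b} = {y, y'}" for a b z
  proof
    assume f: "{a, z} = {r, s}"
    have "{a, b} \<in> \<tau>" unfolding ab by (rule x(1))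
    moreover have "a \<noteq> b" using ab x(2) by (metis doubleton_eq_iff)
    ultimately have "a \<noteq> b" "{a, b} \<in> \<tau>" by simp_all
    moreover have "{b, z} \<noteq> {r, s}" using f \<open>a \<noteq> b\<close> by (auto simp: doubleton_eq_iff)
    ultimately have "{z, b} \<in> \<tau>" "{a, b} \<in> \<tau>" using z(1) unfolding flip by (auto simp: insert_commute)
    then have "b \<in> {p, q}" using common[of b] f by (auto simp: doubleton_eq_iff)
    then have "{b, a} \<in> sides \<tau> {p, q}" using side[of b a] f by auto
    with x(3) ab show False by (simp add: insert_commute)
  qed
  have yy: "{y', y} = {y, y'}" by auto
  show ?thesis
    unfolding opposite_doubleton
    using old[OF _ _ _ _ refl] old[OF _ _ _ _ yy] new[OF _ _ _ refl] new[OF _ _ _ yy]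
    by (intro Collect_cong) (metis flip)
qed

lemma wavelet_cong:
  assumes "opposite \<tau> x = opposite \<tau>' x"
  shows "wavelet \<tau> x = wavelet \<tau>' x"
  using assms unfolding wavelet_def is_wavelet_def sides_def by simp

section \<open>Farey quadrilaterals\<close>

text \<open>
  All Farey quadrilaterals look alike in the lattice basis given by an edge: the third vertices are
  w - v and w + v.  In these coordinates every required incidence and order relation concerns fixed
  small integers.
\<close>

definition lattice_pt :: "int \<times> int \<Rightarrow> int \<times> int \<Rightarrow> int \<Rightarrow> int \<Rightarrow> complex" where
  "lattice_pt v w x y = rational_pt (x * fst v + y * fst w) (x * snd v + y * snd w)"

definition unimodular :: "int \<times> int \<Rightarrow> int \<times> int \<Rightarrow> bool" where
  "unimodular v w \<longleftrightarrow> fst v * snd w - snd v * fst w = 1"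

lemma lattice_det:
  fixes x y x' y' v1 v2 w1 w2 :: "'a::comm_ring"
  shows "(x * v1 + y * w1) * (x' * v2 + y' * w2) - (x * v2 + y * w2) * (x' * v1 + y' * w1)
          = (x * y' - y * x') * (v1 * w2 - v2 * w1)"
  by (simp add: algebra_simps)

lemma lattice_unimodular:
  assumes "unimodular v w" "x * y' - y * x' = 1"
  shows "(x * fst v + y * fst w) * (x' * snd v + y' * snd w) - (x * snd v + y * snd w) * (x' * fst v + y' * fst w) = 1"
  using assms unfolding lattice_det unimodular_def by simp

lemma lattice_pt_minus: "lattice_pt v w (- x) (- y) = lattice_pt v w x y"
  using rational_pt_minus[of "x * fst v + y * fst w" "x * snd v + y * snd w"]
  by (simp add: lattice_pt_def)

lemma primitive_lattice:
  assumes "unimodular v w" "primitive x y"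
  shows "primitive (x * fst v + y * fst w) (x * snd v + y * snd w)"
proof -
  obtain x' y' where "x * y' - y * x' = 1" using assms(2) unfolding primitive_def by blast
  from farey_edge_primitive(1)[OF lattice_unimodular[OF assms(1) this]] show ?thesis .
qed

lemma opposite_lattice:
  assumes "unimodular v w" "x * y' - y * x' = 1"
  shows "opposite farey {lattice_pt v w x y, lattice_pt v w x' y'}
           = {lattice_pt v w (x' - x) (y' - y), lattice_pt v w (x' + x) (y' + y)}"
  unfolding lattice_pt_def opposite_farey[OF lattice_unimodular[OF assms]]
  by (simp add: algebra_simps)

lemma lattice_pt_ideal:
  "lattice_pt v w x y = ideal_pt (of_int x * of_int (fst v) + of_int y * of_int (fst w))
      (of_int x * of_int (snd v) + of_int y * of_int (snd w))"
  by (simp add: lattice_pt_def rational_pt_def)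

lemma lattice_nonzero:
  assumes "unimodular v w" "primitive x y"
  shows "(real_of_int x * of_int (fst v) + of_int y * of_int (fst w),
      real_of_int x * of_int (snd v) + of_int y * of_int (snd w)) \<noteq> (0, 0)"
  using primitive_nonzero[OF primitive_lattice[OF assms]] by simp

lemma real_unimodular:
  assumes "unimodular v w"
  shows "real_of_int (fst v) * of_int (snd w) - of_int (snd v) * of_int (fst w) = 1"
  using assms unfolding unimodular_def by (metis of_int_1 of_int_diff of_int_mult)

lemma chord_side_lattice:
  assumes uni: "unimodular v w" and prim: "primitive x y" "primitive x' y'" "primitive x'' y''"
    and pos: "0 < (x * y' - y * x') * (x' * y'' - y' * x'') * (x'' * y - y'' * x)"
  shows "0 < chord_side (lattice_pt v w x y) (lattice_pt v w x' y') (lattice_pt v w x'' y'')"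
proof -
  note nz = lattice_nonzero[OF uni prim(1)] lattice_nonzero[OF uni prim(2)] lattice_nonzero[OF uni prim(3)]
  have "0 < real_of_int ((x * y' - y * x') * (x' * y'' - y' * x'') * (x'' * y - y'' * x))"
    using pos by (simp only: of_int_0_less_iff)
  then have *: "0 < real_of_int (x * y' - y * x') * of_int (x' * y'' - y' * x'') * of_int (x'' * y - y'' * x)"
    by (simp only: of_int_mult)
  have scale: "0 < a * b * c \<Longrightarrow> 0 < 4 * (a * 1) * (b * 1) * (c * 1)" for a b c :: real
    by (simp add: mult.assoc)
  show ?thesis
    unfolding lattice_pt_ideal chord_side_ideal_pt[OF nz] lattice_det real_unimodular[OF uni]
  proof (rule divide_pos_pos)
    show "0 < 4 * ((real_of_int x * of_int y' - of_int y * of_int x') * 1) *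
       ((of_int x' * of_int y'' - of_int y' * of_int x'') * 1) *
       ((of_int x'' * of_int y - of_int y'' * of_int x) * 1)"
      using scale[OF *] by (simp only: of_int_diff of_int_mult)
  qed (intro mult_pos_pos sum_squares_pos[OF nz(1)] sum_squares_pos[OF nz(2)] sum_squares_pos[OF nz(3)])
qed

lemma transl_lattice:
  assumes uni: "unimodular v w" and prim: "primitive x y" "primitive x' y'" and "(X, Y) \<noteq> (0, 0)"
    and \<alpha>: "\<alpha> = of_int (fst v) * Y - of_int (snd v) * X" and \<beta>: "\<beta> = of_int (fst w) * Y - of_int (snd w) * X"
  shows "transl (lattice_pt v w x y) (lattice_pt v w x' y') (ideal_pt X Y) =
    4 * (of_int x * \<alpha> + of_int y * \<beta>) * (of_int x' * \<alpha> + of_int y' * \<beta>)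
      / (of_int (x * y' - y * x') * (X\<^sup>2 + Y\<^sup>2))"
proof -
  note nz = lattice_nonzero[OF uni prim(1)] lattice_nonzero[OF uni prim(2)]
  have *: "(of_int x * of_int (fst v) + of_int y * of_int (fst w)) * Y - (of_int x * of_int (snd v) + of_int y * of_int (snd w)) * X
    = of_int x * \<alpha> + of_int y * \<beta>" for x y :: int
    unfolding \<alpha> \<beta> by (simp add: algebra_simps)
  show ?thesis
    unfolding lattice_pt_ideal transl_ideal_pt[OF nz assms(4)] lattice_det real_unimodular[OF uni] * by simp
qed

lemma harmonic_lattice:
  assumes uni: "unimodular v w"
  shows "harmonic (lattice_pt v w 1 0) (lattice_pt v w (- 1) 1) (lattice_pt v w 0 1) (lattice_pt v w 1 1)"
proof -
  have prim: "primitive 1 0" "primitive (- 1) 1" "primitive 0 1" "primitive 1 1"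
    unfolding primitive_def by presburger+
  show ?thesis
    unfolding harmonic_def
  proof
    fix z
    show "2 * transl (lattice_pt v w 1 0) (lattice_pt v w 0 1) z =
         transl (lattice_pt v w 1 0) (lattice_pt v w (- 1) 1) z + transl (lattice_pt v w 1 0) (lattice_pt v w 1 1) z \<and>
         2 * transl (lattice_pt v w 0 1) (lattice_pt v w 1 0) z =
         transl (lattice_pt v w 0 1) (lattice_pt v w (- 1) 1) z + transl (lattice_pt v w 0 1) (lattice_pt v w 1 1) z \<and>
         2 * transl (lattice_pt v w (- 1) 1) (lattice_pt v w 1 1) z =
         transl (lattice_pt v w (- 1) 1) (lattice_pt v w 1 0) z + transl (lattice_pt v w (- 1) 1) (lattice_pt v w 0 1) z \<and>
         2 * transl (lattice_pt v w 1 1) (lattice_pt v w (- 1) 1) z =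
         transl (lattice_pt v w 1 1) (lattice_pt v w 1 0) z + transl (lattice_pt v w 1 1) (lattice_pt v w 0 1) z"
    proof (cases "z \<in> S1")
      case True
      then obtain X Y where z: "z = ideal_pt X Y" and N: "X\<^sup>2 + Y\<^sup>2 = 1" using S1_ideal_ptE by metis
      then have nz: "(X, Y) \<noteq> (0, 0)" by auto
      show ?thesis
        unfolding z by (simp add: transl_lattice[OF uni _ _ nz refl refl] prim N) (simp add: field_simps)
    qed (simp add: transl_off)
  qed
qed

lemma lattice_pentagons:
  assumes uni: "unimodular v w"
  shows "ccw_pentagon (lattice_pt v w 1 0) (lattice_pt v w 2 (- 1)) (lattice_pt v w (- 1) 1) (lattice_pt v w 0 1) (lattice_pt v w 1 1)"
    and "ccw_pentagon (lattice_pt v w (- 1) 1) (lattice_pt v w (- 1) 2) (lattice_pt v w 0 1) (lattice_pt v w 1 1) (lattice_pt v w 1 0)"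
    and "ccw_pentagon (lattice_pt v w 0 1) (lattice_pt v w 1 2) (lattice_pt v w 1 1) (lattice_pt v w 1 0) (lattice_pt v w (- 1) 1)"
    and "ccw_pentagon (lattice_pt v w 1 1) (lattice_pt v w 2 1) (lattice_pt v w 1 0) (lattice_pt v w (- 1) 1) (lattice_pt v w 0 1)"
proof -
  have prim: "primitive 1 0" "primitive (- 1) 1" "primitive 0 1" "primitive 1 1"
    "primitive 2 (- 1)" "primitive (- 1) 2" "primitive 1 2" "primitive 2 1"
    unfolding primitive_def by presburger+
  have S1: "lattice_pt v w a b \<in> S1" if "primitive a b" for a b
    unfolding lattice_pt_def by (intro rational_pt_in_S1 primitive_lattice uni that)
  show "ccw_pentagon (lattice_pt v w 1 0) (lattice_pt v w 2 (- 1)) (lattice_pt v w (- 1) 1) (lattice_pt v w 0 1) (lattice_pt v w 1 1)"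
    and "ccw_pentagon (lattice_pt v w (- 1) 1) (lattice_pt v w (- 1) 2) (lattice_pt v w 0 1) (lattice_pt v w 1 1) (lattice_pt v w 1 0)"
    and "ccw_pentagon (lattice_pt v w 0 1) (lattice_pt v w 1 2) (lattice_pt v w 1 1) (lattice_pt v w 1 0) (lattice_pt v w (- 1) 1)"
    and "ccw_pentagon (lattice_pt v w 1 1) (lattice_pt v w 2 1) (lattice_pt v w 1 0) (lattice_pt v w (- 1) 1) (lattice_pt v w 0 1)"
    by (intro ccw_pentagonI S1 prim chord_side_lattice[OF uni]; simp)+
qed

text \<open>
  The configuration around an edge {p, q}: the quadrilateral p, r, q, s, which is harmonic, and
  beyond each side the third vertex m of the adjacent outer triangle, with the cyclic orders needed
  for both the old and the new quadrilateral around that side.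
\<close>

lemma farey_quad:
  assumes "x \<in> farey"
  obtains p r q s m\<^sub>1 m\<^sub>2 m\<^sub>3 m\<^sub>4 where
    "x = {p, q}" "opposite farey x = {r, s}" "harmonic p r q s" "{p, r, q, s} \<subseteq> Qhat"
    "ccw_pentagon p m\<^sub>1 r q s" "opposite farey {p, r} = {q, m\<^sub>1}"
    "ccw_pentagon r m\<^sub>2 q s p" "opposite farey {r, q} = {p, m\<^sub>2}"
    "ccw_pentagon q m\<^sub>3 s p r" "opposite farey {q, s} = {p, m\<^sub>3}"
    "ccw_pentagon s m\<^sub>4 p r q" "opposite farey {s, p} = {q, m\<^sub>4}"
    "\<And>z. {r, z} \<in> farey \<Longrightarrow> {s, z} \<in> farey \<Longrightarrow> z \<in> {p, q}"
proof -
  obtain v1 v2 w1 w2 where vw: "v1 * w2 - v2 * w1 = 1" "x = {rational_pt v1 v2, rational_pt w1 w2}"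
    using assms unfolding farey_iff by blast
  define v w where "v = (v1, v2)" and "w = (w1, w2)"
  have uni: "unimodular v w" using vw(1) by (simp add: unimodular_def v_def w_def)
  let ?L = "lattice_pt v w"
  have prim: "primitive 1 0" "primitive (- 1) 1" "primitive 0 1" "primitive 1 1"
    unfolding primitive_def by presburger+
  have Qhat: "?L a b \<in> Qhat" if "primitive a b" for a b
    unfolding lattice_pt_def by (intro rational_pt_in_Qhat primitive_lattice uni that)
  have L: "?L 1 0 = rational_pt v1 v2" "?L 0 1 = rational_pt w1 w2"
    "?L (- 1) 1 = rational_pt (w1 - v1) (w2 - v2)" "?L 1 1 = rational_pt (w1 + v1) (w2 + v2)"
    by (simp_all add: lattice_pt_def v_def w_def add.commute)
  have x: "x = {?L 1 0, ?L 0 1}" unfolding L vw(2) ..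
  note opp = opposite_lattice[OF uni]
  show ?thesis
  proof (rule that)
    show "x = {?L 1 0, ?L 0 1}" by (rule x)
    show "opposite farey x = {?L (- 1) 1, ?L 1 1}" unfolding x by (simp add: opp)
    show "harmonic (?L 1 0) (?L (- 1) 1) (?L 0 1) (?L 1 1)" by (rule harmonic_lattice[OF uni])
    show "{?L 1 0, ?L (- 1) 1, ?L 0 1, ?L 1 1} \<subseteq> Qhat"
      using Qhat prim by simp
    show "ccw_pentagon (?L 1 0) (?L 2 (- 1)) (?L (- 1) 1) (?L 0 1) (?L 1 1)"
      "ccw_pentagon (?L (- 1) 1) (?L (- 1) 2) (?L 0 1) (?L 1 1) (?L 1 0)"
      "ccw_pentagon (?L 0 1) (?L 1 2) (?L 1 1) (?L 1 0) (?L (- 1) 1)"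
      "ccw_pentagon (?L 1 1) (?L 2 1) (?L 1 0) (?L (- 1) 1) (?L 0 1)"
      by (rule lattice_pentagons[OF uni])+
    have "opposite farey {?L 1 0, ?L (- 1) 1} = {?L (- 2) 1, ?L 0 1}" using opp[of 1 1 0 "- 1"] by simp
    then show "opposite farey {?L 1 0, ?L (- 1) 1} = {?L 0 1, ?L 2 (- 1)}"
      using lattice_pt_minus[of v w 2 "- 1"] by auto
    have "opposite farey {?L (- 1) 1, ?L 0 (- 1)} = {?L 1 (- 2), ?L (- 1) 0}" using opp[of "- 1" "- 1" 1 0] by simp
    then show "opposite farey {?L (- 1) 1, ?L 0 1} = {?L 1 0, ?L (- 1) 2}"
      using lattice_pt_minus[of v w 0 1] lattice_pt_minus[of v w 1 0] lattice_pt_minus[of v w "- 1" 2] by auto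
    have "opposite farey {?L 1 1, ?L 0 1} = {?L (- 1) 0, ?L 1 2}" using opp[of 1 1 1 0] by simp
    then show "opposite farey {?L 0 1, ?L 1 1} = {?L 1 0, ?L 1 2}"
      using lattice_pt_minus[of v w 1 0] by (simp add: insert_commute)
    have "opposite farey {?L 1 0, ?L 1 1} = {?L 0 1, ?L 2 1}" using opp[of 1 1 0 1] by simp
    then show "opposite farey {?L 1 1, ?L 1 0} = {?L 0 1, ?L 2 1}" by (simp add: insert_commute)
    show "z \<in> {?L 1 0, ?L 0 1}" if "{?L (- 1) 1, z} \<in> farey" "{?L 1 1, z} \<in> farey" for z
      using that unfolding L by (rule farey_common_neighbours[OF vw(1)])
  qed
qed

section \<open>The wavelets attached to modular group elements\<close>

lemma field_of_ideal_pt: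
  assumes "(x, y) \<noteq> (0, 0)"
  shows "field_of X (ideal_pt x y) = 2 * (X$2$1 * x\<^sup>2 - 2 * X$1$1 * x * y - X$1$2 * y\<^sup>2) / (x\<^sup>2 + y\<^sup>2)"
proof -
  have nz: "x\<^sup>2 + y\<^sup>2 \<noteq> 0" using assms by (rule sum_squares_nonzero)
  have common_denominator: "(c + b) * (u / n) + 2 * a * (m / n) + (c - b) = ((c + b) * u + 2 * a * m + (c - b) * n) / n"
    if "n \<noteq> 0" for a b c u m n :: real
    using that by (simp add: field_simps)
  show ?thesis
    using ideal_pt_in_S1[OF assms] unfolding field_of_def Re_ideal_pt Im_ideal_pt common_denominator[OF nz]
    by (simp add: algebra_simps)
qed

text \<open>
  At the direction u the field of X is 2 det (u, X u) divided by the squared norm of u, and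
  conjugating X amounts to transporting u.  The squared norms account for the conformal factor.
\<close>

lemma field_of_conjugate:
  fixes A M :: "real^2^2" and x y :: real
  assumes "det A = 1" "M \<in> sl2" "(x, y) \<noteq> (0, 0)"
  defines "X \<equiv> A$1$1 * x + A$1$2 * y" and "Y \<equiv> A$2$1 * x + A$2$2 * y"
  shows "field_of (mat2 (A$2$2) (- A$1$2) (- A$2$1) (A$1$1) ** M ** A) (ideal_pt x y) * (x\<^sup>2 + y\<^sup>2)
       = field_of M (ideal_pt X Y) * (X\<^sup>2 + Y\<^sup>2)"
proof -
  have "(X, Y) \<noteq> (0, 0)"
    using act_nonzero[of "mat2 (A$2$2) (- A$1$2) (- A$2$1) (A$1$1)" x y] assms(1,3)
    unfolding X_def Y_def by (simp add: det_2 mult.commute)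
  then have nz: "X\<^sup>2 + Y\<^sup>2 \<noteq> 0" "x\<^sup>2 + y\<^sup>2 \<noteq> 0" using assms(3) sum_squares_nonzero by blast+
  have M: "M$2$2 = - M$1$1" using assms(2) by (simp add: sl2_iff)
  show ?thesis
    unfolding field_of_ideal_pt[OF assms(3)] field_of_ideal_pt[OF \<open>(X, Y) \<noteq> (0, 0)\<close>]
    using nz apply (simp add: matrix_matrix_mult_def sum_2 M)
    unfolding X_def Y_def by (simp add: algebra_simps power2_eq_square)
qed

lemma matrix_inv_det_1:
  fixes A :: "real^2^2"
  assumes "det A = 1"
  shows "matrix_inv A = mat2 (A$2$2) (- A$1$2) (- A$2$1) (A$1$1)" (is "_ = ?B")
proof -
  have "A$1$1 * A$2$2 - A$1$2 * A$2$1 = 1" using assms by (simp add: det_2)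
  then have "A ** ?B = mat 1" "?B ** A = mat 1"
    by (simp_all add: vec_eq_iff forall_2 matrix_matrix_mult_def sum_2 mat_def algebra_simps)
  then have "A ** matrix_inv A = mat 1 \<and> matrix_inv A ** A = mat 1"
    unfolding matrix_inv_def by (intro someI_ex[of "\<lambda>B. A ** B = mat 1 \<and> B ** A = mat 1"] exI[of _ ?B] conjI)
  then have "matrix_inv A ** (A ** ?B) = ?B" by (simp add: matrix_mul_assoc)
  then show ?thesis using \<open>A ** ?B = mat 1\<close> by simp
qed

lemma mother_in_sl2: "mother z \<in> sl2"
  by (simp add: mother_def sl2_iff sl_e_def sl_f_def sl_h_def)

lemma transl_expand:
  assumes "z \<in> S1"
  shows "transl p q z = 2 * Im ((z + p * q * cnj z - (p + q)) / (p - q))"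
proof -
  have "z \<noteq> 0" "z * cnj z = 1" using assms by (auto simp: complex_norm_square[symmetric])
  then have "(z - p) * (z - q) = z * (z + p * q * cnj z - (p + q))"
    by (simp add: algebra_simps)
  then show ?thesis using assms \<open>z \<noteq> 0\<close> by (simp add: transl_def)
qed

lemma quadrant_iff:
  fixes x y :: real
  assumes "x\<^sup>2 + y\<^sup>2 = 1"
  shows "1 - x - y \<le> 0 \<longleftrightarrow> x \<ge> 0 \<and> y \<ge> 0"
proof
  have sq: "(x + y)\<^sup>2 = 1 + 2 * (x * y)" using assms by (simp add: power2_sum)
  assume le: "1 - x - y \<le> 0"
  then have "1 \<le> (x + y)\<^sup>2" using power_mono[of 1 "x + y" 2] by simp
  then have "0 \<le> x * y" using sq by simp
  then show "x \<ge> 0 \<and> y \<ge> 0" using le by (auto simp: zero_le_mult_iff)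
next
  have sq: "(x + y)\<^sup>2 = 1 + 2 * (x * y)" using assms by (simp add: power2_sum)
  assume "x \<ge> 0 \<and> y \<ge> 0"
  then have "1\<^sup>2 \<le> (x + y)\<^sup>2" "0 \<le> x + y" unfolding sq by auto
  then show "1 - x - y \<le> 0" using power2_le_imp_le[of 1 "x + y"] by simp
qed

text \<open>
  The quadrants are the arcs cut off by the sides of the square with vertices 1, i, -1, -i, and the
  diagonal from -1 to 1 is the geodesic from 0 to infinity.
\<close>

lemma mother_eq_quad_field:
  assumes "z \<in> S1"
  shows "field_of (mother z) z = quad_field 1 \<i> (- 1) (- \<i>) z"
proof -
  define x y where "x = Re z" and "y = Im z"
  have xy: "x\<^sup>2 + y\<^sup>2 = 1" using assms unfolding x_def y_def
    by (simp add: cmod_def)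
  have quadrants: "chord_side 1 \<i> z \<le> 0 \<longleftrightarrow> x \<ge> 0 \<and> y \<ge> 0" "chord_side \<i> (- 1) z \<le> 0 \<longleftrightarrow> x \<le> 0 \<and> y \<ge> 0"
    "chord_side (- 1) (- \<i>) z \<le> 0 \<longleftrightarrow> x \<le> 0 \<and> y \<le> 0"
    using quadrant_iff[of x y] quadrant_iff[of "- x" y] quadrant_iff[of "- x" "- y"] xy
    by (simp_all add: chord_side_def algebra_simps flip: x_def y_def)
  have "transl 1 \<i> z = 2 * x + 2 * y - 2" "transl (- 1) \<i> z = 2 * x - 2 * y + 2"
    "transl (- 1) (- \<i>) z = - 2 * x - 2 * y - 2" "transl 1 (- \<i>) z = - 2 * x + 2 * y + 2"
    unfolding transl_expand[OF assms] by (simp_all add: Im_divide field_simps flip: x_def y_def)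
  then show ?thesis
    using assms unfolding mother_def quad_field_def on_arcs_def quadrants
    by (simp add: field_of_def sl_e_def sl_f_def sl_h_def flip: x_def y_def)
qed

context
  fixes a b c d :: real
  assumes det: "a * d - b * c = 1"
begin

lemma linear_det:
  "(a * x + b * y) * (c * x' + d * y') - (c * x + d * y) * (a * x' + b * y') = x * y' - y * x'"
proof -
  have "(a * x + b * y) * (c * x' + d * y') - (c * x + d * y) * (a * x' + b * y') = (a * d - b * c) * (x * y' - y * x')"
    by (simp add: algebra_simps)
  then show ?thesis unfolding det by simp
qed

lemma linear_nonzero:
  assumes "(x, y) \<noteq> (0, 0)" shows "(a * x + b * y, c * x + d * y) \<noteq> (0, 0)"
proof
  assume "(a * x + b * y, c * x + d * y) = (0, 0)"
  then have "x * y' - y * x' = 0" for x' y' using linear_det[of x y x' y'] by simp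
  from this[of 1 0] this[of 0 1] assms show False by simp
qed

lemma transl_moebius:
  assumes "(x\<^sub>1, y\<^sub>1) \<noteq> (0, 0)" "(x\<^sub>2, y\<^sub>2) \<noteq> (0, 0)" "(x, y) \<noteq> (0, 0)"
  shows "transl (ideal_pt (a * x\<^sub>1 + b * y\<^sub>1) (c * x\<^sub>1 + d * y\<^sub>1)) (ideal_pt (a * x\<^sub>2 + b * y\<^sub>2) (c * x\<^sub>2 + d * y\<^sub>2))
      (ideal_pt (a * x + b * y) (c * x + d * y)) * ((a * x + b * y)\<^sup>2 + (c * x + d * y)\<^sup>2)
    = transl (ideal_pt x\<^sub>1 y\<^sub>1) (ideal_pt x\<^sub>2 y\<^sub>2) (ideal_pt x y) * (x\<^sup>2 + y\<^sup>2)"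
  unfolding transl_ideal_pt[OF assms] transl_ideal_pt[OF assms[THEN linear_nonzero]] linear_det
  using sum_squares_nonzero[OF assms(3)] sum_squares_nonzero[OF linear_nonzero[OF assms(3)]]
  by simp

lemma chord_side_moebius:
  assumes "(x\<^sub>1, y\<^sub>1) \<noteq> (0, 0)" "(x\<^sub>2, y\<^sub>2) \<noteq> (0, 0)" "(x, y) \<noteq> (0, 0)"
  shows "chord_side (ideal_pt (a * x\<^sub>1 + b * y\<^sub>1) (c * x\<^sub>1 + d * y\<^sub>1)) (ideal_pt (a * x\<^sub>2 + b * y\<^sub>2) (c * x\<^sub>2 + d * y\<^sub>2))
      (ideal_pt (a * x + b * y) (c * x + d * y)) \<le> 0
    \<longleftrightarrow> chord_side (ideal_pt x\<^sub>1 y\<^sub>1) (ideal_pt x\<^sub>2 y\<^sub>2) (ideal_pt x y) \<le> 0"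
proof -
  have *: "u / n \<le> 0 \<longleftrightarrow> u \<le> 0" if "n > 0" for u n :: real
    using that by (simp add: divide_le_0_iff not_less less_imp_le)
  show ?thesis
    unfolding chord_side_ideal_pt[OF assms] chord_side_ideal_pt[OF assms[THEN linear_nonzero]] linear_det
    by (subst (1 2) *) (intro mult_pos_pos sum_squares_pos assms linear_nonzero | rule refl)+
qed

text \<open>
  Translations and orientations are given by determinants, which a linear map of determinant 1
  preserves; only the conformal factor of the circle remains.
\<close>

lemma quad_field_moebius:
  assumes "(x\<^sub>1, y\<^sub>1) \<noteq> (0, 0)" "(x\<^sub>2, y\<^sub>2) \<noteq> (0, 0)" "(x\<^sub>3, y\<^sub>3) \<noteq> (0, 0)" "(x\<^sub>4, y\<^sub>4) \<noteq> (0, 0)" "(x, y) \<noteq> (0, 0)"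
  shows "quad_field (ideal_pt (a * x\<^sub>1 + b * y\<^sub>1) (c * x\<^sub>1 + d * y\<^sub>1)) (ideal_pt (a * x\<^sub>2 + b * y\<^sub>2) (c * x\<^sub>2 + d * y\<^sub>2))
      (ideal_pt (a * x\<^sub>3 + b * y\<^sub>3) (c * x\<^sub>3 + d * y\<^sub>3)) (ideal_pt (a * x\<^sub>4 + b * y\<^sub>4) (c * x\<^sub>4 + d * y\<^sub>4))
      (ideal_pt (a * x + b * y) (c * x + d * y)) * ((a * x + b * y)\<^sup>2 + (c * x + d * y)\<^sup>2)
    = quad_field (ideal_pt x\<^sub>1 y\<^sub>1) (ideal_pt x\<^sub>2 y\<^sub>2) (ideal_pt x\<^sub>3 y\<^sub>3) (ideal_pt x\<^sub>4 y\<^sub>4) (ideal_pt x y) * (x\<^sup>2 + y\<^sup>2)"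
  unfolding quad_field_def on_arcs_def
    chord_side_moebius[OF assms(1,2,5)] chord_side_moebius[OF assms(2,3,5)] chord_side_moebius[OF assms(3,4,5)]
  using transl_moebius[OF assms(1,2,5)] transl_moebius[OF assms(3,2,5)] transl_moebius[OF assms(3,4,5)]
    transl_moebius[OF assms(1,4,5)]
  by simp

end

lemma wavelet_mat_eq_quad_field:
  assumes "det A = 1"
  shows "wavelet_mat A = quad_field (ideal_pt (A$2$2) (- A$2$1)) (ideal_pt (- A$1$2 - A$2$2) (A$1$1 + A$2$1))
      (ideal_pt (- A$1$2) (A$1$1)) (ideal_pt (- A$1$2 + A$2$2) (A$1$1 - A$2$1))"
    (is "_ = quad_field ?p ?r ?q ?s")
proof
  fix z
  define a b c d where abcd: "a = A$1$1" "b = A$1$2" "c = A$2$1" "d = A$2$2"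
  have det: "a * d - b * c = 1" using assms by (simp add: det_2 abcd)
  show "wavelet_mat A z = quad_field ?p ?r ?q ?s z"
  proof (cases "z \<in> S1")
    case True
    then obtain x y where z: "z = ideal_pt x y" and n: "x\<^sup>2 + y\<^sup>2 = 1" using S1_ideal_ptE by metis
    then have nz: "(x, y) \<noteq> (0, 0)" by auto
    define X Y where "X = a * x + b * y" and "Y = c * x + d * y"
    have NZ: "(X, Y) \<noteq> (0, 0)" unfolding X_def Y_def by (rule linear_nonzero[OF det nz])
    have detinv: "det (mat2 d (- b) (- c) a) = 1" using det by (simp add: det_2 mult.commute)
    have inv: "matrix_inv A = mat2 d (- b) (- c) a" unfolding abcd by (rule matrix_inv_det_1[OF assms])
    have z': "circ_act z (matrix_inv A) = ideal_pt X Y"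
      unfolding inv z circ_act_ideal_pt[OF detinv nz] by (simp add: X_def Y_def)
    have "wavelet_mat A z * (x\<^sup>2 + y\<^sup>2) = field_of (mother (ideal_pt X Y)) (ideal_pt X Y) * (X\<^sup>2 + Y\<^sup>2)"
      unfolding wavelet_mat_def z' unfolding inv
      using field_of_conjugate[OF assms mother_in_sl2 nz] by (simp add: z X_def Y_def abcd)
    also have "\<dots> = quad_field 1 \<i> (- 1) (- \<i>) (ideal_pt X Y) * (X\<^sup>2 + Y\<^sup>2)"
      using mother_eq_quad_field[OF ideal_pt_in_S1[OF NZ]] by simp
    also have "\<dots> = quad_field (ideal_pt 1 0) (ideal_pt (- 1) 1) (ideal_pt 0 1) (ideal_pt 1 1) (ideal_pt X Y) * (X\<^sup>2 + Y\<^sup>2)"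
    proof -
      have "ideal_pt 1 0 = 1" "ideal_pt (- 1) 1 = \<i>" "ideal_pt 0 1 = - 1" "ideal_pt 1 1 = - \<i>"
        by (simp_all add: complex_eq_iff Re_ideal_pt Im_ideal_pt)
      then show ?thesis by simp
    qed
    also have "\<dots> = quad_field ?p ?r ?q ?s z * (x\<^sup>2 + y\<^sup>2)"
    proof -
      have images: "a * d + b * (- c) = 1" "c * d + d * (- c) = 0"
        "a * (- b - d) + b * (a + c) = - 1" "c * (- b - d) + d * (a + c) = 1"
        "a * (- b) + b * a = 0" "c * (- b) + d * a = 1"
        "a * (- b + d) + b * (a - c) = 1" "c * (- b + d) + d * (a - c) = 1"
        using det by (simp_all add: algebra_simps)
      have nzs: "(d, - c) \<noteq> (0, 0)" "(- b - d, a + c) \<noteq> (0, 0)" "(- b, a) \<noteq> (0, 0)" "(- b + d, a - c) \<noteq> (0, 0)"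
        using images by auto
      show ?thesis
        using quad_field_moebius[OF det nzs nz] unfolding images z X_def Y_def by (simp only: abcd)
    qed
    finally show ?thesis unfolding n by simp
  qed (simp add: wavelet_mat_def field_of_off quad_field_off)
qed

section \<open>Lambda lengths and the Ptolemy equation\<close>

text \<open>
  On a horocycle centred at p the Poisson kernel (1 - |z|^2) / |z - p|^2 is constant, with value
  (1 - r) / r.
\<close>

lemma horocycle_iff:
  assumes "p \<in> S1" "0 < r" "z \<in> ball 0 1"
  shows "z \<in> horocycle p r \<longleftrightarrow> r * (1 - (cmod z)\<^sup>2) = (1 - r) * (cmod (z - p))\<^sup>2"
proof -
  have p: "(Re p)\<^sup>2 + (Im p)\<^sup>2 = 1" using assms(1) by (simp add: cmod_def)
  have "z \<in> horocycle p r \<longleftrightarrow> (cmod (z - of_real (1 - r) * p))\<^sup>2 = r\<^sup>2"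
    using assms(2,3) unfolding horocycle_def dist_norm
    by (simp add: power2_eq_iff_nonneg)
  also have "(cmod (z - of_real (1 - r) * p))\<^sup>2 - r\<^sup>2 = (1 - r) * (cmod (z - p))\<^sup>2 - r * (1 - (cmod z)\<^sup>2)"
    unfolding cmod_power2 using p by (simp add: power2_eq_square) algebra
  then have "(cmod (z - of_real (1 - r) * p))\<^sup>2 = r\<^sup>2 \<longleftrightarrow> r * (1 - (cmod z)\<^sup>2) = (1 - r) * (cmod (z - p))\<^sup>2"
    by linarith
  finally show ?thesis .
qed

text \<open>
  Along the geodesic the Poisson kernels at the initial and at the terminal endpoint are the
  exponentials exp (-t) and exp t, up to constants that are the squared norms of the rows of A.
\<close>

lemma geodesic_path_power:
  fixes A :: "real^2^2" and t :: real
  assumes det: "det A = 1"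
  defines "a \<equiv> A$1$1" and "b \<equiv> A$1$2" and "c \<equiv> A$2$1" and "d \<equiv> A$2$2" and "z \<equiv> geodesic_path A t"
  shows "z \<in> ball 0 1"
    and "1 - (cmod z)\<^sup>2 = (cmod (z - ideal_pt (- b) a))\<^sup>2 * (a\<^sup>2 + b\<^sup>2) * exp (- t)"
    and "1 - (cmod z)\<^sup>2 = (cmod (z - ideal_pt d (- c)))\<^sup>2 * (c\<^sup>2 + d\<^sup>2) * exp t"
    and "0 < 1 - (cmod z)\<^sup>2"
proof -
  define E where "E = exp t"
  have E: "E > 0" "exp (- t) = 1 / E" by (simp_all add: E_def exp_minus inverse_eq_divide)
  have ad: "a * d - b * c = 1" using det by (simp add: det_2 a_def b_def c_def d_def)
  \<comment> \<open>The path point is N / D; as A has determinant 1, the moduli of N and D differ by a simple term.\<close>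
  define N D where "N = Complex (- b - c * E) (d * E - a)" and "D = Complex (c * E - b) (a + d * E)"
  have abcd: "(a, b) \<noteq> (0, 0)" "(c, d) \<noteq> (0, 0)" using ad by auto
  have sq: "a\<^sup>2 + b\<^sup>2 > 0" "c\<^sup>2 + d\<^sup>2 > 0" using abcd sum_squares_pos by blast+
  have normD: "(cmod D)\<^sup>2 = E\<^sup>2 * (c\<^sup>2 + d\<^sup>2) + (a\<^sup>2 + b\<^sup>2) + 2 * E"
    and normN: "(cmod N)\<^sup>2 = E\<^sup>2 * (c\<^sup>2 + d\<^sup>2) + (a\<^sup>2 + b\<^sup>2) - 2 * E"
    unfolding cmod_power2 N_def D_def complex.sel using ad by algebra+
  have Dpos: "(cmod D)\<^sup>2 > 0" 
  proof -
    have "0 < E\<^sup>2 * (c\<^sup>2 + d\<^sup>2)" using E sq by simp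
    then show ?thesis unfolding normD using E sq by linarith
  qed
  then have D0: "D \<noteq> 0" by auto
  have z: "z = N / D"
  proof -
    define y where "y = \<i> * complex_of_real E"
    have den: "- of_real c * y + of_real a \<noteq> 0"
      using abcd E ad by (auto simp: y_def complex_eq_iff)
    have "z = ((of_real d * y - of_real b) / (- of_real c * y + of_real a) - \<i>) /
       ((of_real d * y - of_real b) / (- of_real c * y + of_real a) + \<i>)"
      unfolding z_def geodesic_path_def Let_def y_def E_def a_def b_def c_def d_def by simp
    also have "\<dots> = (of_real d * y - of_real b - \<i> * (- of_real c * y + of_real a)) /
       (of_real d * y - of_real b + \<i> * (- of_real c * y + of_real a))"
    proof -
      have "(u / k - \<i>) / (u / k + \<i>) = (u - \<i> * k) / (u + \<i> * k)" if "k \<noteq> 0" for u k :: complex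
      proof -
        have "u / k - \<i> = (u - \<i> * k) / k" "u / k + \<i> = (u + \<i> * k) / k" using that by (simp_all add: field_simps)
        then show ?thesis using that by simp
      qed
      from this[OF den] show ?thesis .
    qed
    also have "of_real d * y - of_real b - \<i> * (- of_real c * y + of_real a) = N"
      by (simp add: complex_eq_iff y_def N_def)
    also have "of_real d * y - of_real b + \<i> * (- of_real c * y + of_real a) = D"
      by (simp add: complex_eq_iff y_def D_def)
    finally show ?thesis .
  qed
  have one: "1 - (cmod z)\<^sup>2 = 4 * E / (cmod D)\<^sup>2"
  proof -
    have "(cmod z)\<^sup>2 = (cmod N)\<^sup>2 / (cmod D)\<^sup>2" unfolding z by (simp add: norm_divide power_divide)
    also have "1 - \<dots> = ((cmod D)\<^sup>2 - (cmod N)\<^sup>2) / (cmod D)\<^sup>2" using Dpos by (simp add: diff_divide_distrib)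
    also have "(cmod D)\<^sup>2 - (cmod N)\<^sup>2 = 4 * E" unfolding normD normN by simp
    finally show ?thesis .
  qed
  then show pos: "0 < 1 - (cmod z)\<^sup>2" using E Dpos by simp
  then have "(cmod z)\<^sup>2 < 1\<^sup>2" by simp
  then have "cmod z < 1" by (rule power2_less_imp_less) simp
  then show "z \<in> ball 0 1" by simp
  have cancel: "4 * E / n = 4 * E\<^sup>2 / (n * k) * k * (1 / E)" "4 * E / n = 4 / (n * k) * k * E"
    if "n > 0" "k > 0" for n k
    using that E(1) by (simp_all add: power2_eq_square)
  have sub: "N / D - u / k = (N * k - u * D) / (D * k)" if "k \<noteq> 0" for u k
    using that D0 by (simp add: field_simps)
  have p: "z - ideal_pt (- b) a = of_real (- 2 * E) / (D * Complex (- b) a)"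
  proof -
    have "N * Complex (- b) a - Complex (- b) (- a) * D = of_real (- 2 * E * (a * d - b * c))"
      unfolding N_def D_def by (simp add: complex_eq_iff algebra_simps)
    moreover have "Complex (- b) a \<noteq> 0" using abcd by (auto simp: complex_eq_iff)
    ultimately show ?thesis unfolding z ideal_pt_def minus_minus ad by (simp add: sub)
  qed
  have "(cmod (z - ideal_pt (- b) a))\<^sup>2 = 4 * E\<^sup>2 / ((cmod D)\<^sup>2 * (a\<^sup>2 + b\<^sup>2))"
    unfolding p by (simp add: norm_divide norm_mult power_divide power_mult_distrib cmod_power2 add.commute)
  then show "1 - (cmod z)\<^sup>2 = (cmod (z - ideal_pt (- b) a))\<^sup>2 * (a\<^sup>2 + b\<^sup>2) * exp (- t)"
    unfolding one E(2) using cancel(1)[OF Dpos sq(1)] by (simp only:)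
  have q: "z - ideal_pt d (- c) = - 2 * \<i> / (D * Complex d (- c))"
  proof -
    have "N * Complex d (- c) - Complex d c * D = - 2 * \<i> * of_real (a * d - b * c)"
      unfolding N_def D_def by (simp add: complex_eq_iff algebra_simps)
    moreover have "Complex d (- c) \<noteq> 0" using abcd by (auto simp: complex_eq_iff)
    ultimately show ?thesis unfolding z ideal_pt_def minus_minus ad by (simp add: sub)
  qed
  have "(cmod (z - ideal_pt d (- c)))\<^sup>2 = 4 / ((cmod D)\<^sup>2 * (c\<^sup>2 + d\<^sup>2))"
    unfolding q by (simp add: norm_divide norm_mult power_divide power_mult_distrib cmod_power2 add.commute)
  then show "1 - (cmod z)\<^sup>2 = (cmod (z - ideal_pt d (- c)))\<^sup>2 * (c\<^sup>2 + d\<^sup>2) * exp t"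
    unfolding one E_def[symmetric] using cancel(2)[OF Dpos sq(2)] by (simp only:)
qed

text \<open>
  The value of the Poisson kernel at the centre along the horocycle of Euclidean radius r.
\<close>

definition horo_size :: "real \<Rightarrow> real" where
  "horo_size r = (1 - r) / r"

lemma geodesic_meets_horocycle_iff:
  fixes A :: "real^2^2"
  assumes det: "det A = 1" and r: "0 < r"
  shows "geodesic_path A t \<in> horocycle (ideal_pt (- A$1$2) (A$1$1)) r
            \<longleftrightarrow> exp (- t) * ((A$1$1)\<^sup>2 + (A$1$2)\<^sup>2) = horo_size r"
    and "geodesic_path A t \<in> horocycle (ideal_pt (A$2$2) (- A$2$1)) r
            \<longleftrightarrow> exp t * ((A$2$1)\<^sup>2 + (A$2$2)\<^sup>2) = horo_size r"
proof -
  note g = geodesic_path_power[OF det, of t]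
  have "A$1$1 * A$2$2 - A$1$2 * A$2$1 = 1" using det by (simp add: det_2)
  then have nz: "(- A$1$2, A$1$1) \<noteq> (0, 0)" "(A$2$2, - A$2$1) \<noteq> (0, 0)" by auto
  have cancel: "r * (n * k) = (1 - r) * n \<longleftrightarrow> k = horo_size r" if "n * k > 0" for n k
  proof -
    have "n \<noteq> 0" using that by auto
    then have "r * (n * k) = (1 - r) * n \<longleftrightarrow> r * k = 1 - r"
      by (metis mult.commute mult.left_commute mult_cancel_left)
    also have "\<dots> \<longleftrightarrow> k = horo_size r" using r by (auto simp: horo_size_def field_simps)
    finally show ?thesis .
  qed
  show "geodesic_path A t \<in> horocycle (ideal_pt (- A$1$2) (A$1$1)) r
            \<longleftrightarrow> exp (- t) * ((A$1$1)\<^sup>2 + (A$1$2)\<^sup>2) = horo_size r"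
    unfolding horocycle_iff[OF ideal_pt_in_S1[OF nz(1)] r g(1)]
    using cancel[of "(cmod (geodesic_path A t - ideal_pt (- A$1$2) (A$1$1)))\<^sup>2" "exp (- t) * ((A$1$1)\<^sup>2 + (A$1$2)\<^sup>2)"]
      g(4) unfolding g(2) by (simp add: mult_ac)
  show "geodesic_path A t \<in> horocycle (ideal_pt (A$2$2) (- A$2$1)) r
            \<longleftrightarrow> exp t * ((A$2$1)\<^sup>2 + (A$2$2)\<^sup>2) = horo_size r"
    unfolding horocycle_iff[OF ideal_pt_in_S1[OF nz(2)] r g(1)]
    using cancel[of "(cmod (geodesic_path A t - ideal_pt (A$2$2) (- A$2$1)))\<^sup>2" "exp t * ((A$2$1)\<^sup>2 + (A$2$2)\<^sup>2)"]
      g(4) unfolding g(3) by (simp add: mult_ac)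
qed

lemma cmod_diff_endpoints:
  fixes A :: "real^2^2"
  assumes "det A = 1"
  shows "(cmod (ideal_pt (- A$1$2) (A$1$1) - ideal_pt (A$2$2) (- A$2$1)))\<^sup>2
          = 4 / (((A$1$1)\<^sup>2 + (A$1$2)\<^sup>2) * ((A$2$1)\<^sup>2 + (A$2$2)\<^sup>2))"
proof -
  have det: "A$1$1 * A$2$2 - A$1$2 * A$2$1 = 1" using assms by (simp add: det_2)
  then have nz: "(- A$1$2, A$1$1) \<noteq> (0, 0)" "(A$2$2, - A$2$1) \<noteq> (0, 0)" by auto
  have "A$2$2 * A$1$1 - (- A$2$1) * (- A$1$2) = 1" using det by (simp add: mult.commute)
  then show ?thesis
    unfolding ideal_pt_diff[OF nz(2,1)]
    by (simp only:) (simp add: norm_divide norm_mult power_divide power_mult_distrib cmod_power2 add.commute)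
qed

lemma SL2R_with_endpoints:
  assumes "p \<in> S1" "q \<in> S1" "p \<noteq> q"
  obtains A where "A \<in> SL2R" "oriented_edge A = (p, q)"
proof -
  obtain x y where p: "p = ideal_pt x y" "x\<^sup>2 + y\<^sup>2 = 1" using S1_ideal_ptE[OF assms(1)] .
  obtain x' y' where q: "q = ideal_pt x' y'" "x'\<^sup>2 + y'\<^sup>2 = 1" using S1_ideal_ptE[OF assms(2)] .
  have nz: "(x, y) \<noteq> (0, 0)" "(x', y') \<noteq> (0, 0)" using p q by auto
  define k where "k = 1 / (y * x' - x * y')"
  have "y * x' - x * y' \<noteq> 0" using assms(3) ideal_pt_eq_iff[OF nz(2,1)] p q by (auto simp: mult.commute)
  then have k: "k \<noteq> 0" "k * (y * x' - x * y') = 1" by (simp_all add: k_def)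
  define A where "A = mat2 (k * y) (- k * x) (- y') x'"
  have "det A = k * (y * x' - x * y')" by (simp add: A_def det_2 algebra_simps)
  then have det: "det A = 1" using k by simp
  have "ideal_pt (k * x) (k * y) = ideal_pt x y"
    using ideal_pt_eq_iff[OF nz(1), of "k * x" "k * y"] k nz(1) by auto
  then have "oriented_edge A = (p, q)" unfolding oriented_edge_eq[OF det] p q by (simp add: A_def)
  then show ?thesis using that det unfolding SL2R_def by blast
qed

text \<open>
  The crossing times of the two horocycles are read off from the Poisson kernels, and the product of
  the two constants is 4 divided by the squared Euclidean distance of the endpoints.  The result is
  symmetric in the endpoints and independent of the parametrization, so the distance is well defined.
\<close>

lemma exp_signed_horo_dist:
  assumes S: "\<phi> u \<in> S1" "\<phi> v \<in> S1" and ne: "\<phi> u \<noteq> \<phi> v"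
    and \<rho>: "0 < \<rho> u" "\<rho> u < 1" "0 < \<rho> v" "\<rho> v < 1"
  shows "exp (signed_horo_dist (\<phi>, \<rho>) {u, v})
           = horo_size (\<rho> u) * horo_size (\<rho> v) * (cmod (\<phi> u - \<phi> v))\<^sup>2 / 4" (is "_ = ?K")
proof -
  define P where "P l \<longleftrightarrow> (\<exists>u' v' A t\<^sub>1 t\<^sub>2. {u, v} = {u', v'} \<and> A \<in> SL2R \<and>
        oriented_edge A = (\<phi> u', \<phi> v') \<and>
        geodesic_path A t\<^sub>1 \<in> horocycle (\<phi> u') (\<rho> u') \<and>
        geodesic_path A t\<^sub>2 \<in> horocycle (\<phi> v') (\<rho> v') \<and> l = t\<^sub>2 - t\<^sub>1)" for l
  have dist: "exp (t\<^sub>2 - t\<^sub>1) = horo_size r\<^sub>1 * horo_size r\<^sub>2 * (cmod (p - q))\<^sup>2 / 4"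
    if A: "A \<in> SL2R" "oriented_edge A = (p, q)" and r: "0 < r\<^sub>1" "0 < r\<^sub>2"
      and meets: "geodesic_path A t\<^sub>1 \<in> horocycle p r\<^sub>1" "geodesic_path A t\<^sub>2 \<in> horocycle q r\<^sub>2"
    for A p q r\<^sub>1 r\<^sub>2 t\<^sub>1 t\<^sub>2
  proof -
    have det: "det A = 1" using A(1) by (simp add: SL2R_def)
    have pq: "p = ideal_pt (- A$1$2) (A$1$1)" "q = ideal_pt (A$2$2) (- A$2$1)"
      using A(2) unfolding oriented_edge_eq[OF det] by auto
    have h: "exp (- t\<^sub>1) * ((A$1$1)\<^sup>2 + (A$1$2)\<^sup>2) = horo_size r\<^sub>1" "exp t\<^sub>2 * ((A$2$1)\<^sup>2 + (A$2$2)\<^sup>2) = horo_size r\<^sub>2"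
      using meets geodesic_meets_horocycle_iff[OF det] r unfolding pq by blast+
    have "A$1$1 * A$2$2 - A$1$2 * A$2$1 = 1" using det by (simp add: det_2)
    then have "(A$1$1)\<^sup>2 + (A$1$2)\<^sup>2 \<noteq> 0" "(A$2$1)\<^sup>2 + (A$2$2)\<^sup>2 \<noteq> 0"
      by (auto simp: sum_power2_eq_zero_iff)
    moreover have "exp (t\<^sub>2 - t\<^sub>1) = exp (- t\<^sub>1) * exp t\<^sub>2" by (simp flip: exp_add)
    moreover have "e * e' = e * m * (e' * n) * (4 / (m * n)) / 4" if "m \<noteq> 0" "n \<noteq> 0" for e e' m n :: real
      using that by simp
    ultimately show ?thesis
      unfolding pq cmod_diff_endpoints[OF det] h[symmetric] by metis
  qed
  have size: "0 < horo_size (\<rho> u)" "0 < horo_size (\<rho> v)" using \<rho> by (simp_all add: horo_size_def)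
  have P: "exp l = ?K" if "P l" for l
  proof -
    obtain u' v' A t\<^sub>1 t\<^sub>2 where *: "{u, v} = {u', v'}" "A \<in> SL2R" "oriented_edge A = (\<phi> u', \<phi> v')"
        "geodesic_path A t\<^sub>1 \<in> horocycle (\<phi> u') (\<rho> u')"
        "geodesic_path A t\<^sub>2 \<in> horocycle (\<phi> v') (\<rho> v')" "l = t\<^sub>2 - t\<^sub>1"
      using \<open>P l\<close> unfolding P_def by blast
    have uv: "u' = u \<and> v' = v \<or> u' = v \<and> v' = u" using *(1) by (metis doubleton_eq_iff)
    then have "0 < \<rho> u'" "0 < \<rho> v'" using \<rho> by auto
    from dist[OF *(2,3) this *(4,5)] show ?thesis
      unfolding *(6) using uv by (auto simp: norm_minus_commute mult.commute)
  qed
  have "P (ln ?K)"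
  proof -
    \<comment> \<open>The crossing times solve exponential equations, so they exist.\<close>
    obtain A where A: "A \<in> SL2R" "oriented_edge A = (\<phi> u, \<phi> v)" using SL2R_with_endpoints[OF S ne] .
    have det: "det A = 1" using A(1) by (simp add: SL2R_def)
    have pq: "\<phi> u = ideal_pt (- A$1$2) (A$1$1)" "\<phi> v = ideal_pt (A$2$2) (- A$2$1)"
      using A(2) unfolding oriented_edge_eq[OF det] by auto
    define m n where "m = (A$1$1)\<^sup>2 + (A$1$2)\<^sup>2" and "n = (A$2$1)\<^sup>2 + (A$2$2)\<^sup>2"
    have "A$1$1 * A$2$2 - A$1$2 * A$2$1 = 1" using det by (simp add: det_2)
    then have mn: "m > 0" "n > 0" unfolding m_def n_def by (auto simp: sum_power2_gt_zero_iff)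
    define t\<^sub>1 t\<^sub>2 where "t\<^sub>1 = - ln (horo_size (\<rho> u) / m)" and "t\<^sub>2 = ln (horo_size (\<rho> v) / n)"
    have "geodesic_path A t\<^sub>1 \<in> horocycle (\<phi> u) (\<rho> u)" "geodesic_path A t\<^sub>2 \<in> horocycle (\<phi> v) (\<rho> v)"
      unfolding pq geodesic_meets_horocycle_iff(1)[OF det \<rho>(1)] geodesic_meets_horocycle_iff(2)[OF det \<rho>(3)]
      using mn size by (simp_all add: t\<^sub>1_def t\<^sub>2_def m_def[symmetric] n_def[symmetric])
    moreover from this have "exp (t\<^sub>2 - t\<^sub>1) = ?K" using dist[OF A \<rho>(1,3)] by blast
    then have "ln ?K = t\<^sub>2 - t\<^sub>1" by (metis ln_exp)
    ultimately show ?thesis unfolding P_def using A by blast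
  qed
  then have "\<exists>!l. P l" using P by (metis exp_inj_iff)
  then have "P (THE l. P l)" by (rule theI')
  moreover have "signed_horo_dist (\<phi>, \<rho>) {u, v} = (THE l. P l)"
    unfolding signed_horo_dist_def P_def by simp
  ultimately show ?thesis using P by simp
qed

text \<open>
  Up to a factor for each endpoint, the lambda length is the Euclidean length of the chord.
\<close>

lemma lambda_length_eq:
  assumes "\<phi> u \<in> S1" "\<phi> v \<in> S1" "\<phi> u \<noteq> \<phi> v" "0 < \<rho> u" "\<rho> u < 1" "0 < \<rho> v" "\<rho> v < 1"
  shows "lambda_length (\<phi>, \<rho>) {u, v} = sqrt (horo_size (\<rho> u)) * sqrt (horo_size (\<rho> v)) * cmod (\<phi> u - \<phi> v) / 2"
  unfolding lambda_length_def exp_signed_horo_dist[where \<phi> = \<phi> and \<rho> = \<rho>, OF assms]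
  by (simp add: real_sqrt_mult real_sqrt_divide)

lemma lambda_length_pos: "0 < lambda_length D x"
  by (simp add: lambda_length_def)

lemma cmod_cis_diff:
  assumes "a < b" "b < a + 2 * pi"
  shows "cmod (cis a - cis b) = 2 * sin ((b - a)/2)"
proof -
  have "(cmod (cis a - cis b))\<^sup>2 = 2 - 2 * cos (b - a)"
    unfolding cmod_power2 cos_diff using sin_cos_squared_add[of a] sin_cos_squared_add[of b]
    by (simp only: minus_complex.sel cis.sel) algebra
  also have "\<dots> = (2 * sin ((b - a)/2))\<^sup>2"
  proof -
    have "2 * ((b - a)/2) = b - a" by simp
    then have "cos (b - a) = 1 - 2 * (sin ((b - a)/2))\<^sup>2" using cos_double_sin[of "(b - a)/2"] by metis
    then show ?thesis by (simp add: power_mult_distrib)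
  qed
  finally have sq: "(cmod (cis a - cis b))\<^sup>2 = (2 * sin ((b - a)/2))\<^sup>2" .
  have "0 \<le> 2 * sin ((b - a)/2)" using sin_half_pos_iff[of "b - a"] assms by simp
  with sq norm_ge_zero show ?thesis by (rule power2_eq_imp_eq)
qed

text \<open>
  Chords are half-angle sines, and the equation is the three-term Pluecker relation for them.
\<close>

lemma ptolemy_chords:
  assumes "ccw_quad p r q s"
  shows "cmod (p - q) * cmod (r - s) = cmod (p - r) * cmod (q - s) + cmod (r - q) * cmod (s - p)"
proof -
  obtain a b c d where *: "a < b" "b < c" "c < d" "d < a + 2 * pi"
    and eqs: "p = cis a" "r = cis b" "q = cis c" "s = cis d"
    using assms unfolding ccw_quad_def by blast
  have sin: "sin ((v - u)/2) = sin (v/2) * cos (u/2) - cos (v/2) * sin (u/2)" for u v :: real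
    by (simp add: diff_divide_distrib sin_diff)
  have chords: "cmod (p - q) = 2 * sin ((c - a)/2)" "cmod (r - s) = 2 * sin ((d - b)/2)"
    "cmod (p - r) = 2 * sin ((b - a)/2)" "cmod (q - s) = 2 * sin ((d - c)/2)"
    "cmod (r - q) = 2 * sin ((c - b)/2)" "cmod (p - s) = 2 * sin ((d - a)/2)"
    unfolding eqs using * by (intro cmod_cis_diff; simp)+
  show ?thesis unfolding norm_minus_commute[of s p] chords sin by (simp add: algebra_simps)
qed

text \<open>
  A lift to the line is strictly increasing and commutes with full turns.
\<close>

lemma homeo_ccw_quad:
  assumes \<phi>: "orientation_preserving_homeo \<phi>" and "ccw_quad p r q s"
  shows "ccw_quad (\<phi> p) (\<phi> r) (\<phi> q) (\<phi> s)"
proof -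
  obtain a b c d where *: "a < b" "b < c" "c < d" "d < a + 2 * pi"
    and eqs: "p = cis a" "r = cis b" "q = cis c" "s = cis d"
    using assms(2) unfolding ccw_quad_def by blast
  obtain g where g: "strict_mono g" "\<And>t. g (t + 2 * pi) = g t + 2 * pi" "\<And>t. \<phi> (cis t) = cis (g t)"
    using \<phi> unfolding orientation_preserving_homeo_def by blast
  have "g a < g b" "g b < g c" "g c < g d" "g d < g a + 2 * pi"
    using * g(1) unfolding g(2)[symmetric] by (simp_all add: strict_mono_less)
  then show ?thesis unfolding ccw_quad_def eqs g(3) by blast
qed

text \<open>
  Every product in the Ptolemy equation for chords acquires the same factor, one for each vertex.
\<close>

lemma ptolemy_lambda_length:
  assumes D: "D \<in> decorated_tess" and ccw: "ccw_quad p r q s" and Q: "{p, r, q, s} \<subseteq> Qhat"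
  shows "lambda_length D {p, q} * lambda_length D {r, s}
    = lambda_length D {p, r} * lambda_length D {q, s} + lambda_length D {r, q} * lambda_length D {s, p}"
proof -
  obtain \<phi> \<rho> where D_eq: "D = (\<phi>, \<rho>)" by (cases D)
  have \<phi>: "orientation_preserving_homeo \<phi>" and \<rho>: "\<And>u. u \<in> Qhat \<Longrightarrow> 0 < \<rho> u \<and> \<rho> u < 1"
    using D unfolding D_eq decorated_tess_def by auto
  note ccw' = homeo_ccw_quad[OF \<phi> ccw]
  have S: "\<phi> p \<in> S1" "\<phi> r \<in> S1" "\<phi> q \<in> S1" "\<phi> s \<in> S1" using ccw_quad_S1[OF ccw'] by auto
  have ne: "\<phi> p \<noteq> \<phi> r" "\<phi> p \<noteq> \<phi> q" "\<phi> s \<noteq> \<phi> p" "\<phi> r \<noteq> \<phi> q" "\<phi> r \<noteq> \<phi> s" "\<phi> q \<noteq> \<phi> s"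
    using ccw_quad_distinct[OF ccw'] by auto
  have \<rho>': "0 < \<rho> p" "\<rho> p < 1" "0 < \<rho> r" "\<rho> r < 1" "0 < \<rho> q" "\<rho> q < 1" "0 < \<rho> s" "\<rho> s < 1"
    using \<rho> Q by auto
  define k where "k u = sqrt (horo_size (\<rho> u))" for u
  have l: "lambda_length D {p, q} = k p * k q * cmod (\<phi> p - \<phi> q) / 2"
    "lambda_length D {r, s} = k r * k s * cmod (\<phi> r - \<phi> s) / 2"
    "lambda_length D {p, r} = k p * k r * cmod (\<phi> p - \<phi> r) / 2"
    "lambda_length D {q, s} = k q * k s * cmod (\<phi> q - \<phi> s) / 2"
    "lambda_length D {r, q} = k r * k q * cmod (\<phi> r - \<phi> q) / 2"
    "lambda_length D {s, p} = k s * k p * cmod (\<phi> s - \<phi> p) / 2"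
    unfolding D_eq k_def by (intro lambda_length_eq S ne \<rho>')+
  have "lambda_length D {p, q} * lambda_length D {r, s}
     = k p * k q * k r * k s / 4 * (cmod (\<phi> p - \<phi> q) * cmod (\<phi> r - \<phi> s))"
    unfolding l by simp
  also have "\<dots> = lambda_length D {p, r} * lambda_length D {q, s} + lambda_length D {r, q} * lambda_length D {s, p}"
    unfolding l ptolemy_chords[OF ccw'] by (simp add: field_simps)
  finally show ?thesis .
qed

text \<open>
  The logarithmic derivative of the Ptolemy equation at a point where the edge and the four sides
  have lambda length 1, and where therefore the other diagonal has lambda length 2.
\<close>

lemma dlog_lambda_diagonal:
  assumes c: "c \<in> curves_at_identity" and ccw: "ccw_quad p r q s" and Q: "{p, r, q, s} \<subseteq> Qhat"
    and edges: "{p, q} \<in> farey" "{p, r} \<in> farey" "{r, q} \<in> farey" "{q, s} \<in> farey" "{s, p} \<in> farey"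
  shows "dlog_lambda {r, s} c = 1/2 * (dlog_lambda {p, r} c + dlog_lambda {r, q} c
           + dlog_lambda {q, s} c + dlog_lambda {s, p} c) - dlog_lambda {p, q} c"
proof -
  define L where "L x t = lambda_length (c t) x" for x t
  have pos: "0 < L x t" for x t unfolding L_def by (rule lambda_length_pos)
  have one: "L x 0 = 1" if "x \<in> farey" for x
    using c that unfolding curves_at_identity_def is_identity_def L_def by auto
  have diff: "(L x has_real_derivative deriv (L x) 0) (at 0)" if "x \<in> farey" for x
  proof -
    have "L x differentiable (at 0)" using c that unfolding curves_at_identity_def L_def by auto
    then show ?thesis by (meson DERIV_deriv_iff_real_differentiable)
  qed
  have dlog: "dlog_lambda x c = deriv (L x) 0" if "x \<in> farey" for x
  proof -
    have "((\<lambda>t. ln (L x t)) has_real_derivative deriv (L x) 0) (at 0)"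
      using diff[OF that] one[OF that] by (auto intro!: derivative_eq_intros)
    then show ?thesis unfolding dlog_lambda_def L_def by (rule DERIV_imp_deriv)
  qed
  have "L {p, q} t * L {r, s} t = L {p, r} t * L {q, s} t + L {r, q} t * L {s, p} t" for t
    using c ptolemy_lambda_length[OF _ ccw Q] unfolding curves_at_identity_def L_def by auto
  then have "L {r, s} t = (L {p, r} t * L {q, s} t + L {r, q} t * L {s, p} t) / L {p, q} t" for t
    using pos[of "{p, q}" t] by (simp add: field_simps)
  then have log: "ln (L {r, s} t) = ln (L {p, r} t * L {q, s} t + L {r, q} t * L {s, p} t) - ln (L {p, q} t)" for t
    by (simp only:) (intro ln_divide_pos add_pos_pos mult_pos_pos pos)
  have "((\<lambda>t. ln (L {r, s} t)) has_real_derivative 1/2 * (deriv (L {p, r}) 0 + deriv (L {r, q}) 0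
           + deriv (L {q, s}) 0 + deriv (L {s, p}) 0) - deriv (L {p, q}) 0) (at 0)"
    unfolding log using edges[THEN diff] edges[THEN one]
    by (auto intro!: derivative_eq_intros)
  then show ?thesis
    using edges by (simp add: dlog) (simp add: dlog_lambda_def L_def DERIV_imp_deriv)
qed

section \<open>The two forms of the coefficients\<close>

lemma SL2Z_entries:
  assumes "A \<in> SL2Z"
  obtains a b c d :: int where "a * d - b * c = 1" "A = mat2 (of_int a) (of_int b) (of_int c) (of_int d)"
proof -
  have det: "det A = 1" and int: "A$i$j \<in> \<int>" for i j using assms unfolding SL2Z_def SL2R_def by auto
  obtain a b c d where abcd: "A$1$1 = of_int a" "A$1$2 = of_int b" "A$2$1 = of_int c" "A$2$2 = of_int d"
    using int unfolding Ints_def by (metis imageE)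
  have "real_of_int (a * d - b * c) = 1" using det by (simp add: det_2 abcd)
  then have "a * d - b * c = 1" by (simp only: of_int_eq_1_iff)
  then show ?thesis using that mat2_eta[of A] unfolding abcd by metis
qed

lemma SL2Z_mat2:
  assumes "a * d - b * c = (1 :: int)"
  shows "mat2 (of_int a) (of_int b) (of_int c) (of_int d) \<in> SL2Z"
proof -
  have "det (mat2 (of_int a) (of_int b) (of_int c) (of_int d)) = of_int (a * d - b * c)" by (simp add: det_2)
  then show ?thesis using assms unfolding SL2Z_def SL2R_def by (simp add: forall_2)
qed

lemma uminus_mat2: "- mat2 a b c d = mat2 (- a) (- b) (- c) (- d)"
  by (simp add: vec_eq_iff forall_2)

lemma mat2_eq_iff: "mat2 a b c d = mat2 a' b' c' d' \<longleftrightarrow> a = a' \<and> b = b' \<and> c = c' \<and> d = d'"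
  by (auto simp: vec_eq_iff forall_2)

lemma SL2Z_minus: "A \<in> SL2Z \<Longrightarrow> - A \<in> SL2Z"
  unfolding SL2Z_def SL2R_def by (simp add: det_minus_mat2)

lemma SL2Z_det: "A \<in> SL2Z \<Longrightarrow> det A = 1"
  unfolding SL2Z_def SL2R_def by simp

text \<open>
  Transporting the square of the mother wavelet by the inverse of A gives the quadrilateral around
  the edge of A, so both descriptions yield the same quadrilateral field.
\<close>

lemma wavelet_mat_eq_wavelet:
  assumes "A \<in> SL2Z"
  shows "wavelet_mat A = wavelet farey (underlying_edge A)"
proof -
  obtain a b c d where abcd: "a * d - b * c = 1" "A = mat2 (of_int a) (of_int b) (of_int c) (of_int d)"
    using SL2Z_entries[OF assms] .
  define v w where "v = (d, - c)" and "w = (- b, a)"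
  have uni: "unimodular v w" using abcd(1) by (simp add: unimodular_def v_def w_def algebra_simps)
  let ?L = "lattice_pt v w"
  note det = SL2Z_det[OF assms]
  have "wavelet_mat A = quad_field (?L 1 0) (?L (- 1) 1) (?L 0 1) (?L 1 1)"
    unfolding wavelet_mat_eq_quad_field[OF det] lattice_pt_ideal by (simp add: abcd(2) v_def w_def algebra_simps)
  also have "\<dots> = wavelet farey {?L 1 0, ?L 0 1}"
  proof (rule wavelet_eq_quad_field[symmetric, OF _ refl])
    show "ccw_quad (?L 1 0) (?L (- 1) 1) (?L 0 1) (?L 1 1)"
      using ccw_pentagon_quads(3)[OF lattice_pentagons(1)[OF uni]] .
    show "opposite farey {?L 1 0, ?L 0 1} = {?L (- 1) 1, ?L 1 1}"
      using opposite_lattice[OF uni, of 1 1 0 0] by simp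
  qed
  also have "{?L 1 0, ?L 0 1} = underlying_edge A"
    unfolding underlying_edge_eq[OF det] lattice_pt_ideal by (simp add: abcd(2) v_def w_def)
  finally show ?thesis .
qed

text \<open>
  An unoriented edge has two orientations, and each of them comes from exactly one element of
  PSL2(Z).  This explains the factor 1/2 in the sum over the group.
\<close>

lemma fibre_over_farey_edge:
  assumes "x \<in> farey"
  obtains g h where "g \<noteq> h" "{g \<in> PSL2Z. descend underlying_edge g = x} = {g, h}"
proof -
  obtain v1 v2 w1 w2 where vw: "v1 * w2 - v2 * w1 = 1" "x = {rational_pt v1 v2, rational_pt w1 w2}"
    using assms unfolding farey_iff by blast
  note prim = farey_edge_primitive[OF vw(1)]
  \<comment> \<open>B belongs to the basis (w, -v), that is, to the same edge with the opposite orientation.\<close>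
  define A where "A = mat2 (of_int w2) (of_int (- w1)) (of_int (- v2)) (of_int v1)"
  define B where "B = mat2 (of_int (- v2)) (of_int v1) (of_int (- w2)) (of_int w1)"
  have AB: "A \<in> SL2Z" "B \<in> SL2Z" unfolding A_def B_def by (rule SL2Z_mat2; use vw(1) in \<open>simp add: algebra_simps\<close>)+
  have desc: "descend underlying_edge {C, - C} = underlying_edge C" if "C \<in> SL2Z" for C
    using descend_eq underlying_edge_minus SL2Z_det[OF that] by blast
  have edge: "underlying_edge A = x" "underlying_edge B = x"
    unfolding underlying_edge_eq[OF SL2Z_det[OF AB(1)]] underlying_edge_eq[OF SL2Z_det[OF AB(2)]] vw(2) rational_pt_def
    using ideal_pt_minus[of "of_int v1" "of_int v2"]
    by (auto simp: A_def B_def)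
  have "A \<noteq> B" "A \<noteq> - B"
    using vw(1) unfolding A_def B_def uminus_mat2 mat2_eq_iff by auto
  then have "{A, - A} \<noteq> {B, - B}" by (auto simp: doubleton_eq_iff)
  moreover have "{g \<in> PSL2Z. descend underlying_edge g = x} = {{A, - A}, {B, - B}}"
  proof (intro equalityI subsetI)
    fix g assume "g \<in> {{A, - A}, {B, - B}}"
    then show "g \<in> {g \<in> PSL2Z. descend underlying_edge g = x}"
      using AB desc edge unfolding PSL2Z_def by auto
  next
    fix g assume "g \<in> {g \<in> PSL2Z. descend underlying_edge g = x}"
    then obtain C where C: "C \<in> SL2Z" "g = {C, - C}" "underlying_edge C = x"
      using desc unfolding PSL2Z_def by auto
    obtain a b c d where abcd: "a * d - b * c = 1" "C = mat2 (of_int a) (of_int b) (of_int c) (of_int d)"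
      using SL2Z_entries[OF C(1)] .
    have det: "d * a - (- c) * (- b) = 1" using abcd(1) by (simp add: algebra_simps)
    note prim' = farey_edge_primitive[OF det]
    have "{rational_pt d (- c), rational_pt (- b) a} = {rational_pt v1 v2, rational_pt w1 w2}"
      using C(3) unfolding underlying_edge_eq[OF SL2Z_det[OF C(1)]] vw(2) rational_pt_def by (simp add: abcd(2))
    then have "rational_pt d (- c) = rational_pt v1 v2 \<and> rational_pt (- b) a = rational_pt w1 w2 \<or>
       rational_pt d (- c) = rational_pt w1 w2 \<and> rational_pt (- b) a = rational_pt v1 v2"
      by (auto simp: doubleton_eq_iff)
    then have "(v1 = d \<and> v2 = - c \<or> v1 = - d \<and> v2 = c) \<and> (w1 = - b \<and> w2 = a \<or> w1 = b \<and> w2 = - a) \<or>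
       (w1 = d \<and> w2 = - c \<or> w1 = - d \<and> w2 = c) \<and> (v1 = - b \<and> v2 = a \<or> v1 = b \<and> v2 = - a)"
      using rational_pt_eqD[OF prim'(1) prim(1)] rational_pt_eqD[OF prim'(2) prim(2)]
        rational_pt_eqD[OF prim'(1) prim(2)] rational_pt_eqD[OF prim'(2) prim(1)] by auto
    then have "(v1 = d \<and> v2 = - c \<and> w1 = - b \<and> w2 = a) \<or> (v1 = - d \<and> v2 = c \<and> w1 = b \<and> w2 = - a) \<or>
       (w1 = d \<and> w2 = - c \<and> v1 = b \<and> v2 = - a) \<or> (w1 = - d \<and> w2 = c \<and> v1 = - b \<and> v2 = a)"
      using vw(1) abcd(1) by (elim disjE conjE) (simp_all add: algebra_simps)
    then have "C = A \<or> C = - A \<or> C = B \<or> C = - B"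
      unfolding abcd(2) A_def B_def uminus_mat2 by (elim disjE conjE) simp_all
    then show "g \<in> {{A, - A}, {B, - B}}" unfolding C(2) by auto
  qed
  ultimately show ?thesis by (rule that)
qed

lemma xi_PSL2Z_eq_xi:
  assumes "x \<in> farey"
  shows "xi_PSL2Z F x = xi F farey x"
proof -
  have "descend wavelet_mat g = wavelet farey x" if g: "g \<in> PSL2Z" "descend underlying_edge g = x" for g
  proof -
    obtain A where A: "A \<in> SL2Z" "g = {A, - A}" using g(1) unfolding PSL2Z_def by auto
    have minus: "underlying_edge (- A) = underlying_edge A" using underlying_edge_minus[OF SL2Z_det[OF A(1)]] .
    then have "underlying_edge A = x" using descend_eq[of underlying_edge A] g(2) A(2) by simp
    moreover have "descend wavelet_mat g = wavelet_mat A"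
      unfolding A(2) using wavelet_mat_eq_wavelet[OF A(1)] wavelet_mat_eq_wavelet[OF SL2Z_minus[OF A(1)]] minus
      by (intro descend_eq) simp
    ultimately show ?thesis using wavelet_mat_eq_wavelet[OF A(1)] by simp
  qed
  then have "(\<Sum>g\<in>{g \<in> PSL2Z. descend underlying_edge g = x}. normalize_at F (descend wavelet_mat g) z)
     = (\<Sum>g\<in>{g \<in> PSL2Z. descend underlying_edge g = x}. normalize_at F (wavelet farey x) z)" for z
    by (intro sum.cong) auto
  moreover obtain g h where "g \<noteq> h" "{g \<in> PSL2Z. descend underlying_edge g = x} = {g, h}"
    using fibre_over_farey_edge[OF assms] .
  ultimately show ?thesis unfolding xi_PSL2Z_def xi_def by auto
qed

lemma xi_in_ppsl2:
  assumes "F \<in> framings" "x \<in> farey"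
  shows "xi F farey x \<in> ppsl2"
proof -
  obtain p r q s where "x = {p, q}" "opposite farey x = {r, s}" "{p, r, q, s} \<subseteq> Qhat" "ccw_quad p r q s"
    using farey_quad[OF assms(2)] ccw_pentagon_quads(3) by metis
  then show ?thesis
    unfolding xi_def using wavelet_eq_quad_field normalized_quad_field_in_ppsl2 assms(1) by metis
qed

section \<open>Flip invariance\<close>

text \<open>
  With N the normalization, the new coefficients are N(s) + N(e)/2 at each side s and -N(e) at the new
  diagonal f, where N(e) is the coefficient of the old one.  Since dlog f is half the sum of the four
  dlog s minus dlog e, the terms with N(e) dlog s cancel and N(e) dlog e remains.
\<close>

lemma flip_invariant_xi:
  assumes F: "F \<in> framings" and e: "e \<in> farey"
  shows "flip_invariant (xi F) farey e"
proof -
  obtain p r q s m\<^sub>1 m\<^sub>2 m\<^sub>3 m\<^sub>4 where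
    e_eq: "e = {p, q}" and opp: "opposite farey e = {r, s}" and H: "harmonic p r q s" and Q: "{p, r, q, s} \<subseteq> Qhat"
    and pent: "ccw_pentagon p m\<^sub>1 r q s" "ccw_pentagon r m\<^sub>2 q s p"
      "ccw_pentagon q m\<^sub>3 s p r" "ccw_pentagon s m\<^sub>4 p r q"
    and opps: "opposite farey {p, r} = {q, m\<^sub>1}" "opposite farey {r, q} = {p, m\<^sub>2}"
      "opposite farey {q, s} = {p, m\<^sub>3}" "opposite farey {s, p} = {q, m\<^sub>4}"
    and common: "\<And>z. {r, z} \<in> farey \<Longrightarrow> {s, z} \<in> farey \<Longrightarrow> z \<in> {p, q}"
    using farey_quad[OF e] by metis
  have opp': "opposite farey {p, q} = {r, s}" using opp unfolding e_eq .
  define \<tau>' where "\<tau>' = flip farey e"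
  note quads = pent[THEN ccw_pentagon_quads(3)]
  have ne: "p \<noteq> r" "p \<noteq> q" "p \<noteq> s" "r \<noteq> q" "r \<noteq> s" "q \<noteq> s" using ccw_quad_distinct[OF quads(1)] by auto
  have m: "m\<^sub>1 \<noteq> q" "m\<^sub>2 \<noteq> p" "m\<^sub>3 \<noteq> p" "m\<^sub>4 \<noteq> q"
    using pent[THEN ccw_pentagon_quads(1), THEN ccw_quad_distinct] pent[THEN ccw_pentagon_quads(2), THEN ccw_quad_distinct] by auto
  have Hs: "harmonic r q s p" "harmonic q s p r" "harmonic s p r q"
    using H unfolding harmonic_def by (auto simp: add.commute)
  have sides: "sides farey e = {{p, r}, {r, q}, {q, s}, {s, p}}"
    unfolding sides_def opp unfolding e_eq by auto
  have in_farey: "{p, r} \<in> farey" "{r, q} \<in> farey" "{q, s} \<in> farey" "{s, p} \<in> farey"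
    using oppositeD[of r farey p q] oppositeD[of s farey p q] opp' by (auto simp: insert_commute)

  \<comment> \<open>After the flip the side p r borders the triangle p r s instead of p r q, and likewise for the others.\<close>
  have opp_sides: "opposite \<tau>' {p, r} = {m\<^sub>1, s}" "opposite \<tau>' {r, q} = {m\<^sub>2, s}"
    "opposite \<tau>' {q, s} = {m\<^sub>3, r}" "opposite \<tau>' {s, p} = {m\<^sub>4, r}"
  proof -
    have qp: "opposite farey {q, p} = {r, s}" using opp' by (simp add: insert_commute)
    have qp': "opposite farey {q, p} = {s, r}" "opposite farey {p, q} = {s, r}" using opp' by (simp_all add: insert_commute)
    have t: "\<tau>' = flip farey {p, q}" "\<tau>' = flip farey {q, p}" unfolding \<tau>'_def e_eq by (simp_all add: insert_commute)
    show "opposite \<tau>' {p, r} = {m\<^sub>1, s}"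
      unfolding t(1) opposite_flip_side[OF opp' ne(5)] opps(1) using m ne by auto
    have "opposite \<tau>' {q, r} = {m\<^sub>2, s}"
      unfolding t(2) opposite_flip_side[OF qp ne(5)] using opps(2) m ne by (auto simp: insert_commute)
    then show "opposite \<tau>' {r, q} = {m\<^sub>2, s}" by (simp add: insert_commute)
    show "opposite \<tau>' {q, s} = {m\<^sub>3, r}"
      unfolding t(2) opposite_flip_side[OF qp'(1) ne(5)[symmetric]] opps(3) using m ne by auto
    have "opposite \<tau>' {p, s} = {m\<^sub>4, r}"
      unfolding t(1) opposite_flip_side[OF qp'(2) ne(5)[symmetric]] using opps(4) m ne by (auto simp: insert_commute)
    then show "opposite \<tau>' {s, p} = {m\<^sub>4, r}" by (simp add: insert_commute)
  qed
  have opp_diagonal: "opposite \<tau>' {r, s} = {p, q}"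
    unfolding \<tau>'_def e_eq by (rule opposite_flip_diagonal[OF opp' ne(5) common])

  have diagonals: "wavelet farey e = quad_field p r q s" "wavelet \<tau>' {r, s} = quad_field r q s p"
    using wavelet_eq_quad_field[OF quads(1) e_eq opp] wavelet_eq_quad_field[OF quads(2) refl, of \<tau>'] opp_diagonal
    by (simp_all add: insert_commute)
  note old = pent[THEN ccw_pentagon_quads(1)] and new = pent[THEN ccw_pentagon_quads(2)]
  have old_opps: "opposite farey {p, r} = {m\<^sub>1, q}" "opposite farey {r, q} = {m\<^sub>2, p}"
    "opposite farey {q, s} = {m\<^sub>3, p}" "opposite farey {s, p} = {m\<^sub>4, q}"
    unfolding opps by (simp_all add: insert_commute)
  have side_wavelets:
    "wavelet farey {p, r} = quad_field p m\<^sub>1 r q" "wavelet \<tau>' {p, r} = quad_field p m\<^sub>1 r s"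
    "wavelet farey {r, q} = quad_field r m\<^sub>2 q p" "wavelet \<tau>' {r, q} = quad_field r m\<^sub>2 q s"
    "wavelet farey {q, s} = quad_field q m\<^sub>3 s p" "wavelet \<tau>' {q, s} = quad_field q m\<^sub>3 s r"
    "wavelet farey {s, p} = quad_field s m\<^sub>4 p q" "wavelet \<tau>' {s, p} = quad_field s m\<^sub>4 p r"
    by (rule wavelet_eq_quad_field[OF _ refl]; fact)+

  note side = quad_field_flip_side[OF pent(1) H] quad_field_flip_side[OF pent(2) Hs(1)]
    quad_field_flip_side[OF pent(3) Hs(2)] quad_field_flip_side[OF pent(4) Hs(3)]
  note rotate = quad_field_rotate[OF quads(1)] quad_field_rotate[OF quads(2)] quad_field_rotate[OF quads(3)]

  have norm_sides: "xi F \<tau>' x z = 1 * xi F farey x z + 1/2 * xi F farey e z" if "x \<in> sides farey e" for x z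
  proof -
    have "\<exists>Y\<in>sl2. \<forall>z. wavelet \<tau>' x z = 1 * wavelet farey x z + 1/2 * wavelet farey e z + field_of Y z"
    proof -
      \<comment> \<open>The remaining terms are multiples of translations, hence global fields, one for each side.\<close>
      have half: "\<exists>Y\<in>sl2. \<forall>z. k * transl y y' z = field_of Y z" if "y \<in> S1" "y' \<in> S1" "y \<noteq> y'" for y y' k
      proof -
        obtain X where "X \<in> sl2" "transl y y' = field_of X" using transl_in_sl2[OF \<open>y \<in> S1\<close> \<open>y' \<in> S1\<close> \<open>y \<noteq> y'\<close>] by metis
        then show ?thesis using field_of_linear[of k X 0 X] sl2_linear[of X X k 0] by (intro bexI[of _ "k *\<^sub>R X + 0 *\<^sub>R X"]) auto
      qed
      have S: "p \<in> S1" "r \<in> S1" "q \<in> S1" "s \<in> S1" using ccw_quad_S1[OF quads(1)] by auto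
      obtain Y1 where Y1: "Y1 \<in> sl2" "\<And>z. - 1/2 * transl p r z = field_of Y1 z" using half[OF S(1,2) ne(1)] by metis
      obtain Y2 where Y2: "Y2 \<in> sl2" "\<And>z. 1/2 * transl r q z = field_of Y2 z" using half[OF S(2,3) ne(4)] by metis
      obtain Y3 where Y3: "Y3 \<in> sl2" "\<And>z. - 1/2 * transl q s z = field_of Y3 z" using half[OF S(3,4) ne(6)] by metis
      obtain Y4 where Y4: "Y4 \<in> sl2" "\<And>z. 1/2 * transl s p z = field_of Y4 z" using half[OF S(4,1) ne(3)[symmetric]] by metis
      have "wavelet \<tau>' {p, r} z = 1 * wavelet farey {p, r} z + 1/2 * wavelet farey e z + field_of Y1 z" for z
        unfolding side_wavelets diagonals Y1(2)[symmetric] using side(1)[of z] by simp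
      moreover have "wavelet \<tau>' {r, q} z = 1 * wavelet farey {r, q} z + 1/2 * wavelet farey e z + field_of Y2 z" for z
        unfolding side_wavelets diagonals Y2(2)[symmetric] using side(2)[of z] rotate(1)[of z] by simp
      moreover have "wavelet \<tau>' {q, s} z = 1 * wavelet farey {q, s} z + 1/2 * wavelet farey e z + field_of Y3 z" for z
        unfolding side_wavelets diagonals Y3(2)[symmetric] using side(3)[of z] rotate(1,2)[of z] by simp
      moreover have "wavelet \<tau>' {s, p} z = 1 * wavelet farey {s, p} z + 1/2 * wavelet farey e z + field_of Y4 z" for z
        unfolding side_wavelets diagonals Y4(2)[symmetric] using side(4)[of z] rotate(1,2,3)[of z] by simp
      moreover have "x = {p, r} \<or> x = {r, q} \<or> x = {q, s} \<or> x = {s, p}" using \<open>x \<in> sides farey e\<close> unfolding sides by blast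
      ultimately show ?thesis using Y1(1) Y2(1) Y3(1) Y4(1) by blast
    qed
    then show ?thesis unfolding xi_def using normalize_at_linear[OF F] by blast
  qed
  have norm_diagonal: "xi F \<tau>' {r, s} z = - xi F farey e z" for z
  proof -
    have zero: "0 \<in> sl2" by (simp add: sl2_iff)
    have negate: "wavelet \<tau>' {r, s} z = (- 1) * wavelet farey e z + 0 * wavelet farey e z + field_of 0 z" for z
      unfolding diagonals using rotate(1)[of z] by (simp add: field_of_def)
    show ?thesis unfolding xi_def using normalize_at_linear[OF F zero negate, of z] by simp
  qed

  have "xi F \<tau>' x = xi F farey x" if x: "x \<in> farey - insert e (sides farey e)" for x
  proof -
    have "x \<in> farey" using x by blast
    then obtain v1 v2 w1 w2 where vw: "v1 * w2 - v2 * w1 = 1" "x = {rational_pt v1 v2, rational_pt w1 w2}"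
      unfolding farey_iff by blast
    have "rational_pt v1 v2 \<noteq> rational_pt w1 w2"
      using rational_pt_eq_iff[OF farey_edge_primitive[OF vw(1)]] vw(1) by auto
    then have "opposite \<tau>' x = opposite farey x"
      using opposite_flip_other[OF opp' ne(5) common, of "rational_pt v1 v2" "rational_pt w1 w2"] x
      unfolding \<tau>'_def e_eq vw(2) by blast
    then show ?thesis unfolding xi_def using wavelet_cong by metis
  qed
  moreover have "(\<lambda>z. \<Sum>x\<in>insert e (sides farey e). xi F farey x z * dlog_lambda x c) =
          (\<lambda>z. \<Sum>x\<in>insert {r, s} (sides farey e). xi F \<tau>' x z * dlog_lambda x c)"
    if c: "c \<in> curves_at_identity" for c
  proof
    fix z
    define E where "E = xi F farey e z"
    have dlog: "dlog_lambda {r, s} c = 1/2 * (dlog_lambda {p, r} c + dlog_lambda {r, q} c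
           + dlog_lambda {q, s} c + dlog_lambda {s, p} c) - dlog_lambda e c"
      using dlog_lambda_diagonal[OF c quads(1) Q] e in_farey unfolding e_eq by blast
    have sum4: "(\<Sum>x\<in>sides farey e. g x) = g {p, r} + g {r, q} + g {q, s} + g {s, p}" for g :: "complex set \<Rightarrow> real"
      unfolding sides using ne by (simp add: doubleton_eq_iff)
    have fin: "finite (sides farey e)" "e \<notin> sides farey e" "{r, s} \<notin> sides farey e"
      unfolding sides unfolding e_eq using ne by (auto simp: doubleton_eq_iff)
    have "(\<Sum>x\<in>insert {r, s} (sides farey e). xi F \<tau>' x z * dlog_lambda x c)
        = - E * dlog_lambda {r, s} c + (\<Sum>x\<in>sides farey e. (xi F farey x z + 1/2 * E) * dlog_lambda x c)"
      using fin norm_sides unfolding E_def by (simp add: norm_diagonal)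
    also have "\<dots> = E * dlog_lambda e c + (\<Sum>x\<in>sides farey e. xi F farey x z * dlog_lambda x c)"
      unfolding sum4 dlog by (simp add: algebra_simps)
    also have "\<dots> = (\<Sum>x\<in>insert e (sides farey e). xi F farey x z * dlog_lambda x c)"
      using fin unfolding E_def by simp
    finally show "(\<Sum>x\<in>insert e (sides farey e). xi F farey x z * dlog_lambda x c) =
      (\<Sum>x\<in>insert {r, s} (sides farey e). xi F \<tau>' x z * dlog_lambda x c)" by simp
  qed
  ultimately show ?thesis
    unfolding flip_invariant_def Let_def opp \<tau>'_def by blast
qed

theorem theorem7p1:
  fixes F :: "complex \<times> complex \<times> complex"
  assumes "F \<in> framings"
  shows "(\<forall>x\<in>farey. xi_PSL2Z F x = xi F farey x \<and> xi F farey x \<in> ppsl2) \<and>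
         (\<forall>e\<in>farey. flip_invariant (xi F) farey e)"
  using xi_PSL2Z_eq_xi xi_in_ppsl2[OF assms] flip_invariant_xi[OF assms] by blast

end
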